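(* The class of left depth two extensions is Morita invariant, and the class of right depth two extensions is Morita invariant: if $A/B$ is left (resp. right) depth two and $A/B$ is Morita equivalent to $A'/B'$, then $A'/B'$ is left (resp. right) depth two.
   Context: All rings have identity, subrings contain the identity, modules are unital; a ring extension $A/B$ means $B$ is a subring of $A$. For bimodules ${}_RX_{T}$, ${}_RY_{T}$, write $X\mid Y$ if $X$ is isomorphic (as $R$-$T$-bimodule) to a direct summand of a finite direct sum of copies of $Y$, and $X\sim Y$ if $X\mid Y$ and $Y\mid X$. $A/B$ is left depth two if ${}_BA\otimes_BA_A\mid{}_BA_A$, and right depth two if ${}_AA\otimes_BA_B\mid{}_AA_B$. $\mathrm{End}^r({}_AM)$ denotes the ring of left $A$-endomorphisms of $M$ acting on the right. A bimodule ${}_AM_{A'}$ is a Morita module if ${}_AM\sim{}_AA$ and $\mathrm{End}^r({}_AM)=A'$. Ring extensions $A/B$ and $A'/B'$ are Morita equivalent if there exist Morita modules ${}_AM_{A'}$ and ${}_BN_{B'}$ with ${}_AA\otimes_BN_{B'}\cong{}_AM_{B'}$. A class $\mathscr C$ is Morita invariant if whenever $A/B\in\mathscr C$ and $A/B$ is Morita equivalent to $A'/B'$, then $A'/B'\in\mathscr C$. *)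

theory Defs
  imports "HOL-Algebra.Algebra"
begin

record ('r, 's, 'x) bimod =
  mcarrier :: "'x set"
  madd :: "'x \<Rightarrow> 'x \<Rightarrow> 'x"
  mzero :: 'x
  lsmult :: "'r \<Rightarrow> 'x \<Rightarrow> 'x"
  rsmult :: "'x \<Rightarrow> 's \<Rightarrow> 'x"

definition abgrp_part :: "('r, 's, 'x) bimod \<Rightarrow> bool" where
  "abgrp_part Xm \<longleftrightarrow>
     mzero Xm \<in> mcarrier Xm \<and>
     (\<forall>x\<in>mcarrier Xm. \<forall>y\<in>mcarrier Xm. madd Xm x y \<in> mcarrier Xm) \<and>
     (\<forall>x\<in>mcarrier Xm. \<forall>y\<in>mcarrier Xm. \<forall>z\<in>mcarrier Xm.
        madd Xm (madd Xm x y) z = madd Xm x (madd Xm y z)) \<and>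
     (\<forall>x\<in>mcarrier Xm. \<forall>y\<in>mcarrier Xm. madd Xm x y = madd Xm y x) \<and>
     (\<forall>x\<in>mcarrier Xm. madd Xm (mzero Xm) x = x) \<and>
     (\<forall>x\<in>mcarrier Xm. \<exists>y\<in>mcarrier Xm. madd Xm x y = mzero Xm)"

definition leftmod :: "'r ring \<Rightarrow> ('r, 's, 'x) bimod \<Rightarrow> bool" where
  "leftmod R Xm \<longleftrightarrow> ring R \<and> abgrp_part Xm \<and>
     (\<forall>r\<in>carrier R. \<forall>x\<in>mcarrier Xm. lsmult Xm r x \<in> mcarrier Xm) \<and>
     (\<forall>r\<in>carrier R. \<forall>x\<in>mcarrier Xm. \<forall>y\<in>mcarrier Xm.
        lsmult Xm r (madd Xm x y) = madd Xm (lsmult Xm r x) (lsmult Xm r y)) \<and>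
     (\<forall>r\<in>carrier R. \<forall>r'\<in>carrier R. \<forall>x\<in>mcarrier Xm.
        lsmult Xm (r \<oplus>\<^bsub>R\<^esub> r') x = madd Xm (lsmult Xm r x) (lsmult Xm r' x)) \<and>
     (\<forall>r\<in>carrier R. \<forall>r'\<in>carrier R. \<forall>x\<in>mcarrier Xm.
        lsmult Xm (r \<otimes>\<^bsub>R\<^esub> r') x = lsmult Xm r (lsmult Xm r' x)) \<and>
     (\<forall>x\<in>mcarrier Xm. lsmult Xm \<one>\<^bsub>R\<^esub> x = x)"

definition rightmod :: "'s ring \<Rightarrow> ('r, 's, 'x) bimod \<Rightarrow> bool" where
  "rightmod S Xm \<longleftrightarrow> ring S \<and> abgrp_part Xm \<and>
     (\<forall>s\<in>carrier S. \<forall>x\<in>mcarrier Xm. rsmult Xm x s \<in> mcarrier Xm) \<and>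
     (\<forall>s\<in>carrier S. \<forall>x\<in>mcarrier Xm. \<forall>y\<in>mcarrier Xm.
        rsmult Xm (madd Xm x y) s = madd Xm (rsmult Xm x s) (rsmult Xm y s)) \<and>
     (\<forall>s\<in>carrier S. \<forall>s'\<in>carrier S. \<forall>x\<in>mcarrier Xm.
        rsmult Xm x (s \<oplus>\<^bsub>S\<^esub> s') = madd Xm (rsmult Xm x s) (rsmult Xm x s')) \<and>
     (\<forall>s\<in>carrier S. \<forall>s'\<in>carrier S. \<forall>x\<in>mcarrier Xm.
        rsmult Xm x (s \<otimes>\<^bsub>S\<^esub> s') = rsmult Xm (rsmult Xm x s) s') \<and>
     (\<forall>x\<in>mcarrier Xm. rsmult Xm x \<one>\<^bsub>S\<^esub> = x)"

definition bimodule :: "'r ring \<Rightarrow> 's ring \<Rightarrow> ('r, 's, 'x) bimod \<Rightarrow> bool" where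
  "bimodule R S Xm \<longleftrightarrow> leftmod R Xm \<and> rightmod S Xm \<and>
     (\<forall>r\<in>carrier R. \<forall>x\<in>mcarrier Xm. \<forall>s\<in>carrier S.
        rsmult Xm (lsmult Xm r x) s = lsmult Xm r (rsmult Xm x s))"

definition lhom :: "'r ring \<Rightarrow> ('r, 's, 'x) bimod \<Rightarrow> ('r, 't, 'y) bimod \<Rightarrow> ('x \<Rightarrow> 'y) \<Rightarrow> bool" where
  "lhom R Xm Ym f \<longleftrightarrow>
     (\<forall>x\<in>mcarrier Xm. f x \<in> mcarrier Ym) \<and>
     (\<forall>x\<in>mcarrier Xm. \<forall>y\<in>mcarrier Xm. f (madd Xm x y) = madd Ym (f x) (f y)) \<and>
     (\<forall>r\<in>carrier R. \<forall>x\<in>mcarrier Xm. f (lsmult Xm r x) = lsmult Ym r (f x))"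

definition bhom :: "'r ring \<Rightarrow> 's ring \<Rightarrow> ('r, 's, 'x) bimod \<Rightarrow> ('r, 's, 'y) bimod \<Rightarrow> ('x \<Rightarrow> 'y) \<Rightarrow> bool" where
  "bhom R S Xm Ym f \<longleftrightarrow> lhom R Xm Ym f \<and>
     (\<forall>s\<in>carrier S. \<forall>x\<in>mcarrier Xm. f (rsmult Xm x s) = rsmult Ym (f x) s)"

definition biso :: "'r ring \<Rightarrow> 's ring \<Rightarrow> ('r, 's, 'x) bimod \<Rightarrow> ('r, 's, 'y) bimod \<Rightarrow> ('x \<Rightarrow> 'y) \<Rightarrow> bool" where
  "biso R S Xm Ym f \<longleftrightarrow> bhom R S Xm Ym f \<and> bij_betw f (mcarrier Xm) (mcarrier Ym)"

definition bm_pow :: "('r, 's, 'y) bimod \<Rightarrow> nat \<Rightarrow> ('r, 's, nat \<Rightarrow> 'y) bimod" where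
  "bm_pow Ym n =
     \<lparr> mcarrier = {v. (\<forall>i<n. v i \<in> mcarrier Ym) \<and> (\<forall>i\<ge>n. v i = mzero Ym)},
       madd = (\<lambda>v w i. if i < n then madd Ym (v i) (w i) else mzero Ym),
       mzero = (\<lambda>i. mzero Ym),
       lsmult = (\<lambda>r v i. if i < n then lsmult Ym r (v i) else mzero Ym),
       rsmult = (\<lambda>v s i. if i < n then rsmult Ym (v i) s else mzero Ym) \<rparr>"

text \<open>Xm | Ym for left R-modules: Xm is isomorphic to a direct summand of Ym^n for some n.\<close>
definition ldvd :: "'r ring \<Rightarrow> ('r, 's, 'x) bimod \<Rightarrow> ('r, 't, 'y) bimod \<Rightarrow> bool" where
  "ldvd R Xm Ym \<longleftrightarrow> (\<exists>n f g. lhom R Xm (bm_pow Ym n) f \<and> lhom R (bm_pow Ym n) Xm g \<and>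
                        (\<forall>x\<in>mcarrier Xm. g (f x) = x))"

definition lsim :: "'r ring \<Rightarrow> ('r, 's, 'x) bimod \<Rightarrow> ('r, 't, 'y) bimod \<Rightarrow> bool" where
  "lsim R Xm Ym \<longleftrightarrow> ldvd R Xm Ym \<and> ldvd R Ym Xm"

definition bdvd :: "'r ring \<Rightarrow> 's ring \<Rightarrow> ('r, 's, 'x) bimod \<Rightarrow> ('r, 's, 'y) bimod \<Rightarrow> bool" where
  "bdvd R S Xm Ym \<longleftrightarrow> (\<exists>n f g. bhom R S Xm (bm_pow Ym n) f \<and> bhom R S (bm_pow Ym n) Xm g \<and>
                          (\<forall>x\<in>mcarrier Xm. g (f x) = x))"

definition ring_bimod :: "'a ring \<Rightarrow> ('a, 'a, 'a) bimod" where
  "ring_bimod A = \<lparr> mcarrier = carrier A, madd = Ring.ring.add A, mzero = Ring.ring.zero A,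
                     lsmult = Group.monoid.mult A, rsmult = Group.monoid.mult A \<rparr>"

abbreviation subr :: "'a ring \<Rightarrow> 'a set \<Rightarrow> 'a ring" where
  "subr A B \<equiv> A\<lparr>carrier := B\<rparr>"

section \<open>Tensor product Xm \<otimes>_T Ym (free abelian group modulo balanced relations)\<close>

definition tfree :: "('r, 't, 'x) bimod \<Rightarrow> ('t, 's, 'y) bimod \<Rightarrow> ('x \<times> 'y \<Rightarrow> int) set" where
  "tfree Xm Ym = {f. finite {p. f p \<noteq> 0} \<and> {p. f p \<noteq> 0} \<subseteq> mcarrier Xm \<times> mcarrier Ym}"

definition tdelta :: "'p \<Rightarrow> 'p \<Rightarrow> int" where
  "tdelta p = (\<lambda>q. if q = p then 1 else 0)"

definition trel :: "'t ring \<Rightarrow> ('r, 't, 'x) bimod \<Rightarrow> ('t, 's, 'y) bimod \<Rightarrow> ('x \<times> 'y \<Rightarrow> int) set" where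
  "trel T Xm Ym =
     {tdelta (madd Xm x x', y) - tdelta (x, y) - tdelta (x', y) | x x' y.
        x \<in> mcarrier Xm \<and> x' \<in> mcarrier Xm \<and> y \<in> mcarrier Ym} \<union>
     {tdelta (x, madd Ym y y') - tdelta (x, y) - tdelta (x, y') | x y y'.
        x \<in> mcarrier Xm \<and> y \<in> mcarrier Ym \<and> y' \<in> mcarrier Ym} \<union>
     {tdelta (rsmult Xm x t, y) - tdelta (x, lsmult Ym t y) | x t y.
        x \<in> mcarrier Xm \<and> t \<in> carrier T \<and> y \<in> mcarrier Ym}"

inductive_set tker :: "'t ring \<Rightarrow> ('r, 't, 'x) bimod \<Rightarrow> ('t, 's, 'y) bimod \<Rightarrow> ('x \<times> 'y \<Rightarrow> int) set"
  for T Xm Ym where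
  tker_zero: "(\<lambda>_. 0) \<in> tker T Xm Ym"
| tker_rel: "r \<in> trel T Xm Ym \<Longrightarrow> r \<in> tker T Xm Ym"
| tker_diff: "f \<in> tker T Xm Ym \<Longrightarrow> g \<in> tker T Xm Ym \<Longrightarrow> (\<lambda>p. f p - g p) \<in> tker T Xm Ym"

definition tcls :: "'t ring \<Rightarrow> ('r, 't, 'x) bimod \<Rightarrow> ('t, 's, 'y) bimod \<Rightarrow> ('x \<times> 'y \<Rightarrow> int) \<Rightarrow> ('x \<times> 'y \<Rightarrow> int) set" where
  "tcls T Xm Ym f = {g \<in> tfree Xm Ym. (\<lambda>p. g p - f p) \<in> tker T Xm Ym}"

definition trep :: "('p \<Rightarrow> int) set \<Rightarrow> ('p \<Rightarrow> int)" where
  "trep C = (SOME f. f \<in> C)"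

definition tlfree :: "('r, 't, 'x) bimod \<Rightarrow> 'r \<Rightarrow> ('x \<times> 'y \<Rightarrow> int) \<Rightarrow> ('x \<times> 'y \<Rightarrow> int)" where
  "tlfree Xm r f = (\<lambda>p. \<Sum>q\<in>{q. f q \<noteq> 0 \<and> (lsmult Xm r (fst q), snd q) = p}. f q)"

definition trfree :: "('t, 's, 'y) bimod \<Rightarrow> ('x \<times> 'y \<Rightarrow> int) \<Rightarrow> 's \<Rightarrow> ('x \<times> 'y \<Rightarrow> int)" where
  "trfree Ym f s = (\<lambda>p. \<Sum>q\<in>{q. f q \<noteq> 0 \<and> (fst q, rsmult Ym (snd q) s) = p}. f q)"

definition tens :: "'t ring \<Rightarrow> ('r, 't, 'x) bimod \<Rightarrow> ('t, 's, 'y) bimod \<Rightarrow> ('r, 's, ('x \<times> 'y \<Rightarrow> int) set) bimod" where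
  "tens T Xm Ym =
     \<lparr> mcarrier = tcls T Xm Ym ` tfree Xm Ym,
       madd = (\<lambda>C D. tcls T Xm Ym (\<lambda>p. trep C p + trep D p)),
       mzero = tcls T Xm Ym (\<lambda>_. 0),
       lsmult = (\<lambda>r C. tcls T Xm Ym (tlfree Xm r (trep C))),
       rsmult = (\<lambda>C s. tcls T Xm Ym (trfree Ym (trep C) s)) \<rparr>"

definition left_d2 :: "'a ring \<Rightarrow> 'a set \<Rightarrow> bool" where
  "left_d2 A B \<longleftrightarrow>
     bdvd (subr A B) A (tens (subr A B) (ring_bimod A) (ring_bimod A)) (ring_bimod A)"

definition right_d2 :: "'a ring \<Rightarrow> 'a set \<Rightarrow> bool" where
  "right_d2 A B \<longleftrightarrow>
     bdvd A (subr A B) (tens (subr A B) (ring_bimod A) (ring_bimod A)) (ring_bimod A)"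

text \<open>Morita module R M S: R M \<sim> R R and End^r(R M) = S, i.e. the right action
  s \<mapsto> (m \<mapsto> m s) is a bijection from S onto the left R-endomorphisms of M.\<close>
definition morita_module :: "'r ring \<Rightarrow> 's ring \<Rightarrow> ('r, 's, 'x) bimod \<Rightarrow> bool" where
  "morita_module R S M \<longleftrightarrow> bimodule R S M \<and> lsim R M (ring_bimod R) \<and>
     bij_betw (\<lambda>s. restrict (\<lambda>m. rsmult M m s) (mcarrier M)) (carrier S)
              {f. lhom R M M f \<and> f \<in> extensional (mcarrier M)}"

definition morita_equiv ::
  "'a ring \<Rightarrow> 'a set \<Rightarrow> 'b ring \<Rightarrow> 'b set \<Rightarrow> ('a, 'b, 'm) bimod \<Rightarrow> ('a, 'b, 'n) bimod \<Rightarrow> bool" where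
  "morita_equiv A B A' B' M N \<longleftrightarrow>
     morita_module A A' M \<and> morita_module (subr A B) (subr A' B') N \<and>
     (\<exists>f. biso A (subr A' B') (tens (subr A B) (ring_bimod A) N) M f)"

end

theory Submission
  imports Defs
begin

text \<open>
  Let \<open>\<iota> : N \<rightarrow> M\<close> be the map \<open>x \<mapsto> 1 \<otimes> x\<close> under \<open>A \<otimes>\<^sub>B N \<cong> M\<close>. Since \<open>A'\<close> is the endomorphism ring of
  \<open>M\<close>, the map \<open>c \<mapsto> \<iota>(-)c\<close> identifies \<open>A'\<close> with the left \<open>B\<close>-linear maps \<open>N \<rightarrow> M\<close>.

  Left (right) depth two says that there are \<open>B\<close>-\<open>B\<close>-linear \<open>\<beta>\<^sub>i : A \<rightarrow> A\<close> and \<open>B\<close>-central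
  \<open>t\<^sub>i \<in> A \<otimes>\<^sub>B A\<close> with \<open>a \<otimes> 1 = \<Sum>\<^sub>i t\<^sub>i \<beta>\<^sub>i(a)\<close> (respectively \<open>1 \<otimes> a = \<Sum>\<^sub>i \<beta>\<^sub>i(a) t\<^sub>i\<close>). Both kinds of data
  move to \<open>A'/B'\<close> by the same recipe. The map \<open>\<beta> \<otimes> N\<close> on \<open>A \<otimes>\<^sub>B N \<cong> M\<close> induces \<open>\<gamma> : A' \<rightarrow> A'\<close> through
  \<open>\<iota>(x)\<gamma>(c) = (\<beta> \<otimes> N)(\<iota>(x)c)\<close>. A tensor \<open>z \<in> A' \<otimes>\<^bsub>B'\<^esub> A'\<close> is the same as the family
  \<open>\<Theta>\<^bsub>\<iota>(x)\<^esub>(z) \<in> A \<otimes>\<^sub>B M\<close>, where \<open>\<Theta>\<^bsub>\<iota>(x)\<^esub>(c \<otimes> d) = \<Sum>\<^sub>r a\<^sub>r \<otimes> \<iota>(x\<^sub>r)d\<close> for \<open>\<iota>(x)c = \<Sum>\<^sub>r a\<^sub>r \<iota>(x\<^sub>r)\<close>; the inverse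
  is built from dual bases of the progenerator \<open>N\<close>. Let \<open>s\<close> be the tensor with
  \<open>\<Theta>\<^bsub>\<iota>(x)\<^esub>(s) = t \<cdot> \<iota>(x)\<close>. The equations for \<open>\<gamma>\<^sub>i, s\<^sub>i\<close> can then be checked after applying each
  \<open>\<Theta>\<^bsub>\<iota>(x)\<^esub>\<close>, where they reduce to those for \<open>\<beta>\<^sub>i, t\<^sub>i\<close>.
\<close>

section \<open>Additive maps and finite sums\<close>

definition addhom :: "('r, 's, 'x) bimod \<Rightarrow> ('t, 'u, 'y) bimod \<Rightarrow> ('x \<Rightarrow> 'y) \<Rightarrow> bool" where
  "addhom U Y f \<longleftrightarrow> (\<forall>x\<in>mcarrier U. f x \<in> mcarrier Y) \<and>
     (\<forall>x\<in>mcarrier U. \<forall>y\<in>mcarrier U. f (madd U x y) = madd Y (f x) (f y))"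

text \<open>Sums over initial segments of the naturals, formed from \<open>madd\<close> and
  \<open>mzero\<close> of the record itself, so that the same notion serves plain modules, powers
  and tensor products.\<close>

primrec msum :: "('r, 's, 'x) bimod \<Rightarrow> (nat \<Rightarrow> 'x) \<Rightarrow> nat \<Rightarrow> 'x" where
  "msum U f 0 = mzero U"
| "msum U f (Suc n) = madd U (msum U f n) (f n)"

lemma addhomI:
  assumes "\<And>x. x \<in> mcarrier U \<Longrightarrow> f x \<in> mcarrier Y"
    and "\<And>x y. x \<in> mcarrier U \<Longrightarrow> y \<in> mcarrier U \<Longrightarrow> f (madd U x y) = madd Y (f x) (f y)"
  shows "addhom U Y f"
  using assms by (simp add: addhom_def)

lemma addhom_closed: "addhom U Y f \<Longrightarrow> x \<in> mcarrier U \<Longrightarrow> f x \<in> mcarrier Y"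
  by (simp add: addhom_def)

lemma addhom_add:
  "addhom U Y f \<Longrightarrow> x \<in> mcarrier U \<Longrightarrow> y \<in> mcarrier U \<Longrightarrow> f (madd U x y) = madd Y (f x) (f y)"
  by (simp add: addhom_def)

lemma addhom_comp: "addhom U Y f \<Longrightarrow> addhom Y Z g \<Longrightarrow> addhom U Z (\<lambda>x. g (f x))"
  by (simp add: addhom_def)

lemma abgrp_zero_closed: "abgrp_part U \<Longrightarrow> mzero U \<in> mcarrier U"
  and abgrp_add_closed: "abgrp_part U \<Longrightarrow> x \<in> mcarrier U \<Longrightarrow> y \<in> mcarrier U \<Longrightarrow> madd U x y \<in> mcarrier U"
  and abgrp_assoc: "abgrp_part U \<Longrightarrow> x \<in> mcarrier U \<Longrightarrow> y \<in> mcarrier U \<Longrightarrow> z \<in> mcarrier U \<Longrightarrow>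
     madd U (madd U x y) z = madd U x (madd U y z)"
  and abgrp_comm: "abgrp_part U \<Longrightarrow> x \<in> mcarrier U \<Longrightarrow> y \<in> mcarrier U \<Longrightarrow> madd U x y = madd U y x"
  and abgrp_lzero: "abgrp_part U \<Longrightarrow> x \<in> mcarrier U \<Longrightarrow> madd U (mzero U) x = x"
  unfolding abgrp_part_def by blast+

lemma abgrp_rzero: "abgrp_part U \<Longrightarrow> x \<in> mcarrier U \<Longrightarrow> madd U x (mzero U) = x"
  by (metis abgrp_comm abgrp_lzero abgrp_zero_closed)

lemma abgrp_neg:
  assumes "abgrp_part U" "x \<in> mcarrier U"
  obtains y where "y \<in> mcarrier U" "madd U x y = mzero U"
  using assms unfolding abgrp_part_def by blast

text \<open>Adding an inverse of \<open>x\<close> to both sides of x + x = x. This is how additive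
  maps are seen to fix zero.\<close>

lemma abgrp_idem_zero:
  assumes U: "abgrp_part U" and x: "x \<in> mcarrier U" and idem: "madd U x x = x"
  shows "x = mzero U"
proof -
  obtain y where y: "y \<in> mcarrier U" "madd U x y = mzero U"
    using abgrp_neg[OF U x] .
  have "x = madd U x (madd U x y)" using U x y by (simp add: abgrp_rzero)
  also have "\<dots> = madd U (madd U x x) y" using U x y by (simp add: abgrp_assoc)
  finally show ?thesis using idem y by simp
qed

lemma abgrp_interchange:
  assumes U: "abgrp_part U"
    and "a \<in> mcarrier U" "b \<in> mcarrier U" "c \<in> mcarrier U" "d \<in> mcarrier U"
  shows "madd U (madd U a b) (madd U c d) = madd U (madd U a c) (madd U b d)"
proof -
  have "madd U b (madd U c d) = madd U c (madd U b d)"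
    using assms by (metis abgrp_assoc abgrp_comm)
  then show ?thesis using assms by (simp add: abgrp_assoc abgrp_add_closed)
qed

lemma addhom_zero:
  assumes "abgrp_part U" "abgrp_part Y" "addhom U Y f"
  shows "f (mzero U) = mzero Y"
  using assms by (metis abgrp_idem_zero abgrp_lzero abgrp_zero_closed addhom_add addhom_closed)

lemma msum_closed:
  "abgrp_part U \<Longrightarrow> (\<And>i. i < n \<Longrightarrow> f i \<in> mcarrier U) \<Longrightarrow> msum U f n \<in> mcarrier U"
  by (induction n) (auto simp: abgrp_zero_closed abgrp_add_closed)

lemma msum_cong: "(\<And>i. i < n \<Longrightarrow> f i = g i) \<Longrightarrow> msum U f n = msum U g n"
  by (induction n) auto

lemma msum_zero: "abgrp_part U \<Longrightarrow> msum U (\<lambda>i. mzero U) n = mzero U"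
  by (induction n) (auto simp: abgrp_lzero abgrp_zero_closed)

lemma addhom_msum:
  assumes "abgrp_part U" "abgrp_part Y" "addhom U Y f" "\<And>i. i < n \<Longrightarrow> g i \<in> mcarrier U"
  shows "f (msum U g n) = msum Y (\<lambda>i. f (g i)) n"
  using assms(4)
proof (induction n)
  case 0 then show ?case using assms by (simp add: addhom_zero)
next
  case (Suc n)
  then show ?case using assms(1-3) by (simp add: addhom_add msum_closed)
qed

lemma msum_add:
  assumes "abgrp_part U" "\<And>i. i < n \<Longrightarrow> f i \<in> mcarrier U" "\<And>i. i < n \<Longrightarrow> g i \<in> mcarrier U"
  shows "msum U (\<lambda>i. madd U (f i) (g i)) n = madd U (msum U f n) (msum U g n)"
  using assms(2,3)
proof (induction n)
  case 0 then show ?case using assms(1) by (simp add: abgrp_lzero abgrp_zero_closed)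
next
  case (Suc n)
  then show ?case using assms(1) by (simp add: abgrp_interchange msum_closed)
qed

lemma msum_swap:
  assumes "abgrp_part U" "\<And>i j. i < n \<Longrightarrow> j < m \<Longrightarrow> f i j \<in> mcarrier U"
  shows "msum U (\<lambda>i. msum U (f i) m) n = msum U (\<lambda>j. msum U (\<lambda>i. f i j) n) m"
  using assms(2)
proof (induction n)
  case 0 then show ?case using assms(1) by (simp add: msum_zero)
next
  case (Suc n)
  then show ?case using assms(1) by (simp add: msum_add msum_closed)
qed

lemma addhom_msum_fun:
  assumes "abgrp_part Y" "\<And>i. i < n \<Longrightarrow> addhom U Y (f i)"
  shows "addhom U Y (\<lambda>x. msum Y (\<lambda>i. f i x) n)"
proof (rule addhomI)
  fix x y assume xy: "x \<in> mcarrier U" "y \<in> mcarrier U"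
  have "msum Y (\<lambda>i. f i (madd U x y)) n = msum Y (\<lambda>i. madd Y (f i x) (f i y)) n"
    using assms xy by (intro msum_cong) (simp add: addhom_add)
  also have "\<dots> = madd Y (msum Y (\<lambda>i. f i x) n) (msum Y (\<lambda>i. f i y) n)"
    using assms xy by (intro msum_add) (auto intro: addhom_closed)
  finally show "msum Y (\<lambda>i. f i (madd U x y)) n = madd Y (msum Y (\<lambda>i. f i x) n) (msum Y (\<lambda>i. f i y) n)" .
qed (use assms in \<open>auto intro!: msum_closed intro: addhom_closed\<close>)

lemma addhom_add_fun:
  assumes "abgrp_part Y" "addhom U Y f" "addhom U Y g"
  shows "addhom U Y (\<lambda>x. madd Y (f x) (g x))"
  using assms by (intro addhomI) (auto simp: addhom_add addhom_closed abgrp_add_closed intro: abgrp_interchange)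

lemma lhom_addhom: "lhom R U Y f \<Longrightarrow> addhom U Y f"
  by (simp add: lhom_def addhom_def)

lemma bhom_addhom: "bhom R S U Y f \<Longrightarrow> addhom U Y f"
  by (simp add: bhom_def lhom_def addhom_def)

text \<open>The record \<open>bimod\<close> has no negation, so the vanishing of a difference is
  deduced from an equation of this shape.\<close>

lemma abgrp_cancel_zero:
  assumes U: "abgrp_part U" and x: "x \<in> mcarrier U" and y: "y \<in> mcarrier U" and eq: "madd U x y = y"
  shows "x = mzero U"
proof -
  obtain z where z: "z \<in> mcarrier U" "madd U y z = mzero U"
    using abgrp_neg[OF U y] .
  have "x = madd U x (madd U y z)" using U x z by (simp add: abgrp_rzero)
  also have "\<dots> = madd U (madd U x y) z" using U x y z by (simp add: abgrp_assoc)
  finally show ?thesis using eq z by simp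
qed

section \<open>Modules\<close>

lemma leftmod_abgrp: "leftmod R U \<Longrightarrow> abgrp_part U"
  and rightmod_abgrp: "rightmod S U \<Longrightarrow> abgrp_part U"
  by (simp_all add: leftmod_def rightmod_def)

lemma bimodule_left: "bimodule R S U \<Longrightarrow> leftmod R U"
  and bimodule_right: "bimodule R S U \<Longrightarrow> rightmod S U"
  by (simp_all add: bimodule_def)

lemma bimodule_abgrp: "bimodule R S U \<Longrightarrow> abgrp_part U"
  by (simp add: bimodule_def leftmod_def)

lemma leftmod_addhom: "leftmod R U \<Longrightarrow> r \<in> carrier R \<Longrightarrow> addhom U U (lsmult U r)"
  by (simp add: leftmod_def addhom_def)

lemma rightmod_addhom: "rightmod S U \<Longrightarrow> s \<in> carrier S \<Longrightarrow> addhom U U (\<lambda>x. rsmult U x s)"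
  by (simp add: rightmod_def addhom_def)

lemma leftmod_simps:
  assumes "leftmod R U"
  shows "r \<in> carrier R \<Longrightarrow> x \<in> mcarrier U \<Longrightarrow> lsmult U r x \<in> mcarrier U"
    and "r \<in> carrier R \<Longrightarrow> x \<in> mcarrier U \<Longrightarrow> y \<in> mcarrier U \<Longrightarrow>
       lsmult U r (madd U x y) = madd U (lsmult U r x) (lsmult U r y)"
    and "r \<in> carrier R \<Longrightarrow> r' \<in> carrier R \<Longrightarrow> x \<in> mcarrier U \<Longrightarrow>
       lsmult U (r \<oplus>\<^bsub>R\<^esub> r') x = madd U (lsmult U r x) (lsmult U r' x)"
    and "r \<in> carrier R \<Longrightarrow> r' \<in> carrier R \<Longrightarrow> x \<in> mcarrier U \<Longrightarrow>
       lsmult U (r \<otimes>\<^bsub>R\<^esub> r') x = lsmult U r (lsmult U r' x)"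
    and "x \<in> mcarrier U \<Longrightarrow> lsmult U \<one>\<^bsub>R\<^esub> x = x"
  using assms by (auto simp: leftmod_def)

lemma rightmod_simps:
  assumes "rightmod S U"
  shows "s \<in> carrier S \<Longrightarrow> x \<in> mcarrier U \<Longrightarrow> rsmult U x s \<in> mcarrier U"
    and "s \<in> carrier S \<Longrightarrow> x \<in> mcarrier U \<Longrightarrow> y \<in> mcarrier U \<Longrightarrow>
       rsmult U (madd U x y) s = madd U (rsmult U x s) (rsmult U y s)"
    and "s \<in> carrier S \<Longrightarrow> s' \<in> carrier S \<Longrightarrow> x \<in> mcarrier U \<Longrightarrow>
       rsmult U x (s \<oplus>\<^bsub>S\<^esub> s') = madd U (rsmult U x s) (rsmult U x s')"
    and "s \<in> carrier S \<Longrightarrow> s' \<in> carrier S \<Longrightarrow> x \<in> mcarrier U \<Longrightarrow>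
       rsmult U x (s \<otimes>\<^bsub>S\<^esub> s') = rsmult U (rsmult U x s) s'"
    and "x \<in> mcarrier U \<Longrightarrow> rsmult U x \<one>\<^bsub>S\<^esub> = x"
  using assms by (auto simp: rightmod_def)

lemma bimodule_assoc:
  "bimodule R S U \<Longrightarrow> r \<in> carrier R \<Longrightarrow> x \<in> mcarrier U \<Longrightarrow> s \<in> carrier S \<Longrightarrow>
     rsmult U (lsmult U r x) s = lsmult U r (rsmult U x s)"
  by (simp add: bimodule_def)

lemma ring_bimod_simps [simp]:
  "mcarrier (ring_bimod A) = carrier A" "madd (ring_bimod A) = Ring.ring.add A"
  "mzero (ring_bimod A) = Ring.ring.zero A" "lsmult (ring_bimod A) = Group.monoid.mult A"
  "rsmult (ring_bimod A) = Group.monoid.mult A"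
  by (simp_all add: ring_bimod_def)

lemma abgrp_ring_bimod:
  assumes "ring A" shows "abgrp_part (ring_bimod A)"
proof -
  interpret ring A by fact
  show ?thesis unfolding abgrp_part_def ring_bimod_simps
  proof (intro conjI ballI)
    show "\<exists>y\<in>carrier A. x \<oplus>\<^bsub>A\<^esub> y = \<zero>\<^bsub>A\<^esub>" if "x \<in> carrier A" for x
      using r_neg[OF that] a_inv_closed[OF that] by blast
  qed (simp_all add: a_assoc, simp add: a_comm)
qed

lemma bimodule_ring_bimod:
  assumes "ring A" shows "bimodule A A (ring_bimod A)"
proof -
  interpret ring A by fact
  show ?thesis using assms abgrp_ring_bimod[OF assms]
    by (auto simp: bimodule_def leftmod_def rightmod_def r_distr l_distr m_assoc)
qed

lemma leftmod_subring:
  assumes "ring R" "leftmod R U" "subring S R"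
  shows "leftmod (subr R S) U"
proof -
  have "ring (subr R S)" using assms(1,3) by (simp add: ring.subring_is_ring)
  moreover have "S \<subseteq> carrier R" using assms(3) by (rule subringE(1))
  ultimately show ?thesis using assms(2) unfolding leftmod_def by (simp add: subset_eq)
qed

lemma rightmod_subring:
  assumes "ring R" "rightmod R U" "subring S R"
  shows "rightmod (subr R S) U"
proof -
  have "ring (subr R S)" using assms(1,3) by (simp add: ring.subring_is_ring)
  moreover have "S \<subseteq> carrier R" using assms(3) by (rule subringE(1))
  ultimately show ?thesis using assms(2) unfolding rightmod_def by (simp add: subset_eq)
qed

lemma bimodule_subring_left:
  assumes "ring R" "bimodule R S U" "subring T R"
  shows "bimodule (subr R T) S U"
  using assms leftmod_subring[of R U T] subringE(1)[OF assms(3)] unfolding bimodule_def by auto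

lemma bimodule_subring_right:
  assumes "ring S" "bimodule R S U" "subring T S"
  shows "bimodule R (subr S T) U"
  using assms rightmod_subring[of S U T] subringE(1)[OF assms(3)] unfolding bimodule_def by auto

section \<open>Divisibility through families of maps\<close>

lemma abgrp_bm_pow:
  assumes "abgrp_part Y" shows "abgrp_part (bm_pow Y n)"
proof -
  have "\<exists>y\<in>mcarrier (bm_pow Y n). madd (bm_pow Y n) v y = mzero (bm_pow Y n)"
    if v: "v \<in> mcarrier (bm_pow Y n)" for v
  proof -
    have "v i \<in> mcarrier Y" if "i < n" for i
      using v that by (simp add: bm_pow_def)
    then have "\<exists>y\<in>mcarrier Y. madd Y (v i) y = mzero Y" if "i < n" for i
      using abgrp_neg[OF assms, of "v i"] that by blast
    then obtain w where w: "\<And>i. i < n \<Longrightarrow> w i \<in> mcarrier Y \<and> madd Y (v i) (w i) = mzero Y"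
      by metis
    \<comment> \<open>\<open>w\<close> is unconstrained from \<open>n\<close> on, whereas elements
      of \<open>bm_pow Y n\<close> must equal \<open>mzero Y\<close> there; hence the
      padding.\<close>
    show ?thesis
      by (rule bexI[of _ "\<lambda>i. if i < n then w i else mzero Y"]) (use w in \<open>auto simp: bm_pow_def\<close>)
  qed
  then show ?thesis using assms unfolding abgrp_part_def
    by (auto simp: bm_pow_def fun_eq_iff)
qed

definition binj :: "('r, 's, 'y) bimod \<Rightarrow> nat \<Rightarrow> 'y \<Rightarrow> nat \<Rightarrow> 'y" where
  "binj Y i y = (\<lambda>j. if j = i then y else mzero Y)"

lemma binj_addhom: "abgrp_part Y \<Longrightarrow> i < n \<Longrightarrow> addhom Y (bm_pow Y n) (binj Y i)"
  by (rule addhomI) (auto simp: binj_def bm_pow_def fun_eq_iff abgrp_lzero abgrp_zero_closed)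

lemma bm_pow_decomp:
  assumes Y: "abgrp_part Y" and v: "v \<in> mcarrier (bm_pow Y n)"
  shows "msum (bm_pow Y n) (\<lambda>i. binj Y i (v i)) n = v"
proof -
  \<comment> \<open>Generalised to partial sums: after \<open>k\<close> terms exactly the first
    \<open>k\<close> coordinates of \<open>v\<close> have been filled in.\<close>
  have *: "msum (bm_pow Y n) (\<lambda>i. binj Y i (v i)) k = (\<lambda>j. if j < k then v j else mzero Y)"
    if "k \<le> n" for k
    using that
  proof (induction k)
    case 0 show ?case by (simp add: bm_pow_def)
  next
    case (Suc k)
    then show ?case using Y v
      by (auto simp: bm_pow_def binj_def fun_eq_iff abgrp_lzero abgrp_rzero abgrp_zero_closed)
  qed
  show ?thesis using *[of n] v by (auto simp: bm_pow_def fun_eq_iff)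
qed

lemma pow_hom_decomp:
  assumes "abgrp_part U" "abgrp_part Y" "addhom (bm_pow Y n) U g" "v \<in> mcarrier (bm_pow Y n)"
  shows "g v = msum U (\<lambda>i. g (binj Y i (v i))) n"
proof -
  have "g v = g (msum (bm_pow Y n) (\<lambda>i. binj Y i (v i)) n)"
    using assms by (simp add: bm_pow_decomp)
  also have "\<dots> = msum U (\<lambda>i. g (binj Y i (v i))) n"
  proof (rule addhom_msum[OF abgrp_bm_pow[OF assms(2)] assms(1,3)])
    show "binj Y i (v i) \<in> mcarrier (bm_pow Y n)" if "i < n" for i
      using addhom_closed[OF binj_addhom[OF assms(2) that]] assms(4) that by (simp add: bm_pow_def)
  qed
  finally show ?thesis .
qed

text \<open>The two maps of a splitting are composed with the coordinate projections and inclusions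
  of \<open>bm_pow Y n\<close>. The sum of inclusions after projections is the identity of the
  power, which gives the last equation.\<close>

lemma ldvd_family:
  assumes U: "leftmod R U" and Y: "leftmod R Y" and "ldvd R U Y"
  shows "\<exists>(n::nat) f g. (\<forall>i<n. lhom R U Y (f i) \<and> lhom R Y U (g i)) \<and>
    (\<forall>x\<in>mcarrier U. msum U (\<lambda>i. g i (f i x)) n = x)"
proof -
  obtain n F G where F: "lhom R U (bm_pow Y n) F" and G: "lhom R (bm_pow Y n) U G"
    and GF: "\<And>x. x \<in> mcarrier U \<Longrightarrow> G (F x) = x"
    using assms(3) by (auto simp: ldvd_def)
  have ab: "abgrp_part U" "abgrp_part Y" using U Y by (simp_all add: leftmod_abgrp)
  show ?thesis
  proof (intro exI[of _ n] exI[of _ "\<lambda>i x. F x i"] exI[of _ "\<lambda>i y. G (binj Y i y)"] conjI allI impI ballI)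
    show "lhom R U Y (\<lambda>x. F x i)" if "i < n" for i
      using F that by (auto simp: lhom_def bm_pow_def)
    show "lhom R Y U (\<lambda>y. G (binj Y i y))" if "i < n" for i
    proof -
      \<comment> \<open>Off the coordinate \<open>i\<close> the inclusion puts
        \<open>mzero Y\<close>, so it commutes with scalars only because these fix zero.\<close>
      have z: "lsmult Y r (mzero Y) = mzero Y" if "r \<in> carrier R" for r
        using addhom_zero[OF ab(2) ab(2) leftmod_addhom[OF Y that]] .
      have i: "binj Y i y \<in> mcarrier (bm_pow Y n)" if "y \<in> mcarrier Y" for y
        using addhom_closed[OF binj_addhom[OF ab(2) \<open>i < n\<close>]] that .
      have "binj Y i (lsmult Y r y) = lsmult (bm_pow Y n) r (binj Y i y)" if "r \<in> carrier R" for r y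
        using z[OF that] \<open>i < n\<close> by (auto simp: binj_def bm_pow_def fun_eq_iff)
      then have "G (binj Y i (lsmult Y r y)) = lsmult U r (G (binj Y i y))"
        if "r \<in> carrier R" "y \<in> mcarrier Y" for r y
        using G i that by (simp add: lhom_def)
      moreover have "addhom Y U (\<lambda>y. G (binj Y i y))"
        using addhom_comp[OF binj_addhom[OF ab(2) \<open>i < n\<close>] lhom_addhom[OF G]] .
      ultimately show ?thesis by (simp add: lhom_def addhom_def)
    qed
    show "msum U (\<lambda>i. G (binj Y i (F x i))) n = x" if "x \<in> mcarrier U" for x
      using pow_hom_decomp[OF ab lhom_addhom[OF G], of "F x"] F GF that
      by (simp add: lhom_def)
  qed
qed

lemma bdvd_family:
  assumes U: "bimodule R S U" and Y: "bimodule R S Y" and "bdvd R S U Y"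
  shows "\<exists>(n::nat) f g. (\<forall>i<n. bhom R S U Y (f i) \<and> bhom R S Y U (g i)) \<and>
    (\<forall>x\<in>mcarrier U. msum U (\<lambda>i. g i (f i x)) n = x)"
proof -
  obtain n F G where F: "bhom R S U (bm_pow Y n) F" and G: "bhom R S (bm_pow Y n) U G"
    and GF: "\<And>x. x \<in> mcarrier U \<Longrightarrow> G (F x) = x"
    using assms(3) by (auto simp: bdvd_def)
  have ab: "abgrp_part U" "abgrp_part Y" using U Y by (simp_all add: bimodule_abgrp)
  show ?thesis
  proof (intro exI[of _ n] exI[of _ "\<lambda>i x. F x i"] exI[of _ "\<lambda>i y. G (binj Y i y)"] conjI allI impI ballI)
    show "bhom R S U Y (\<lambda>x. F x i)" if "i < n" for i
      using F that by (auto simp: bhom_def lhom_def bm_pow_def)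
    show "bhom R S Y U (\<lambda>y. G (binj Y i y))" if "i < n" for i
    proof -
      have z: "lsmult Y r (mzero Y) = mzero Y" if "r \<in> carrier R" for r
        using addhom_zero[OF ab(2) ab(2) leftmod_addhom[OF bimodule_left[OF Y] that]] .
      have z': "rsmult Y (mzero Y) s = mzero Y" if "s \<in> carrier S" for s
        using addhom_zero[OF ab(2) ab(2) rightmod_addhom[OF bimodule_right[OF Y] that]] .
      have i: "binj Y i y \<in> mcarrier (bm_pow Y n)" if "y \<in> mcarrier Y" for y
        using addhom_closed[OF binj_addhom[OF ab(2) \<open>i < n\<close>]] that .
      have "binj Y i (lsmult Y r y) = lsmult (bm_pow Y n) r (binj Y i y)" if "r \<in> carrier R" for r y
        using z[OF that] \<open>i < n\<close> by (auto simp: binj_def bm_pow_def fun_eq_iff)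
      then have "G (binj Y i (lsmult Y r y)) = lsmult U r (G (binj Y i y))"
        if "r \<in> carrier R" "y \<in> mcarrier Y" for r y
        using G i that by (simp add: bhom_def lhom_def)
      moreover have "binj Y i (rsmult Y y s) = rsmult (bm_pow Y n) (binj Y i y) s" if "s \<in> carrier S" for s y
        using z'[OF that] \<open>i < n\<close> by (auto simp: binj_def bm_pow_def fun_eq_iff)
      then have "G (binj Y i (rsmult Y y s)) = rsmult U (G (binj Y i y)) s"
        if "s \<in> carrier S" "y \<in> mcarrier Y" for s y
        using G i that by (simp add: bhom_def)
      moreover have "addhom Y U (\<lambda>y. G (binj Y i y))"
        using addhom_comp[OF binj_addhom[OF ab(2) \<open>i < n\<close>] bhom_addhom[OF G]] .
      ultimately show ?thesis by (simp add: bhom_def lhom_def addhom_def)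
    qed
    show "msum U (\<lambda>i. G (binj Y i (F x i))) n = x" if "x \<in> mcarrier U" for x
      using pow_hom_decomp[OF ab bhom_addhom[OF G], of "F x"] F GF that
      by (simp add: bhom_def lhom_def)
  qed
qed

text \<open>Converse of \<open>bdvd_family\<close>: the \<open>f i\<close> are the coordinates of a
  map into the power, and the \<open>g i\<close> are summed on the way back.\<close>

lemma bdvdI:
  assumes U: "bimodule R S U" and Y: "bimodule R S Y"
    and f: "\<And>i. i < (n::nat) \<Longrightarrow> bhom R S U Y (f i)" and g: "\<And>i. i < n \<Longrightarrow> bhom R S Y U (g i)"
    and gf: "\<And>x. x \<in> mcarrier U \<Longrightarrow> msum U (\<lambda>i. g i (f i x)) n = x"
  shows "bdvd R S U Y"
proof -
  have ab: "abgrp_part U" "abgrp_part Y" using U Y by (simp_all add: bimodule_abgrp)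
  define F where "F x = (\<lambda>i. if i < n then f i x else mzero Y)" for x
  define G where "G v = msum U (\<lambda>i. g i (v i)) n" for v
  have v: "v i \<in> mcarrier Y" if "v \<in> mcarrier (bm_pow Y n)" "i < n" for v i
    using that by (simp add: bm_pow_def)
  have gc: "g i (v i) \<in> mcarrier U" if "v \<in> mcarrier (bm_pow Y n)" "i < n" for v i
    using g[OF that(2)] v[OF that] by (simp add: bhom_def lhom_def)
  have "bhom R S U (bm_pow Y n) F"
    using f by (auto simp: bhom_def lhom_def bm_pow_def F_def fun_eq_iff)
  moreover have "bhom R S (bm_pow Y n) U G"
    unfolding bhom_def lhom_def
  proof (intro conjI ballI)
    fix u assume u: "u \<in> mcarrier (bm_pow Y n)"
    show "G u \<in> mcarrier U" unfolding G_def using gc[OF u] ab by (intro msum_closed)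
    show "G (lsmult (bm_pow Y n) r u) = lsmult U r (G u)" if r: "r \<in> carrier R" for r
    proof -
      have "G (lsmult (bm_pow Y n) r u) = msum U (\<lambda>i. lsmult U r (g i (u i))) n"
        unfolding G_def using g r v[OF u]
        by (intro msum_cong) (simp add: bm_pow_def bhom_def lhom_def)
      also have "\<dots> = lsmult U r (G u)" unfolding G_def
        using addhom_msum[OF ab(1) ab(1) leftmod_addhom[OF bimodule_left[OF U] r], of n "\<lambda>i. g i (u i)"] gc[OF u] by simp
      finally show ?thesis .
    qed
    show "G (rsmult (bm_pow Y n) u s) = rsmult U (G u) s" if s: "s \<in> carrier S" for s
    proof -
      have "G (rsmult (bm_pow Y n) u s) = msum U (\<lambda>i. rsmult U (g i (u i)) s) n"
        unfolding G_def using g s v[OF u]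
        by (intro msum_cong) (simp add: bm_pow_def bhom_def)
      also have "\<dots> = rsmult U (G u) s" unfolding G_def
        using addhom_msum[OF ab(1) ab(1) rightmod_addhom[OF bimodule_right[OF U] s], of n "\<lambda>i. g i (u i)"] gc[OF u] by simp
      finally show ?thesis .
    qed
    fix w assume w: "w \<in> mcarrier (bm_pow Y n)"
    have "G (madd (bm_pow Y n) u w) = msum U (\<lambda>i. madd U (g i (u i)) (g i (w i))) n"
      unfolding G_def using g v[OF u] v[OF w]
      by (intro msum_cong) (simp add: bm_pow_def bhom_def lhom_def)
    also have "\<dots> = madd U (G u) (G w)"
      unfolding G_def using gc[OF u] gc[OF w] ab by (intro msum_add)
    finally show "G (madd (bm_pow Y n) u w) = madd U (G u) (G w)" .
  qed
  moreover have "G (F x) = x" if "x \<in> mcarrier U" for x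
  proof -
    have "G (F x) = msum U (\<lambda>i. g i (f i x)) n" unfolding G_def F_def by (intro msum_cong) simp
    then show ?thesis using gf that by simp
  qed
  ultimately show ?thesis unfolding bdvd_def by blast
qed

section \<open>Tensor products\<close>

definition tpure :: "'t ring \<Rightarrow> ('r, 't, 'x) bimod \<Rightarrow> ('t, 's, 'y) bimod \<Rightarrow> 'x \<Rightarrow> 'y \<Rightarrow> ('x \<times> 'y \<Rightarrow> int) set" where
  "tpure T U Y x y = tcls T U Y (tdelta (x, y))"

text \<open>The target enters as an abelian group, so \<open>Z\<close> may carry scalars of any
  types; linearity of the induced maps is checked afterwards on pure tensors.\<close>

definition balanced :: "'t ring \<Rightarrow> ('r, 't, 'x) bimod \<Rightarrow> ('t, 's, 'y) bimod \<Rightarrow> ('p, 'q, 'z) bimod \<Rightarrow> ('x \<Rightarrow> 'y \<Rightarrow> 'z) \<Rightarrow> bool" where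
  "balanced T U Y Z h \<longleftrightarrow>
     (\<forall>y\<in>mcarrier Y. addhom U Z (\<lambda>x. h x y)) \<and> (\<forall>x\<in>mcarrier U. addhom Y Z (h x)) \<and>
     (\<forall>x\<in>mcarrier U. \<forall>t\<in>carrier T. \<forall>y\<in>mcarrier Y. h (rsmult U x t) y = h x (lsmult Y t y))"

lemma balancedI:
  assumes "\<And>y. y \<in> mcarrier Y \<Longrightarrow> addhom U Z (\<lambda>x. h x y)"
    and "\<And>x. x \<in> mcarrier U \<Longrightarrow> addhom Y Z (h x)"
    and "\<And>x t y. x \<in> mcarrier U \<Longrightarrow> t \<in> carrier T \<Longrightarrow> y \<in> mcarrier Y \<Longrightarrow>
       h (rsmult U x t) y = h x (lsmult Y t y)"
  shows "balanced T U Y Z h"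
  using assms by (simp add: balanced_def)

section \<open>Pushforward of integer functions with finite support\<close>

definition tpush :: "('p \<Rightarrow> 'q) \<Rightarrow> ('p \<Rightarrow> int) \<Rightarrow> 'q \<Rightarrow> int" where
  "tpush \<phi> f = (\<lambda>p. \<Sum>q\<in>{q. f q \<noteq> 0 \<and> \<phi> q = p}. f q)"

text \<open>Summing over a fixed finite set, with zero terms allowed, lets functions with different
  supports be combined termwise.\<close>

lemma tpush_superset:
  assumes "finite D" "{q. f q \<noteq> 0} \<subseteq> D"
  shows "tpush \<phi> f p = (\<Sum>q\<in>D. if \<phi> q = p then f q else 0)"
proof -
  have "tpush \<phi> f p = (\<Sum>q\<in>{q\<in>D. \<phi> q = p}. f q)"
    unfolding tpush_def using assms by (intro sum.mono_neutral_left) auto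
  also have "\<dots> = (\<Sum>q\<in>D. if \<phi> q = p then f q else 0)"
    using assms by (simp add: sum.inter_filter)
  finally show ?thesis .
qed

lemma tpush_diff:
  assumes "finite {q. f q \<noteq> 0}" "finite {q. g q \<noteq> 0}"
  shows "tpush \<phi> (\<lambda>p. f p - g p) = (\<lambda>p. tpush \<phi> f p - tpush \<phi> g p)"
proof
  fix p
  let ?D = "{q. f q \<noteq> 0} \<union> {q. g q \<noteq> 0}"
  have D: "finite ?D" using assms by simp
  have "tpush \<phi> (\<lambda>p. f p - g p) p = (\<Sum>q\<in>?D. if \<phi> q = p then f q - g q else 0)"
    by (rule tpush_superset[OF D]) auto
  also have "\<dots> = (\<Sum>q\<in>?D. (if \<phi> q = p then f q else 0) - (if \<phi> q = p then g q else 0))"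
    by (rule sum.cong) auto
  also have "\<dots> = tpush \<phi> f p - tpush \<phi> g p"
    by (subst (1 2) tpush_superset[OF D]) (auto simp: sum_subtractf)
  finally show "tpush \<phi> (\<lambda>p. f p - g p) p = tpush \<phi> f p - tpush \<phi> g p" .
qed

lemma tpush_support: "{p. tpush \<phi> f p \<noteq> 0} \<subseteq> \<phi> ` {q. f q \<noteq> 0}"
proof
  fix p assume "p \<in> {p. tpush \<phi> f p \<noteq> 0}"
  then have "{q. f q \<noteq> 0 \<and> \<phi> q = p} \<noteq> {}"
    unfolding tpush_def by (metis (mono_tags, lifting) mem_Collect_eq sum.empty)
  then show "p \<in> \<phi> ` {q. f q \<noteq> 0}" by auto
qed

lemma tdelta_support: "{q. tdelta p q \<noteq> 0} = {p}"
  by (auto simp: tdelta_def)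

lemma tpush_tdelta: "tpush \<phi> (tdelta p) = tdelta (\<phi> p)"
proof
  fix q
  have "tpush \<phi> (tdelta p) q = (\<Sum>r\<in>{p}. if \<phi> r = q then tdelta p r else 0)"
    by (rule tpush_superset) (simp_all add: tdelta_support)
  then show "tpush \<phi> (tdelta p) q = tdelta (\<phi> p) q" by (simp add: tdelta_def)
qed

lemma tpush_tdelta_diff: "tpush \<phi> (\<lambda>p. tdelta a p - tdelta b p) = (\<lambda>p. tdelta (\<phi> a) p - tdelta (\<phi> b) p)"
  by (subst tpush_diff) (simp_all add: tdelta_support tpush_tdelta)

lemma tpush_tdelta_diff2:
  "tpush \<phi> (\<lambda>p. tdelta a p - tdelta b p - tdelta c p) =
     (\<lambda>p. tdelta (\<phi> a) p - tdelta (\<phi> b) p - tdelta (\<phi> c) p)"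
proof (subst tpush_diff)
  show "finite {q. tdelta a q - tdelta b q \<noteq> 0}"
    by (rule finite_subset[of _ "{a, b}"]) (auto simp: tdelta_def)
qed (simp_all add: tdelta_support tpush_tdelta_diff tpush_tdelta)

text \<open>Both outer actions on formal sums are pushforwards along a map of pairs, so the facts
  about \<open>tpush\<close> serve both.\<close>

lemma tlfree_tpush: "tlfree U r f = tpush (\<lambda>q. (lsmult U r (fst q), snd q)) f"
  and trfree_tpush: "trfree Y f s = tpush (\<lambda>q. (fst q, rsmult Y (snd q) s)) f"
  by (simp_all add: tlfree_def trfree_def tpush_def)

section \<open>The tensor product as an abelian group, built from the two actions of
  \<open>T\<close>\<close>

locale tensor_pair =
  fixes T :: "'t ring" and U :: "('r, 't, 'x) bimod" and Y :: "('t, 's, 'y) bimod"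
  assumes rU: "rightmod T U" and lY: "leftmod T Y"
begin

abbreviation "D \<equiv> mcarrier U \<times> mcarrier Y"
abbreviation "F \<equiv> tfree U Y"
abbreviation "K \<equiv> tker T U Y"
abbreviation "W \<equiv> tens T U Y"
abbreviation "cl \<equiv> tcls T U Y"
abbreviation pure (infixl "\<odot>" 70) where "x \<odot> y \<equiv> tpure T U Y x y"

lemma abU: "abgrp_part U" and abY: "abgrp_part Y"
  using rU lY by (auto intro: rightmod_abgrp leftmod_abgrp)

lemma tfree_zero: "(\<lambda>_. 0) \<in> F"
  by (simp add: tfree_def)

lemma tfree_diff: "f \<in> F \<Longrightarrow> g \<in> F \<Longrightarrow> (\<lambda>p. f p - g p) \<in> F"
proof -
  assume "f \<in> F" "g \<in> F"
  moreover have sub: "{p. f p - g p \<noteq> 0} \<subseteq> {p. f p \<noteq> 0} \<union> {p. g p \<noteq> 0}" by auto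
  then have "finite {p. f p \<noteq> 0} \<Longrightarrow> finite {p. g p \<noteq> 0} \<Longrightarrow> finite {p. f p - g p \<noteq> 0}"
    by (rule finite_subset) simp
  ultimately show ?thesis using sub unfolding tfree_def by blast
qed

lemma tfree_neg: "f \<in> F \<Longrightarrow> (\<lambda>p. - f p) \<in> F"
  using tfree_diff[OF tfree_zero, of f] by simp

lemma tfree_add: "f \<in> F \<Longrightarrow> g \<in> F \<Longrightarrow> (\<lambda>p. f p + g p) \<in> F"
  using tfree_diff[OF _ tfree_neg, of f g] by simp

lemma tfree_tdelta: "x \<in> mcarrier U \<Longrightarrow> y \<in> mcarrier Y \<Longrightarrow> tdelta (x, y) \<in> F"
  by (simp add: tfree_def tdelta_support)

lemma tker_in_tfree: "f \<in> K \<Longrightarrow> f \<in> F"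
proof (induction rule: tker.induct)
  case (tker_rel r)
  then show ?case unfolding trel_def fun_diff_def
    using abU abY rightmod_simps(1)[OF rU] leftmod_simps(1)[OF lY]
    by (auto intro!: tfree_diff tfree_tdelta abgrp_add_closed)
qed (simp_all add: tfree_zero tfree_diff)

lemma tker_neg: "f \<in> K \<Longrightarrow> (\<lambda>p. - f p) \<in> K"
  using tker_diff[OF tker_zero, of f] by simp

lemma tker_add: "f \<in> K \<Longrightarrow> g \<in> K \<Longrightarrow> (\<lambda>p. f p + g p) \<in> K"
  using tker_diff[of f T U Y "\<lambda>p. - g p"] tker_neg[of g] by simp

lemma tker_add_left:
  assumes "x \<in> mcarrier U" "x' \<in> mcarrier U" "y \<in> mcarrier Y"
  shows "(\<lambda>p. tdelta (madd U x x', y) p - tdelta (x, y) p - tdelta (x', y) p) \<in> K"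
proof (rule tker_rel)
  have "(\<lambda>p. tdelta (madd U x x', y) p - tdelta (x, y) p - tdelta (x', y) p) =
    tdelta (madd U x x', y) - tdelta (x, y) - tdelta (x', y)" by (simp add: fun_eq_iff)
  then show "(\<lambda>p. tdelta (madd U x x', y) p - tdelta (x, y) p - tdelta (x', y) p) \<in> trel T U Y"
    unfolding trel_def using assms by blast
qed

lemma tker_add_right:
  assumes "x \<in> mcarrier U" "y \<in> mcarrier Y" "y' \<in> mcarrier Y"
  shows "(\<lambda>p. tdelta (x, madd Y y y') p - tdelta (x, y) p - tdelta (x, y') p) \<in> K"
proof (rule tker_rel)
  have "(\<lambda>p. tdelta (x, madd Y y y') p - tdelta (x, y) p - tdelta (x, y') p) =
    tdelta (x, madd Y y y') - tdelta (x, y) - tdelta (x, y')" by (simp add: fun_eq_iff)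
  then show "(\<lambda>p. tdelta (x, madd Y y y') p - tdelta (x, y) p - tdelta (x, y') p) \<in> trel T U Y"
    unfolding trel_def using assms by blast
qed

lemma tker_balance:
  assumes "x \<in> mcarrier U" "t \<in> carrier T" "y \<in> mcarrier Y"
  shows "(\<lambda>p. tdelta (rsmult U x t, y) p - tdelta (x, lsmult Y t y) p) \<in> K"
proof (rule tker_rel)
  have "(\<lambda>p. tdelta (rsmult U x t, y) p - tdelta (x, lsmult Y t y) p) =
    tdelta (rsmult U x t, y) - tdelta (x, lsmult Y t y)" by (simp add: fun_eq_iff)
  then show "(\<lambda>p. tdelta (rsmult U x t, y) p - tdelta (x, lsmult Y t y) p) \<in> trel T U Y"
    unfolding trel_def using assms by blast
qed

text \<open>Splits the relation case of the induction for \<open>tker\<close> into the three kinds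
  of relations, written pointwise as \<open>tpush\<close> and the evaluation of formal sums take
  them.\<close>

lemma tker_subset_induct [consumes 1, case_names zero left right balance diff]:
  assumes "f \<in> K" and "P (\<lambda>_. 0)"
    and "\<And>x x' y. x \<in> mcarrier U \<Longrightarrow> x' \<in> mcarrier U \<Longrightarrow> y \<in> mcarrier Y \<Longrightarrow>
       P (\<lambda>p. tdelta (madd U x x', y) p - tdelta (x, y) p - tdelta (x', y) p)"
    and "\<And>x y y'. x \<in> mcarrier U \<Longrightarrow> y \<in> mcarrier Y \<Longrightarrow> y' \<in> mcarrier Y \<Longrightarrow>
       P (\<lambda>p. tdelta (x, madd Y y y') p - tdelta (x, y) p - tdelta (x, y') p)"
    and "\<And>x t y. x \<in> mcarrier U \<Longrightarrow> t \<in> carrier T \<Longrightarrow> y \<in> mcarrier Y \<Longrightarrow>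
       P (\<lambda>p. tdelta (rsmult U x t, y) p - tdelta (x, lsmult Y t y) p)"
    and "\<And>f g. f \<in> K \<Longrightarrow> g \<in> K \<Longrightarrow> P f \<Longrightarrow> P g \<Longrightarrow> P (\<lambda>p. f p - g p)"
  shows "P f"
  using assms(1)
proof (induction rule: tker.induct)
  case (tker_rel r)
  then show ?case unfolding trel_def fun_diff_def using assms(3-5) by auto
qed (use assms in auto)

lemma tcls_eq_iff:
  assumes "f \<in> F" "g \<in> F"
  shows "cl f = cl g \<longleftrightarrow> (\<lambda>p. f p - g p) \<in> K"
proof
  assume "cl f = cl g"
  moreover have "f \<in> cl f" using assms tker_zero[of T U Y] by (simp add: tcls_def)
  ultimately show "(\<lambda>p. f p - g p) \<in> K" by (simp add: tcls_def)
next
  assume *: "(\<lambda>p. f p - g p) \<in> K"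
  have "(\<lambda>p. h p - f p) \<in> K \<longleftrightarrow> (\<lambda>p. h p - g p) \<in> K" for h
    using tker_add[OF _ *, of "\<lambda>p. h p - f p"] tker_diff[OF _ *, of "\<lambda>p. h p - g p"] by auto
  then show "cl f = cl g" by (simp add: tcls_def)
qed

text \<open>The operations of \<open>tens\<close> work on a representative picked by
  \<open>SOME\<close>. As a member of the class it differs from any given representative by an
  element of \<open>K\<close>.\<close>

lemma trep_tcls:
  assumes "f \<in> F" shows "trep (cl f) \<in> F" "(\<lambda>p. trep (cl f) p - f p) \<in> K"
proof -
  have "f \<in> cl f" using assms tker_zero[of T U Y] by (simp add: tcls_def)
  then have "trep (cl f) \<in> cl f" unfolding trep_def by (rule someI[of "\<lambda>g. g \<in> cl f"])
  then show "trep (cl f) \<in> F" "(\<lambda>p. trep (cl f) p - f p) \<in> K" by (simp_all add: tcls_def)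
qed

lemma tens_simps:
  "mcarrier W = cl ` F" "mzero W = cl (\<lambda>_. 0)"
  "lsmult W r C = cl (tlfree U r (trep C))" "rsmult W C s = cl (trfree Y (trep C) s)"
  by (simp_all add: tens_def)

lemma tcls_in: "f \<in> F \<Longrightarrow> cl f \<in> mcarrier W"
  by (simp add: tens_simps)

text \<open>Independence of the picked representatives: the two errors add up to an element of
  \<open>K\<close>.\<close>

lemma tens_add:
  assumes "f \<in> F" "g \<in> F"
  shows "madd W (cl f) (cl g) = cl (\<lambda>p. f p + g p)"
proof -
  have "madd W (cl f) (cl g) = cl (\<lambda>p. trep (cl f) p + trep (cl g) p)" by (simp add: tens_def)
  also have "\<dots> = cl (\<lambda>p. f p + g p)"
    using assms trep_tcls tker_add[of "\<lambda>p. trep (cl f) p - f p" "\<lambda>p. trep (cl g) p - g p"]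
    by (subst tcls_eq_iff) (auto intro!: tfree_add simp: algebra_simps)
  finally show ?thesis .
qed

lemma abgrp_tens: "abgrp_part W"
  unfolding abgrp_part_def tens_simps(1)
proof (intro conjI ballI; (elim imageE)?)
  fix z w u f g h
  assume f: "z = cl f" "f \<in> F"
  show "\<exists>y\<in>cl ` F. madd W z y = mzero W"
    using f by (intro bexI[of _ "cl (\<lambda>p. - f p)"]) (simp_all add: tens_add tfree_neg tens_simps(2))
  show "madd W (mzero W) z = z"
    using f by (simp add: tens_add tens_simps(2) tfree_zero)
  assume g: "w = cl g" "g \<in> F"
  show "madd W z w \<in> cl ` F"
    using f g by (simp add: tens_add tfree_add)
  show "madd W z w = madd W w z"
    using f g by (simp add: tens_add add.commute)
  assume h: "u = cl h" "h \<in> F"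
  show "madd W (madd W z w) u = madd W z (madd W w u)"
    using f g h by (simp add: tens_add tfree_add add.assoc)
qed (simp add: tens_simps(2) tfree_zero)

lemma pure_closed: "x \<in> mcarrier U \<Longrightarrow> y \<in> mcarrier Y \<Longrightarrow> x \<odot> y \<in> mcarrier W"
  by (simp add: tpure_def tens_simps(1) tfree_tdelta)

lemma pure_add_left:
  assumes "x \<in> mcarrier U" "x' \<in> mcarrier U" "y \<in> mcarrier Y"
  shows "madd U x x' \<odot> y = madd W (x \<odot> y) (x' \<odot> y)"
  using assms tker_add_left[OF assms] unfolding tpure_def
  by (simp add: tens_add tfree_tdelta tcls_eq_iff tfree_add abgrp_add_closed[OF abU] algebra_simps)

lemma pure_add_right:
  assumes "x \<in> mcarrier U" "y \<in> mcarrier Y" "y' \<in> mcarrier Y"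
  shows "x \<odot> madd Y y y' = madd W (x \<odot> y) (x \<odot> y')"
  using assms tker_add_right[OF assms] unfolding tpure_def
  by (simp add: tens_add tfree_tdelta tcls_eq_iff tfree_add abgrp_add_closed[OF abY] algebra_simps)

lemma pure_balance:
  assumes "x \<in> mcarrier U" "t \<in> carrier T" "y \<in> mcarrier Y"
  shows "rsmult U x t \<odot> y = x \<odot> lsmult Y t y"
  using assms tker_balance[OF assms] unfolding tpure_def
  by (simp add: tfree_tdelta tcls_eq_iff rightmod_simps(1)[OF rU] leftmod_simps(1)[OF lY])

lemma addhom_pure_left: "y \<in> mcarrier Y \<Longrightarrow> addhom U W (\<lambda>x. x \<odot> y)"
  by (simp add: addhom_def pure_closed pure_add_left)

lemma addhom_pure_right: "x \<in> mcarrier U \<Longrightarrow> addhom Y W (\<lambda>y. x \<odot> y)"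
  by (simp add: addhom_def pure_closed pure_add_right)

text \<open>Induction on the sum of the absolute values. At a point of the support, subtracting or
  adding one generator according to the sign lowers it.\<close>

lemma tfree_induct:
  assumes "f \<in> F" and zero: "P (\<lambda>_. 0)" and delta: "\<And>x y. x \<in> mcarrier U \<Longrightarrow> y \<in> mcarrier Y \<Longrightarrow> P (tdelta (x, y))"
    and diff: "\<And>f g. f \<in> F \<Longrightarrow> g \<in> F \<Longrightarrow> P f \<Longrightarrow> P g \<Longrightarrow> P (\<lambda>p. f p - g p)"
  shows "P f"
  using assms(1)
proof (induction "nat (\<Sum>q\<in>{q. f q \<noteq> 0}. \<bar>f q\<bar>)" arbitrary: f rule: less_induct)
  case (less f)
  have fin: "finite {q. f q \<noteq> 0}" and sub: "{q. f q \<noteq> 0} \<subseteq> D"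
    using less.prems by (auto simp: tfree_def)
  show ?case
  proof (cases "f = (\<lambda>_. 0)")
    case False
    then obtain p where p: "f p \<noteq> 0" by (auto simp only: fun_eq_iff)
    then obtain x y where xy: "p = (x, y)" "x \<in> mcarrier U" "y \<in> mcarrier Y"
      using sub by auto
    have d: "tdelta p \<in> F" "P (tdelta p)" using xy by (simp_all add: tfree_tdelta delta)
    \<comment> \<open>Closure is available for differences only, so minus a generator is written as
      zero minus that generator.\<close>
    have nd: "(\<lambda>q. 0 - tdelta p q) \<in> F" "P (\<lambda>q. 0 - tdelta p q)"
      using d tfree_diff[OF tfree_zero] diff[OF tfree_zero _ zero] by auto
    have small: "nat (\<Sum>q\<in>{q. g q \<noteq> 0}. \<bar>g q\<bar>) < nat (\<Sum>q\<in>{q. f q \<noteq> 0}. \<bar>f q\<bar>)"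
      if g: "\<And>q. q \<noteq> p \<Longrightarrow> g q = f q" "\<bar>g p\<bar> < \<bar>f p\<bar>" for g
    proof -
      have "(\<Sum>q\<in>{q. g q \<noteq> 0}. \<bar>g q\<bar>) = (\<Sum>q\<in>{q. f q \<noteq> 0}. \<bar>g q\<bar>)"
        using fin p g by (intro sum.mono_neutral_left) (auto, metis)
      also have "\<dots> < (\<Sum>q\<in>{q. f q \<noteq> 0}. \<bar>f q\<bar>)"
      proof (rule sum_strict_mono_ex1[OF fin])
        show "\<forall>q\<in>{q. f q \<noteq> 0}. \<bar>g q\<bar> \<le> \<bar>f q\<bar>" using g by (metis less_imp_le order_refl)
        show "\<exists>q\<in>{q. f q \<noteq> 0}. \<bar>g q\<bar> < \<bar>f q\<bar>" using p g(2) by blast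
      qed
      finally show ?thesis
        by (simp add: zless_nat_conj) (meson abs_ge_zero le_less_trans sum_nonneg)
    qed
    show ?thesis
    proof (cases "f p > 0")
      case True
      let ?g = "\<lambda>q. f q - tdelta p q"
      have g: "?g \<in> F" using less.prems d by (intro tfree_diff)
      have "P ?g" using True by (intro less.hyps small g) (auto simp: tdelta_def)
      have "P (\<lambda>q. ?g q - (0 - tdelta p q))" by (rule diff[OF g nd(1) \<open>P ?g\<close> nd(2)])
      then show ?thesis by simp
    next
      case False
      let ?g = "\<lambda>q. f q - (0 - tdelta p q)"
      have g: "?g \<in> F" by (rule tfree_diff[OF less.prems nd(1)])
      have "P ?g" using False p by (intro less.hyps small g) (auto simp: tdelta_def)
      have "P (\<lambda>q. ?g q - tdelta p q)" by (rule diff[OF g d(1) \<open>P ?g\<close> d(2)])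
      then show ?thesis by simp
    qed
  qed (use zero in simp)
qed

lemma pure_zero_left: "y \<in> mcarrier Y \<Longrightarrow> mzero U \<odot> y = mzero W"
  using addhom_zero[OF abU abgrp_tens addhom_pure_left] .

text \<open>No closure under negation is asked for, because \<open>-(x \<otimes> y) = (-x) \<otimes> y\<close>.\<close>

lemma tens_induct [consumes 1, case_names pure add]:
  assumes "z \<in> mcarrier W"
    and pure: "\<And>x y. x \<in> mcarrier U \<Longrightarrow> y \<in> mcarrier Y \<Longrightarrow> P (x \<odot> y)"
    and add: "\<And>z w. z \<in> mcarrier W \<Longrightarrow> w \<in> mcarrier W \<Longrightarrow> P z \<Longrightarrow> P w \<Longrightarrow> P (madd W z w)"
  shows "P z"
proof -
  obtain f where f: "f \<in> F" "z = cl f" using assms(1) by (auto simp: tens_simps(1))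
  \<comment> \<open>Carrying the negative along turns a difference of formal sums into a sum of
    classes, which the hypothesis \<open>add\<close> handles.\<close>
  have "P (cl f) \<and> P (cl (\<lambda>p. - f p))" using f(1)
  proof (rule tfree_induct)
    have "P (mzero U \<odot> mzero Y)" using abU abY by (intro pure abgrp_zero_closed)
    then have "P (mzero W)" using abY by (simp add: pure_zero_left abgrp_zero_closed)
    then show "P (cl (\<lambda>_. 0)) \<and> P (cl (\<lambda>p. - 0))" by (simp add: tens_simps(2))
    fix x y assume xy: "x \<in> mcarrier U" "y \<in> mcarrier Y"
    obtain x' where x': "x' \<in> mcarrier U" "madd U x x' = mzero U"
      using abgrp_neg[OF abU xy(1)] .
    have "madd W (x \<odot> y) (x' \<odot> y) = mzero W"
      using xy x' pure_add_left pure_zero_left by metis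
    moreover have "madd W (x \<odot> y) (cl (\<lambda>p. - tdelta (x, y) p)) = mzero W"
      unfolding tpure_def using xy by (simp add: tens_add tfree_tdelta tfree_neg tens_simps(2))
    moreover have "cl (\<lambda>p. - tdelta (x, y) p) \<in> mcarrier W"
      using xy by (simp add: tcls_in tfree_tdelta tfree_neg)
    moreover have "x \<odot> y \<in> mcarrier W" "x' \<odot> y \<in> mcarrier W" using xy x' by (simp_all add: pure_closed)
    ultimately have "cl (\<lambda>p. - tdelta (x, y) p) = x' \<odot> y"
      using abgrp_tens by (metis abgrp_assoc abgrp_comm abgrp_lzero)
    then show "P (cl (tdelta (x, y))) \<and> P (cl (\<lambda>p. - tdelta (x, y) p))"
      using pure[OF xy] pure[OF x'(1) xy(2)] by (simp add: tpure_def)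
  next
    fix f g assume fg: "f \<in> F" "g \<in> F" and P: "P (cl f) \<and> P (cl (\<lambda>p. - f p))" "P (cl g) \<and> P (cl (\<lambda>p. - g p))"
    have "cl (\<lambda>p. f p - g p) = madd W (cl f) (cl (\<lambda>p. - g p))"
      "cl (\<lambda>p. - (f p - g p)) = madd W (cl (\<lambda>p. - f p)) (cl g)"
      using fg by (simp_all add: tens_add tfree_neg)
    then show "P (cl (\<lambda>p. f p - g p)) \<and> P (cl (\<lambda>p. - (f p - g p)))"
      using fg P by (simp add: add tcls_in tfree_neg)
  qed
  then show ?thesis using f by simp
qed

lemma tens_hom_eqI:
  assumes "addhom W Z \<phi>" "addhom W Z \<psi>" "z \<in> mcarrier W"
    and "\<And>x y. x \<in> mcarrier U \<Longrightarrow> y \<in> mcarrier Y \<Longrightarrow> \<phi> (x \<odot> y) = \<psi> (x \<odot> y)"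
  shows "\<phi> z = \<psi> z"
  using assms(3) by (induction rule: tens_induct) (use assms in \<open>simp_all add: addhom_add\<close>)

end

section \<open>The universal property of the tensor product\<close>

text \<open>Written multiplicatively, so that \<^const>\<open>finprod\<close> and integer powers are available.\<close>

definition addgrp :: "('r, 's, 'x) bimod \<Rightarrow> 'x monoid" where
  "addgrp Z = \<lparr>carrier = mcarrier Z, monoid.mult = madd Z, one = mzero Z\<rparr>"

lemma addgrp_simps [simp]:
  "carrier (addgrp Z) = mcarrier Z" "monoid.mult (addgrp Z) = madd Z" "one (addgrp Z) = mzero Z"
  by (simp_all add: addgrp_def)

lemma comm_group_addgrp: "abgrp_part Z \<Longrightarrow> comm_group (addgrp Z)"
  by (rule comm_groupI)
    (auto simp: abgrp_zero_closed abgrp_add_closed abgrp_assoc abgrp_lzero intro: abgrp_comm,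
      metis abgrp_comm abgrp_neg)

text \<open>The homomorphism on formal sums that extends \<open>h\<close> from generators;
  coefficients become exponents in the multiplicative notation.\<close>

definition tev :: "('r, 's, 'z) bimod \<Rightarrow> ('p \<Rightarrow> 'z) \<Rightarrow> ('p \<Rightarrow> int) \<Rightarrow> 'z" where
  "tev Z h f = finprod (addgrp Z) (\<lambda>p. h p [^]\<^bsub>addgrp Z\<^esub> f p) {p. f p \<noteq> 0}"

context tensor_pair
begin

context
  fixes Z :: "('c, 'd, 'z) bimod" and h :: "'x \<Rightarrow> 'y \<Rightarrow> 'z"
  assumes Z: "abgrp_part Z" and h: "balanced T U Y Z h"
begin

interpretation G: comm_group "addgrp Z" by (rule comm_group_addgrp[OF Z])

abbreviation "ev \<equiv> tev Z (case_prod h)"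

lemma h_closed: "p \<in> D \<Longrightarrow> case_prod h p \<in> mcarrier Z"
  using h by (auto simp: balanced_def addhom_def)

lemma tev_superset:
  assumes "finite E" "{p. f p \<noteq> 0} \<subseteq> E" "E \<subseteq> D"
  shows "ev f = finprod (addgrp Z) (\<lambda>p. case_prod h p [^]\<^bsub>addgrp Z\<^esub> f p) E"
  unfolding tev_def
proof (rule G.finprod_mono_neutral_cong_left[OF assms(1,2)])
  show "(\<lambda>p. case_prod h p [^]\<^bsub>addgrp Z\<^esub> f p) \<in> E \<rightarrow> carrier (addgrp Z)"
    using assms(3) h_closed by (intro funcsetI G.int_pow_closed) auto
qed auto

lemma tev_closed:
  assumes "f \<in> F" shows "ev f \<in> mcarrier Z"
proof -
  have "(\<lambda>p. case_prod h p [^]\<^bsub>addgrp Z\<^esub> f p) \<in> {p. f p \<noteq> 0} \<rightarrow> carrier (addgrp Z)"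
    using assms h_closed unfolding tfree_def by (intro funcsetI G.int_pow_closed) auto
  from G.finprod_closed[OF this] show ?thesis by (simp add: tev_def)
qed

lemma tev_add:
  assumes "f \<in> F" "g \<in> F"
  shows "ev (\<lambda>p. f p + g p) = madd Z (ev f) (ev g)"
proof -
  let ?E = "{p. f p \<noteq> 0} \<union> {p. g p \<noteq> 0}"
  have E: "finite ?E" "?E \<subseteq> D" using assms by (auto simp: tfree_def)
  have c: "case_prod h p \<in> carrier (addgrp Z)" if "p \<in> ?E" for p using h_closed that E by auto
  have "ev (\<lambda>p. f p + g p) = finprod (addgrp Z) (\<lambda>p. case_prod h p [^]\<^bsub>addgrp Z\<^esub> (f p + g p)) ?E"
    using E by (intro tev_superset) auto
  also have "\<dots> = finprod (addgrp Z) (\<lambda>p. case_prod h p [^]\<^bsub>addgrp Z\<^esub> f p \<otimes>\<^bsub>addgrp Z\<^esub>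
      case_prod h p [^]\<^bsub>addgrp Z\<^esub> g p) ?E"
    using c by (intro G.finprod_cong') (auto simp: G.int_pow_mult simp del: addgrp_simps)
  also have "\<dots> = finprod (addgrp Z) (\<lambda>p. case_prod h p [^]\<^bsub>addgrp Z\<^esub> f p) ?E \<otimes>\<^bsub>addgrp Z\<^esub>
      finprod (addgrp Z) (\<lambda>p. case_prod h p [^]\<^bsub>addgrp Z\<^esub> g p) ?E"
    using c by (intro G.finprod_multf funcsetI G.int_pow_closed)
  also have "\<dots> = madd Z (ev f) (ev g)"
    using E tev_superset[of ?E f] tev_superset[of ?E g] by simp
  finally show ?thesis .
qed

lemma tev_tdelta:
  assumes "x \<in> mcarrier U" "y \<in> mcarrier Y" shows "ev (tdelta (x, y)) = h x y"
proof -
  have c: "h x y \<in> carrier (addgrp Z)" using h_closed[of "(x, y)"] assms by simp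
  then have "(\<lambda>p. case_prod h p [^]\<^bsub>addgrp Z\<^esub> tdelta (x, y) p) \<in> {} \<rightarrow> carrier (addgrp Z)"
    "case_prod h (x, y) [^]\<^bsub>addgrp Z\<^esub> tdelta (x, y) (x, y) \<in> carrier (addgrp Z)"
    by (auto simp del: addgrp_simps)
  from G.finprod_insert[OF finite.emptyI _ this] c show ?thesis unfolding tev_def tdelta_support
    by (simp add: tdelta_def G.int_pow_1 G.r_one del: addgrp_simps)
qed

lemma tev_diff:
  assumes "f \<in> F" "g \<in> F"
  shows "ev f = madd Z (ev (\<lambda>p. f p - g p)) (ev g)"
  using tev_add[OF tfree_diff[OF assms] assms(2)] by simp

text \<open>Each relation is the difference of two formal sums to which a balanced \<open>h\<close>
  gives the same value, so its own value cancels to zero. Differences inherit this.\<close>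

lemma tev_tker: "f \<in> K \<Longrightarrow> ev f = mzero Z"
proof (induction rule: tker_subset_induct)
  case zero show ?case by (simp add: tev_def G.finprod_empty[simplified])
next
  case (left x x' y)
  let ?d = "tdelta (madd U x x', y)" and ?d1 = "tdelta (x, y)" and ?d2 = "tdelta (x', y)"
  have F: "?d \<in> F" "?d1 \<in> F" "?d2 \<in> F" using left abU by (simp_all add: tfree_tdelta abgrp_add_closed)
  have r: "ev (\<lambda>p. ?d p - ?d1 p - ?d2 p) \<in> mcarrier Z" using F by (intro tev_closed tfree_diff)
  have "ev ?d = madd Z (ev (\<lambda>p. ?d p - ?d1 p - ?d2 p)) (ev (\<lambda>p. ?d1 p + ?d2 p))"
    using tev_diff[OF F(1) tfree_add[OF F(2,3)]] by (simp add: algebra_simps)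
  moreover have "ev ?d = ev (\<lambda>p. ?d1 p + ?d2 p)"
    using left h abU F by (simp add: tev_add tev_tdelta abgrp_add_closed balanced_def addhom_def)
  ultimately show ?case
    using abgrp_cancel_zero[OF Z r, of "ev (\<lambda>p. ?d1 p + ?d2 p)"] tev_closed[OF tfree_add[OF F(2,3)]] by simp
next
  case (right x y y')
  let ?d = "tdelta (x, madd Y y y')" and ?d1 = "tdelta (x, y)" and ?d2 = "tdelta (x, y')"
  have F: "?d \<in> F" "?d1 \<in> F" "?d2 \<in> F" using right abY by (simp_all add: tfree_tdelta abgrp_add_closed)
  have r: "ev (\<lambda>p. ?d p - ?d1 p - ?d2 p) \<in> mcarrier Z" using F by (intro tev_closed tfree_diff)
  have "ev ?d = madd Z (ev (\<lambda>p. ?d p - ?d1 p - ?d2 p)) (ev (\<lambda>p. ?d1 p + ?d2 p))"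
    using tev_diff[OF F(1) tfree_add[OF F(2,3)]] by (simp add: algebra_simps)
  moreover have "ev ?d = ev (\<lambda>p. ?d1 p + ?d2 p)"
    using right h abY F by (simp add: tev_add tev_tdelta abgrp_add_closed balanced_def addhom_def)
  ultimately show ?case
    using abgrp_cancel_zero[OF Z r, of "ev (\<lambda>p. ?d1 p + ?d2 p)"] tev_closed[OF tfree_add[OF F(2,3)]] by simp
next
  case (balance x t y)
  let ?d = "tdelta (rsmult U x t, y)" and ?d1 = "tdelta (x, lsmult Y t y)"
  have F: "?d \<in> F" "?d1 \<in> F"
    using balance by (simp_all add: tfree_tdelta rightmod_simps(1)[OF rU] leftmod_simps(1)[OF lY])
  have "ev ?d = ev ?d1"
    using balance h by (simp add: tev_tdelta rightmod_simps(1)[OF rU] leftmod_simps(1)[OF lY] balanced_def)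
  then show ?case
    using abgrp_cancel_zero[OF Z tev_closed[OF tfree_diff[OF F]] tev_closed[OF F(2)]] tev_diff[OF F] by simp
next
  case (diff f g)
  then have F: "f \<in> F" "g \<in> F" by (simp_all add: tker_in_tfree)
  then show ?case
    using tev_diff[OF F] diff tev_closed[OF tfree_diff[OF F]] Z by (simp add: abgrp_rzero)
qed

text \<open>The map evaluates the representative picked by \<open>trep\<close>. Any other
  representative differs by an element of \<open>K\<close>, whose value is zero by
  \<open>tev_tker\<close>.\<close>

lemma tens_universal_aux: "\<exists>\<phi>. addhom W Z \<phi> \<and> (\<forall>x\<in>mcarrier U. \<forall>y\<in>mcarrier Y. \<phi> (x \<odot> y) = h x y)"
proof -
  have *: "ev (trep (cl f)) = ev f" if "f \<in> F" for f
    using tev_diff[OF trep_tcls(1)[OF that] that] tev_tker[OF trep_tcls(2)[OF that]]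
      tev_closed[OF that] Z by (simp add: abgrp_lzero)
  show ?thesis
  proof (intro exI conjI ballI)
    show "addhom W Z (\<lambda>C. ev (trep C))"
      by (rule addhomI) (auto simp: tens_simps(1) tens_add * tfree_add tev_add tev_closed)
    show "ev (trep (x \<odot> y)) = h x y" if "x \<in> mcarrier U" "y \<in> mcarrier Y" for x y
      using that by (simp add: tpure_def * tfree_tdelta tev_tdelta)
  qed
qed

end

lemma tens_universal:
  assumes "abgrp_part Z" "balanced T U Y Z h"
  obtains \<phi> where "addhom W Z \<phi>" "\<And>x y. x \<in> mcarrier U \<Longrightarrow> y \<in> mcarrier Y \<Longrightarrow> \<phi> (x \<odot> y) = h x y"
  using tens_universal_aux[OF assms] by blast

section \<open>Outer actions on the tensor product\<close>

lemma tpush_tfree: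
  assumes "\<And>p. p \<in> D \<Longrightarrow> \<phi> p \<in> D" "f \<in> F" shows "tpush \<phi> f \<in> F"
proof -
  have f: "finite {q. f q \<noteq> 0}" "{q. f q \<noteq> 0} \<subseteq> D" using assms(2) by (simp_all add: tfree_def)
  have "finite {p. tpush \<phi> f p \<noteq> 0}"
    by (rule finite_subset[OF tpush_support finite_imageI[OF f(1)]])
  moreover have "{p. tpush \<phi> f p \<noteq> 0} \<subseteq> D"
  proof
    fix p assume "p \<in> {p. tpush \<phi> f p \<noteq> 0}"
    then obtain q where "p = \<phi> q" "q \<in> {q. f q \<noteq> 0}" using tpush_support[of \<phi> f] by blast
    then show "p \<in> D" using assms(1) f(2) by blast
  qed
  ultimately show ?thesis by (simp add: tfree_def)
qed

lemma tpush_class: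
  assumes D: "\<And>p. p \<in> D \<Longrightarrow> \<phi> p \<in> D" and f: "f \<in> F" and K: "\<And>g. g \<in> K \<Longrightarrow> tpush \<phi> g \<in> K"
  shows "cl (tpush \<phi> (trep (cl f))) = cl (tpush \<phi> f)"
proof -
  have "(\<lambda>p. tpush \<phi> (trep (cl f)) p - tpush \<phi> f p) = tpush \<phi> (\<lambda>p. trep (cl f) p - f p)"
    using f trep_tcls(1)[OF f] by (subst tpush_diff) (auto simp: tfree_def)
  then show ?thesis
    using K[OF trep_tcls(2)[OF f]] by (subst tcls_eq_iff) (auto intro!: tpush_tfree D f trep_tcls)
qed

text \<open>Pushforward respects differences, so \<open>K\<close> is preserved as soon as the three
  kinds of relations are mapped into \<open>K\<close>.\<close>

lemma tpush_tker:
  assumes D: "\<And>p. p \<in> D \<Longrightarrow> \<phi> p \<in> D" and g: "g \<in> K"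
    and "\<And>x x' y. x \<in> mcarrier U \<Longrightarrow> x' \<in> mcarrier U \<Longrightarrow> y \<in> mcarrier Y \<Longrightarrow>
       (\<lambda>p. tdelta (\<phi> (madd U x x', y)) p - tdelta (\<phi> (x, y)) p - tdelta (\<phi> (x', y)) p) \<in> K"
    and "\<And>x y y'. x \<in> mcarrier U \<Longrightarrow> y \<in> mcarrier Y \<Longrightarrow> y' \<in> mcarrier Y \<Longrightarrow>
       (\<lambda>p. tdelta (\<phi> (x, madd Y y y')) p - tdelta (\<phi> (x, y)) p - tdelta (\<phi> (x, y')) p) \<in> K"
    and "\<And>x t y. x \<in> mcarrier U \<Longrightarrow> t \<in> carrier T \<Longrightarrow> y \<in> mcarrier Y \<Longrightarrow>
       (\<lambda>p. tdelta (\<phi> (rsmult U x t, y)) p - tdelta (\<phi> (x, lsmult Y t y)) p) \<in> K"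
  shows "tpush \<phi> g \<in> K"
  using g
proof (induction rule: tker_subset_induct)
  case zero show ?case using tker_zero by (simp add: tpush_def)
next
  case (diff f g)
  then have "finite {q. f q \<noteq> 0}" "finite {q. g q \<noteq> 0}" using tker_in_tfree by (auto simp: tfree_def)
  then show ?case using diff by (simp add: tpush_diff tker_diff)
next
  case (left x x' y)
  then show ?case unfolding tpush_tdelta_diff2 by (rule assms(3))
next
  case (right x y y')
  then show ?case unfolding tpush_tdelta_diff2 by (rule assms(4))
next
  case (balance x t y)
  then show ?case unfolding tpush_tdelta_diff by (rule assms(5))
qed

end

locale tensor_bimod = tensor_pair T U Y
  for R :: "'r ring" and T :: "'t ring" and S :: "'s ring"
    and U :: "('r, 't, 'x) bimod" and Y :: "('t, 's, 'y) bimod" +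
  assumes bU: "bimodule R T U" and bY: "bimodule T S Y"
begin

lemma left_map: "r \<in> carrier R \<Longrightarrow> p \<in> D \<Longrightarrow> (lsmult U r (fst p), snd p) \<in> D"
  using leftmod_simps(1)[OF bimodule_left[OF bU]] by auto

lemma right_map: "s \<in> carrier S \<Longrightarrow> p \<in> D \<Longrightarrow> (fst p, rsmult Y (snd p) s) \<in> D"
  using rightmod_simps(1)[OF bimodule_right[OF bY]] by auto

text \<open>Additivity of the action takes additive relations to additive relations; for the
  balancing relations it is decisive that the two actions on \<open>U\<close> commute.\<close>

lemma left_tker:
  assumes "r \<in> carrier R" "g \<in> K" shows "tpush (\<lambda>q. (lsmult U r (fst q), snd q)) g \<in> K"
  using assms leftmod_simps(1,2)[OF bimodule_left[OF bU]] bimodule_assoc[OF bU, symmetric]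
  by (intro tpush_tker left_map)
    (simp_all add: tker_add_left tker_add_right tker_balance rightmod_simps(1)[OF rU])

lemma right_tker:
  assumes "s \<in> carrier S" "g \<in> K" shows "tpush (\<lambda>q. (fst q, rsmult Y (snd q) s)) g \<in> K"
  using assms rightmod_simps(1,2)[OF bimodule_right[OF bY]] bimodule_assoc[OF bY]
  by (intro tpush_tker right_map)
    (simp_all add: tker_add_left tker_add_right tker_balance leftmod_simps(1)[OF lY])

lemma lsmult_tcls:
  assumes "r \<in> carrier R" "f \<in> F"
  shows "lsmult W r (cl f) = cl (tpush (\<lambda>q. (lsmult U r (fst q), snd q)) f)"
  unfolding tens_simps tlfree_tpush using assms by (intro tpush_class left_map left_tker)

lemma rsmult_tcls:
  assumes "s \<in> carrier S" "f \<in> F"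
  shows "rsmult W (cl f) s = cl (tpush (\<lambda>q. (fst q, rsmult Y (snd q) s)) f)"
  unfolding tens_simps trfree_tpush using assms by (intro tpush_class right_map right_tker)

lemma tpush_add:
  assumes "f \<in> F" "g \<in> F"
  shows "tpush \<phi> (\<lambda>p. f p + g p) = (\<lambda>p. tpush \<phi> f p + tpush \<phi> g p)"
  using assms tfree_add[OF assms] tpush_diff[of "\<lambda>p. f p + g p" g \<phi>]
  by (auto simp: tfree_def fun_eq_iff)

lemma addhom_lsmult: "r \<in> carrier R \<Longrightarrow> addhom W W (lsmult W r)"
  by (rule addhomI)
    (auto simp: tens_simps(1) tens_add lsmult_tcls tfree_add tpush_add tpush_tfree[OF left_map])

lemma addhom_rsmult: "s \<in> carrier S \<Longrightarrow> addhom W W (\<lambda>z. rsmult W z s)"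
  by (rule addhomI)
    (auto simp: tens_simps(1) tens_add rsmult_tcls tfree_add tpush_add tpush_tfree[OF right_map])

lemma lsmult_pure:
  "r \<in> carrier R \<Longrightarrow> x \<in> mcarrier U \<Longrightarrow> y \<in> mcarrier Y \<Longrightarrow> lsmult W r (x \<odot> y) = lsmult U r x \<odot> y"
  by (simp add: tpure_def lsmult_tcls tfree_tdelta tpush_tdelta)

lemma rsmult_pure:
  "s \<in> carrier S \<Longrightarrow> x \<in> mcarrier U \<Longrightarrow> y \<in> mcarrier Y \<Longrightarrow> rsmult W (x \<odot> y) s = x \<odot> rsmult Y y s"
  by (simp add: tpure_def rsmult_tcls tfree_tdelta tpush_tdelta)

text \<open>Both actions are additive maps on \<open>W\<close>, so each remaining axiom can be
  checked on pure tensors, where it follows from the module axioms of \<open>U\<close> and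
  \<open>Y\<close>.\<close>

lemma bimodule_tens: "bimodule R S W"
proof -
  have R: "ring R" and S: "ring S" using bU bY by (auto simp: bimodule_def leftmod_def rightmod_def)
  interpret R: ring R by fact
  interpret S: ring S by fact
  note l = leftmod_simps[OF bimodule_left[OF bU]] and r = rightmod_simps[OF bimodule_right[OF bY]]
  note hl = addhom_closed[OF addhom_lsmult] addhom_add[OF addhom_lsmult]
  note hr = addhom_closed[OF addhom_rsmult] addhom_add[OF addhom_rsmult]
  have 1: "lsmult W (a \<oplus>\<^bsub>R\<^esub> b) z = madd W (lsmult W a z) (lsmult W b z)"
    if "z \<in> mcarrier W" "a \<in> carrier R" "b \<in> carrier R" for a b z
    using that(1)
  proof (rule tens_hom_eqI[rotated 2])
    show "addhom W W (\<lambda>z. madd W (lsmult W a z) (lsmult W b z))"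
      by (intro addhom_add_fun abgrp_tens addhom_lsmult that)
  qed (use that in \<open>simp_all add: addhom_lsmult lsmult_pure l pure_add_left\<close>)
  have 2: "lsmult W (a \<otimes>\<^bsub>R\<^esub> b) z = lsmult W a (lsmult W b z)"
    if "z \<in> mcarrier W" "a \<in> carrier R" "b \<in> carrier R" for a b z
    using that(1)
  proof (rule tens_hom_eqI[rotated 2])
    show "addhom W W (\<lambda>z. lsmult W a (lsmult W b z))"
      by (rule addhom_comp[OF addhom_lsmult addhom_lsmult]) (use that in auto)
  qed (use that in \<open>simp_all add: addhom_lsmult lsmult_pure l\<close>)
  have 3: "lsmult W \<one>\<^bsub>R\<^esub> z = z" if "z \<in> mcarrier W" for z
    using that by (induction rule: tens_induct) (simp_all add: lsmult_pure l hl)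
  have 4: "rsmult W z (a \<oplus>\<^bsub>S\<^esub> b) = madd W (rsmult W z a) (rsmult W z b)"
    if "z \<in> mcarrier W" "a \<in> carrier S" "b \<in> carrier S" for a b z
    using that(1)
  proof (rule tens_hom_eqI[rotated 2])
    show "addhom W W (\<lambda>z. madd W (rsmult W z a) (rsmult W z b))"
      by (intro addhom_add_fun abgrp_tens addhom_rsmult that)
  qed (use that in \<open>simp_all add: addhom_rsmult rsmult_pure r pure_add_right\<close>)
  have 5: "rsmult W z (a \<otimes>\<^bsub>S\<^esub> b) = rsmult W (rsmult W z a) b"
    if "z \<in> mcarrier W" "a \<in> carrier S" "b \<in> carrier S" for a b z
    using that(1)
  proof (rule tens_hom_eqI[rotated 2])
    show "addhom W W (\<lambda>z. rsmult W (rsmult W z a) b)"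
      by (rule addhom_comp[OF addhom_rsmult addhom_rsmult]) (use that in auto)
  qed (use that in \<open>simp_all add: addhom_rsmult rsmult_pure r\<close>)
  have 6: "rsmult W z \<one>\<^bsub>S\<^esub> = z" if "z \<in> mcarrier W" for z
    using that by (induction rule: tens_induct) (simp_all add: rsmult_pure r hr)
  have 7: "rsmult W (lsmult W a z) b = lsmult W a (rsmult W z b)"
    if "z \<in> mcarrier W" "a \<in> carrier R" "b \<in> carrier S" for a b z
    using that by (induction rule: tens_induct) (simp_all add: lsmult_pure rsmult_pure l r hl hr)
  show ?thesis unfolding bimodule_def leftmod_def rightmod_def
    using R S abgrp_tens 1 2 3 4 5 6 7 hl hr by auto
qed

end

lemma tensor_bimodI:
  assumes "bimodule R T U" "bimodule T S Y" shows "tensor_bimod R T S U Y"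
  using assms by unfold_locales (auto simp: bimodule_def)

section \<open>Quasi-bases of depth two extensions\<close>

text \<open>Since a bimodule map out of the regular bimodule is determined by the image of 1, a
  splitting of depth two consists of maps \<open>\<beta> i\<close> and central tensors \<open>t i\<close>; the left and the right
  condition differ only in the equation relating them.\<close>

definition d2_data :: "'a ring \<Rightarrow> 'a set \<Rightarrow> nat \<Rightarrow> (nat \<Rightarrow> 'a \<Rightarrow> 'a) \<Rightarrow> (nat \<Rightarrow> ('a \<times> 'a \<Rightarrow> int) set) \<Rightarrow> bool" where
  "d2_data A B n \<beta> t \<longleftrightarrow> (\<forall>i<n. bhom (subr A B) (subr A B) (ring_bimod A) (ring_bimod A) (\<beta> i) \<and>
     t i \<in> mcarrier (tens (subr A B) (ring_bimod A) (ring_bimod A)) \<and>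
     (\<forall>b\<in>B. lsmult (tens (subr A B) (ring_bimod A) (ring_bimod A)) b (t i) =
        rsmult (tens (subr A B) (ring_bimod A) (ring_bimod A)) (t i) b))"

locale ring_extension =
  fixes A :: "'a ring" and B :: "'a set"
  assumes ring_A: "ring A" and subring_B: "subring B A"
begin

abbreviation "BB \<equiv> subr A B"
abbreviation "RA \<equiv> ring_bimod A"
abbreviation "tAA \<equiv> tens BB RA RA"
abbreviation "pAA \<equiv> tpure BB RA RA"

lemma B_sub: "b \<in> B \<Longrightarrow> b \<in> carrier A"
  using subringE(1)[OF subring_B] by auto

lemma bRA: "bimodule A A RA"
  by (rule bimodule_ring_bimod[OF ring_A])

lemma bRA_left: "bimodule BB A RA" and bRA_right: "bimodule A BB RA"
  using bimodule_subring_left[OF ring_A _ subring_B] bimodule_subring_right[OF ring_A _ subring_B] bRA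
  by blast+

sublocale A: ring A by (rule ring_A)
sublocale AA: tensor_bimod A BB A RA RA
  by (rule tensor_bimodI[OF bRA_right bRA_left])

lemmas AA_l = leftmod_simps[OF bimodule_left[OF AA.bimodule_tens]]
lemmas AA_r = rightmod_simps[OF bimodule_right[OF AA.bimodule_tens]]

lemma b_tAA_left: "bimodule BB A tAA" and b_tAA_right: "bimodule A BB tAA"
  using bimodule_subring_left[OF ring_A _ subring_B] bimodule_subring_right[OF ring_A _ subring_B] AA.bimodule_tens
  by blast+

text \<open>\<open>\<beta> i a\<close> is the \<open>i\<close>-th coordinate of a \<otimes> 1 under
  the splitting, and \<open>t i\<close> is the image of 1 under \<open>g i\<close>. Right
  \<open>A\<close>-linearity of \<open>g i\<close> makes \<open>t i\<close> times
  \<open>\<beta> i a\<close> equal to \<open>g i\<close> of that coordinate, and these sum to a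
  \<otimes> 1.\<close>

lemma left_d2_data:
  assumes "left_d2 A B"
  obtains n \<beta> t where "d2_data A B n \<beta> t"
    "\<And>a. a \<in> carrier A \<Longrightarrow> msum tAA (\<lambda>i. rsmult tAA (t i) (\<beta> i a)) n = pAA a \<one>\<^bsub>A\<^esub>"
proof -
  obtain n f g where fg: "(\<forall>i<n::nat. bhom BB A tAA RA (f i) \<and> bhom BB A RA tAA (g i)) \<and>
      (\<forall>x\<in>mcarrier tAA. msum tAA (\<lambda>i. g i (f i x)) n = x)"
    using bdvd_family[OF b_tAA_left bRA_left assms[unfolded left_d2_def]] by (elim exE)
  then have f: "\<And>i. i < n \<Longrightarrow> bhom BB A tAA RA (f i)" and g: "\<And>i. i < n \<Longrightarrow> bhom BB A RA tAA (g i)"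
    and gf: "\<And>x. x \<in> mcarrier tAA \<Longrightarrow> msum tAA (\<lambda>i. g i (f i x)) n = x"
    by simp_all
  have f_simps: "f i z \<in> carrier A" "w \<in> mcarrier tAA \<Longrightarrow> f i (madd tAA z w) = f i z \<oplus>\<^bsub>A\<^esub> f i w"
    "b \<in> B \<Longrightarrow> f i (lsmult tAA b z) = b \<otimes>\<^bsub>A\<^esub> f i z" "a \<in> carrier A \<Longrightarrow> f i (rsmult tAA z a) = f i z \<otimes>\<^bsub>A\<^esub> a"
    if "i < n" "z \<in> mcarrier tAA" for i z w a b
    using f[OF that(1)] that by (simp_all add: bhom_def lhom_def)
  have g_simps: "g i a \<in> mcarrier tAA"
    "b \<in> B \<Longrightarrow> g i (b \<otimes>\<^bsub>A\<^esub> a) = lsmult tAA b (g i a)" "a' \<in> carrier A \<Longrightarrow> g i (a \<otimes>\<^bsub>A\<^esub> a') = rsmult tAA (g i a) a'"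
    if "i < n" "a \<in> carrier A" for i a a' b
    using g[OF that(1)] that by (simp_all add: bhom_def lhom_def)
  define \<beta> where "\<beta> i a = f i (pAA a \<one>\<^bsub>A\<^esub>)" for i a
  define t where "t i = g i \<one>\<^bsub>A\<^esub>" for i
  have p: "pAA a a' \<in> mcarrier tAA" if "a \<in> carrier A" "a' \<in> carrier A" for a a'
    using AA.pure_closed[of a a'] that by simp
  have "bhom BB BB RA RA (\<beta> i)" if "i < n" for i
  proof -
    have "\<beta> i (a \<otimes>\<^bsub>A\<^esub> b) = \<beta> i a \<otimes>\<^bsub>A\<^esub> b" if "a \<in> carrier A" "b \<in> B" for a b
    proof -
      \<comment> \<open>\<open>b\<close> crosses the tensor sign and becomes a right scalar, for
        which \<open>f i\<close> is linear.\<close>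
      have "pAA (a \<otimes>\<^bsub>A\<^esub> b) \<one>\<^bsub>A\<^esub> = rsmult tAA (pAA a \<one>\<^bsub>A\<^esub>) b"
        using AA.pure_balance[of a b "\<one>\<^bsub>A\<^esub>"] AA.rsmult_pure[of b a "\<one>\<^bsub>A\<^esub>"] that by (simp add: B_sub)
      then show ?thesis using f_simps(4)[OF \<open>i < n\<close> p] that by (simp add: \<beta>_def B_sub)
    qed
    moreover have "\<beta> i (a \<oplus>\<^bsub>A\<^esub> a') = \<beta> i a \<oplus>\<^bsub>A\<^esub> \<beta> i a'" if "a \<in> carrier A" "a' \<in> carrier A" for a a'
      using AA.pure_add_left[of a a' "\<one>\<^bsub>A\<^esub>"] f_simps(2)[OF \<open>i < n\<close> p p] that by (simp add: \<beta>_def)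
    moreover have "\<beta> i (b \<otimes>\<^bsub>A\<^esub> a) = b \<otimes>\<^bsub>A\<^esub> \<beta> i a" if "a \<in> carrier A" "b \<in> B" for a b
      using AA.lsmult_pure[of b a "\<one>\<^bsub>A\<^esub>", symmetric] f_simps(3)[OF \<open>i < n\<close> p] that by (simp add: \<beta>_def B_sub)
    moreover have "\<beta> i a \<in> carrier A" if "a \<in> carrier A" for a
      using f_simps(1)[OF \<open>i < n\<close> p] that by (simp add: \<beta>_def)
    ultimately show ?thesis by (simp add: bhom_def lhom_def)
  qed
  moreover have "lsmult tAA b (t i) = rsmult tAA (t i) b" if "i < n" "b \<in> B" for i b
    \<comment> \<open>Both sides are \<open>g i b\<close>, by linearity of \<open>g i\<close> at 1
      on the left over \<open>B\<close> and on the right over \<open>A\<close>.\<close>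
    using g_simps(2,3)[OF that(1), of "\<one>\<^bsub>A\<^esub>" b] that by (simp add: t_def B_sub)
  ultimately have "d2_data A B n \<beta> t"
    using g_simps(1) by (simp add: d2_data_def t_def)
  moreover have "msum tAA (\<lambda>i. rsmult tAA (t i) (\<beta> i a)) n = pAA a \<one>\<^bsub>A\<^esub>" if "a \<in> carrier A" for a
  proof -
    have "msum tAA (\<lambda>i. rsmult tAA (t i) (\<beta> i a)) n = msum tAA (\<lambda>i. g i (f i (pAA a \<one>\<^bsub>A\<^esub>))) n"
    proof (rule msum_cong)
      fix i assume "i < n"
      then show "rsmult tAA (t i) (\<beta> i a) = g i (f i (pAA a \<one>\<^bsub>A\<^esub>))"
        using g_simps(3)[of i "\<one>\<^bsub>A\<^esub>" "f i (pAA a \<one>\<^bsub>A\<^esub>)"] f_simps(1)[OF _ p] that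
        by (simp add: \<beta>_def t_def)
    qed
    then show ?thesis using gf p that by simp
  qed
  ultimately show ?thesis by (rule that)
qed

text \<open>Mirror image of \<open>left_d2_data\<close>: the coordinates are those of 1 \<otimes> a,
  and the linearity over \<open>A\<close> is on the left.\<close>

lemma right_d2_data:
  assumes "right_d2 A B"
  obtains n \<beta> t where "d2_data A B n \<beta> t"
    "\<And>a. a \<in> carrier A \<Longrightarrow> msum tAA (\<lambda>i. lsmult tAA (\<beta> i a) (t i)) n = pAA \<one>\<^bsub>A\<^esub> a"
proof -
  obtain n f g where fg: "(\<forall>i<n::nat. bhom A BB tAA RA (f i) \<and> bhom A BB RA tAA (g i)) \<and>
      (\<forall>x\<in>mcarrier tAA. msum tAA (\<lambda>i. g i (f i x)) n = x)"
    using bdvd_family[OF b_tAA_right bRA_right assms[unfolded right_d2_def]] by (elim exE)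
  then have f: "\<And>i. i < n \<Longrightarrow> bhom A BB tAA RA (f i)" and g: "\<And>i. i < n \<Longrightarrow> bhom A BB RA tAA (g i)"
    and gf: "\<And>x. x \<in> mcarrier tAA \<Longrightarrow> msum tAA (\<lambda>i. g i (f i x)) n = x"
    by simp_all
  have f_simps: "f i z \<in> carrier A" "w \<in> mcarrier tAA \<Longrightarrow> f i (madd tAA z w) = f i z \<oplus>\<^bsub>A\<^esub> f i w"
    "a \<in> carrier A \<Longrightarrow> f i (lsmult tAA a z) = a \<otimes>\<^bsub>A\<^esub> f i z" "b \<in> B \<Longrightarrow> f i (rsmult tAA z b) = f i z \<otimes>\<^bsub>A\<^esub> b"
    if "i < n" "z \<in> mcarrier tAA" for i z w a b
    using f[OF that(1)] that by (simp_all add: bhom_def lhom_def)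
  have g_simps: "g i a \<in> mcarrier tAA"
    "a' \<in> carrier A \<Longrightarrow> g i (a' \<otimes>\<^bsub>A\<^esub> a) = lsmult tAA a' (g i a)" "b \<in> B \<Longrightarrow> g i (a \<otimes>\<^bsub>A\<^esub> b) = rsmult tAA (g i a) b"
    if "i < n" "a \<in> carrier A" for i a a' b
    using g[OF that(1)] that by (simp_all add: bhom_def lhom_def)
  define \<beta> where "\<beta> i a = f i (pAA \<one>\<^bsub>A\<^esub> a)" for i a
  define t where "t i = g i \<one>\<^bsub>A\<^esub>" for i
  have p: "pAA a a' \<in> mcarrier tAA" if "a \<in> carrier A" "a' \<in> carrier A" for a a'
    using AA.pure_closed[of a a'] that by simp
  have "bhom BB BB RA RA (\<beta> i)" if "i < n" for i
  proof -
    have "\<beta> i (b \<otimes>\<^bsub>A\<^esub> a) = b \<otimes>\<^bsub>A\<^esub> \<beta> i a" if "a \<in> carrier A" "b \<in> B" for a b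
    proof -
      have "pAA \<one>\<^bsub>A\<^esub> (b \<otimes>\<^bsub>A\<^esub> a) = lsmult tAA b (pAA \<one>\<^bsub>A\<^esub> a)"
        using AA.pure_balance[of "\<one>\<^bsub>A\<^esub>" b a] AA.lsmult_pure[of b "\<one>\<^bsub>A\<^esub>" a] that by (simp add: B_sub)
      then show ?thesis using f_simps(3)[OF \<open>i < n\<close> p] that by (simp add: \<beta>_def B_sub)
    qed
    moreover have "\<beta> i (a \<oplus>\<^bsub>A\<^esub> a') = \<beta> i a \<oplus>\<^bsub>A\<^esub> \<beta> i a'" if "a \<in> carrier A" "a' \<in> carrier A" for a a'
      using AA.pure_add_right[of "\<one>\<^bsub>A\<^esub>" a a'] f_simps(2)[OF \<open>i < n\<close> p p] that by (simp add: \<beta>_def)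
    moreover have "\<beta> i (a \<otimes>\<^bsub>A\<^esub> b) = \<beta> i a \<otimes>\<^bsub>A\<^esub> b" if "a \<in> carrier A" "b \<in> B" for a b
      using AA.rsmult_pure[of b "\<one>\<^bsub>A\<^esub>" a, symmetric] f_simps(4)[OF \<open>i < n\<close> p] that by (simp add: \<beta>_def B_sub)
    moreover have "\<beta> i a \<in> carrier A" if "a \<in> carrier A" for a
      using f_simps(1)[OF \<open>i < n\<close> p] that by (simp add: \<beta>_def)
    ultimately show ?thesis by (simp add: bhom_def lhom_def)
  qed
  moreover have "lsmult tAA b (t i) = rsmult tAA (t i) b" if "i < n" "b \<in> B" for i b
    using g_simps(3)[OF that(1), of "\<one>\<^bsub>A\<^esub>" b] g_simps(2)[OF that(1), of "\<one>\<^bsub>A\<^esub>" b] that by (simp add: t_def B_sub)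
  ultimately have "d2_data A B n \<beta> t"
    using g_simps(1) by (simp add: d2_data_def t_def)
  moreover have "msum tAA (\<lambda>i. lsmult tAA (\<beta> i a) (t i)) n = pAA \<one>\<^bsub>A\<^esub> a" if "a \<in> carrier A" for a
  proof -
    have "msum tAA (\<lambda>i. lsmult tAA (\<beta> i a) (t i)) n = msum tAA (\<lambda>i. g i (f i (pAA \<one>\<^bsub>A\<^esub> a))) n"
    proof (rule msum_cong)
      fix i assume "i < n"
      then show "lsmult tAA (\<beta> i a) (t i) = g i (f i (pAA \<one>\<^bsub>A\<^esub> a))"
        using g_simps(2)[of i "\<one>\<^bsub>A\<^esub>" "f i (pAA \<one>\<^bsub>A\<^esub> a)"] f_simps(1)[OF _ p] that
        by (simp add: \<beta>_def t_def)
    qed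
    then show ?thesis using gf p that by simp
  qed
  ultimately show ?thesis by (rule that)
qed

lemma ring_addhom:
  "a \<in> carrier A \<Longrightarrow> addhom RA RA (\<lambda>x. a \<otimes>\<^bsub>A\<^esub> x)" "a \<in> carrier A \<Longrightarrow> addhom RA RA (\<lambda>x. x \<otimes>\<^bsub>A\<^esub> a)"
  by (simp_all add: addhom_def A.r_distr A.l_distr)

text \<open>The splitting maps x \<otimes> y to \<open>\<beta> i x\<close> times y, and back a to
  \<open>t i\<close> times a. Right \<open>B\<close>-linearity of \<open>\<beta> i\<close> makes the
  first map balanced; centrality of \<open>t i\<close> makes the second left
  \<open>B\<close>-linear.\<close>

lemma left_d2I:
  assumes d: "d2_data A B n \<beta> t"
    and eq: "\<And>a. a \<in> carrier A \<Longrightarrow> msum tAA (\<lambda>i. rsmult tAA (t i) (\<beta> i a)) n = pAA a \<one>\<^bsub>A\<^esub>"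
  shows "left_d2 A B"
proof -
  have \<beta>: "\<beta> i a \<in> carrier A" "addhom RA RA (\<beta> i)" "b \<in> B \<Longrightarrow> \<beta> i (b \<otimes>\<^bsub>A\<^esub> a) = b \<otimes>\<^bsub>A\<^esub> \<beta> i a"
    "b \<in> B \<Longrightarrow> \<beta> i (a \<otimes>\<^bsub>A\<^esub> b) = \<beta> i a \<otimes>\<^bsub>A\<^esub> b" if "i < n" "a \<in> carrier A" for i a b
    using d that by (simp_all add: d2_data_def bhom_def lhom_def addhom_def)
  have t: "t i \<in> mcarrier tAA" "b \<in> B \<Longrightarrow> lsmult tAA b (t i) = rsmult tAA (t i) b" if "i < n" for i b
    using d that by (simp_all add: d2_data_def)
  have "\<exists>f. addhom tAA RA f \<and> (\<forall>x\<in>carrier A. \<forall>y\<in>carrier A. f (pAA x y) = \<beta> i x \<otimes>\<^bsub>A\<^esub> y)" if i: "i < n" for i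
  proof -
    have "balanced BB RA RA RA (\<lambda>x y. \<beta> i x \<otimes>\<^bsub>A\<^esub> y)"
      by (rule balancedI)
        (use i \<beta>(1,4) in \<open>auto simp: A.m_assoc B_sub intro: ring_addhom addhom_comp[OF \<beta>(2) ring_addhom(2)]\<close>)
    then show ?thesis
      using AA.tens_universal[OF abgrp_ring_bimod[OF ring_A]] by (metis ring_bimod_simps(1))
  qed
  then obtain f where f: "addhom tAA RA (f i)"
    "x \<in> carrier A \<Longrightarrow> y \<in> carrier A \<Longrightarrow> f i (pAA x y) = \<beta> i x \<otimes>\<^bsub>A\<^esub> y" if "i < n" for i x y
    by metis
  have fl: "f i (lsmult tAA b z) = b \<otimes>\<^bsub>A\<^esub> f i z" if "i < n" "z \<in> mcarrier tAA" "b \<in> B" for i z b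
  proof (rule AA.tens_hom_eqI[OF addhom_comp[OF AA.addhom_lsmult f(1)] addhom_comp[OF f(1) ring_addhom(1)]])
    fix x y assume "x \<in> mcarrier RA" "y \<in> mcarrier RA"
    then show "f i (lsmult tAA b (pAA x y)) = b \<otimes>\<^bsub>A\<^esub> f i (pAA x y)"
      using that \<beta>[OF that(1)] by (simp add: AA.lsmult_pure B_sub f A.m_assoc)
  qed (use that B_sub in auto)
  have fr: "f i (rsmult tAA z a) = f i z \<otimes>\<^bsub>A\<^esub> a" if "i < n" "z \<in> mcarrier tAA" "a \<in> carrier A" for i z a
  proof (rule AA.tens_hom_eqI[OF addhom_comp[OF AA.addhom_rsmult f(1)] addhom_comp[OF f(1) ring_addhom(2)]])
    fix x y assume "x \<in> mcarrier RA" "y \<in> mcarrier RA"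
    then show "f i (rsmult tAA (pAA x y) a) = f i (pAA x y) \<otimes>\<^bsub>A\<^esub> a"
      using that \<beta>[OF that(1)] by (simp add: AA.rsmult_pure f A.m_assoc)
  qed (use that in auto)
  show ?thesis unfolding left_d2_def
  proof (rule bdvdI[OF b_tAA_left bRA_left])
    show "bhom BB A tAA RA (f i)" if "i < n" for i
      using fl[OF that] fr[OF that] f(1)[OF that] by (simp add: bhom_def lhom_def addhom_def)
    show "bhom BB A RA tAA (\<lambda>a. rsmult tAA (t i) a)" if "i < n" for i
      using t(1)[OF that] t(2)[OF that, symmetric] AA_r bimodule_assoc[OF AA.bimodule_tens]
      by (simp add: bhom_def lhom_def B_sub)
    fix z assume z: "z \<in> mcarrier tAA"
    show "msum tAA (\<lambda>i. rsmult tAA (t i) (f i z)) n = z"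
    proof (rule AA.tens_hom_eqI[OF _ _ z])
      show "addhom tAA tAA (\<lambda>z. msum tAA (\<lambda>i. rsmult tAA (t i) (f i z)) n)"
      proof (rule addhom_msum_fun[OF AA.abgrp_tens])
        fix i assume "i < n"
        have "addhom RA tAA (rsmult tAA (t i))" using t[OF \<open>i < n\<close>] AA_r by (simp add: addhom_def)
        from addhom_comp[OF f(1)[OF \<open>i < n\<close>] this] show "addhom tAA tAA (\<lambda>z. rsmult tAA (t i) (f i z))" .
      qed
      show "addhom tAA tAA (\<lambda>z. z)" by (simp add: addhom_def)
      fix x y assume "x \<in> mcarrier RA" "y \<in> mcarrier RA"
      then have xy: "x \<in> carrier A" "y \<in> carrier A" by simp_all
      \<comment> \<open>The hypothesis covers x \<otimes> 1; right multiplication by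
        \<open>y\<close> extends it to all pure tensors.\<close>
      have "msum tAA (\<lambda>i. rsmult tAA (t i) (f i (pAA x y))) n = msum tAA (\<lambda>i. rsmult tAA (rsmult tAA (t i) (\<beta> i x)) y) n"
        using xy t \<beta> by (intro msum_cong) (simp add: f AA_r)
      also have "\<dots> = rsmult tAA (msum tAA (\<lambda>i. rsmult tAA (t i) (\<beta> i x)) n) y"
        using xy t(1) \<beta>(1) AA_r(1)
        by (intro addhom_msum[OF AA.abgrp_tens AA.abgrp_tens AA.addhom_rsmult, symmetric]) auto
      also have "\<dots> = pAA x y" using xy by (simp add: eq AA.rsmult_pure)
      finally show "msum tAA (\<lambda>i. rsmult tAA (t i) (f i (pAA x y))) n = pAA x y" .
    qed
  qed
qed

text \<open>Now x \<otimes> y goes to x times \<open>\<beta> i y\<close>, and a goes back to a times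
  \<open>t i\<close>. Left \<open>B\<close>-linearity of \<open>\<beta> i\<close> gives balance;
  centrality gives right \<open>B\<close>-linearity of the second map.\<close>

lemma right_d2I:
  assumes d: "d2_data A B n \<beta> t"
    and eq: "\<And>a. a \<in> carrier A \<Longrightarrow> msum tAA (\<lambda>i. lsmult tAA (\<beta> i a) (t i)) n = pAA \<one>\<^bsub>A\<^esub> a"
  shows "right_d2 A B"
proof -
  have \<beta>: "\<beta> i a \<in> carrier A" "addhom RA RA (\<beta> i)" "b \<in> B \<Longrightarrow> \<beta> i (b \<otimes>\<^bsub>A\<^esub> a) = b \<otimes>\<^bsub>A\<^esub> \<beta> i a"
    "b \<in> B \<Longrightarrow> \<beta> i (a \<otimes>\<^bsub>A\<^esub> b) = \<beta> i a \<otimes>\<^bsub>A\<^esub> b" if "i < n" "a \<in> carrier A" for i a b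
    using d that by (simp_all add: d2_data_def bhom_def lhom_def addhom_def)
  have t: "t i \<in> mcarrier tAA" "b \<in> B \<Longrightarrow> lsmult tAA b (t i) = rsmult tAA (t i) b" if "i < n" for i b
    using d that by (simp_all add: d2_data_def)
  have "\<exists>f. addhom tAA RA f \<and> (\<forall>x\<in>carrier A. \<forall>y\<in>carrier A. f (pAA x y) = x \<otimes>\<^bsub>A\<^esub> \<beta> i y)" if i: "i < n" for i
  proof -
    have "balanced BB RA RA RA (\<lambda>x y. x \<otimes>\<^bsub>A\<^esub> \<beta> i y)"
      by (rule balancedI)
        (use i \<beta>(1,3) in \<open>auto simp: A.m_assoc B_sub intro: ring_addhom addhom_comp[OF \<beta>(2) ring_addhom(1)]\<close>)
    then show ?thesis
      using AA.tens_universal[OF abgrp_ring_bimod[OF ring_A]] by (metis ring_bimod_simps(1))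
  qed
  then obtain f where f: "addhom tAA RA (f i)"
    "x \<in> carrier A \<Longrightarrow> y \<in> carrier A \<Longrightarrow> f i (pAA x y) = x \<otimes>\<^bsub>A\<^esub> \<beta> i y" if "i < n" for i x y
    by metis
  have fl: "f i (lsmult tAA a z) = a \<otimes>\<^bsub>A\<^esub> f i z" if "i < n" "z \<in> mcarrier tAA" "a \<in> carrier A" for i z a
  proof (rule AA.tens_hom_eqI[OF addhom_comp[OF AA.addhom_lsmult f(1)] addhom_comp[OF f(1) ring_addhom(1)]])
    fix x y assume "x \<in> mcarrier RA" "y \<in> mcarrier RA"
    then show "f i (lsmult tAA a (pAA x y)) = a \<otimes>\<^bsub>A\<^esub> f i (pAA x y)"
      using that \<beta>[OF that(1)] by (simp add: AA.lsmult_pure f A.m_assoc)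
  qed (use that in auto)
  have fr: "f i (rsmult tAA z b) = f i z \<otimes>\<^bsub>A\<^esub> b" if "i < n" "z \<in> mcarrier tAA" "b \<in> B" for i z b
  proof (rule AA.tens_hom_eqI[OF addhom_comp[OF AA.addhom_rsmult f(1)] addhom_comp[OF f(1) ring_addhom(2)]])
    fix x y assume "x \<in> mcarrier RA" "y \<in> mcarrier RA"
    then show "f i (rsmult tAA (pAA x y) b) = f i (pAA x y) \<otimes>\<^bsub>A\<^esub> b"
      using that \<beta>[OF that(1)] by (simp add: AA.rsmult_pure B_sub f A.m_assoc)
  qed (use that B_sub in auto)
  show ?thesis unfolding right_d2_def
  proof (rule bdvdI[OF b_tAA_right bRA_right])
    show "bhom A BB tAA RA (f i)" if "i < n" for i
      using fl[OF that] fr[OF that] f(1)[OF that] by (simp add: bhom_def lhom_def addhom_def)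
    show "bhom A BB RA tAA (\<lambda>a. lsmult tAA a (t i))" if "i < n" for i
      using t[OF that] AA_l bimodule_assoc[OF AA.bimodule_tens]
      by (simp add: bhom_def lhom_def B_sub)
    fix z assume z: "z \<in> mcarrier tAA"
    show "msum tAA (\<lambda>i. lsmult tAA (f i z) (t i)) n = z"
    proof (rule AA.tens_hom_eqI[OF _ _ z])
      show "addhom tAA tAA (\<lambda>z. msum tAA (\<lambda>i. lsmult tAA (f i z) (t i)) n)"
      proof (rule addhom_msum_fun[OF AA.abgrp_tens])
        fix i assume "i < n"
        have "addhom RA tAA (\<lambda>a. lsmult tAA a (t i))" using t[OF \<open>i < n\<close>] AA_l by (simp add: addhom_def)
        from addhom_comp[OF f(1)[OF \<open>i < n\<close>] this] show "addhom tAA tAA (\<lambda>z. lsmult tAA (f i z) (t i))" .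
      qed
      show "addhom tAA tAA (\<lambda>z. z)" by (simp add: addhom_def)
      fix x y assume "x \<in> mcarrier RA" "y \<in> mcarrier RA"
      then have xy: "x \<in> carrier A" "y \<in> carrier A" by simp_all
      have "msum tAA (\<lambda>i. lsmult tAA (f i (pAA x y)) (t i)) n = msum tAA (\<lambda>i. lsmult tAA x (lsmult tAA (\<beta> i y) (t i))) n"
        using xy t \<beta> by (intro msum_cong) (simp add: f AA_l)
      also have "\<dots> = lsmult tAA x (msum tAA (\<lambda>i. lsmult tAA (\<beta> i y) (t i)) n)"
        using xy t(1) \<beta>(1) AA_l(1)
        by (intro addhom_msum[OF AA.abgrp_tens AA.abgrp_tens AA.addhom_lsmult, symmetric]) auto
      also have "\<dots> = pAA x y" using xy by (simp add: eq AA.lsmult_pure)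
      finally show "msum tAA (\<lambda>i. lsmult tAA (f i (pAA x y)) (t i)) n = pAA x y" .
    qed
  qed
qed

end

section \<open>Morita equivalent extensions\<close>

text \<open>Passing to a subring changes the carrier only, so sums in \<open>B\<close> may be read
  in \<open>A\<close>.\<close>

lemma msum_ring_bimod_subr: "msum (ring_bimod (subr A B)) f n = msum (ring_bimod A) f n"
  by (induction n) simp_all

lemma addhom_inv_into:
  assumes f: "addhom U Y f" "bij_betw f (mcarrier U) (mcarrier Y)" and U: "abgrp_part U"
  shows "addhom Y U (inv_into (mcarrier U) f)"
proof (rule addhomI)
  let ?g = "inv_into (mcarrier U) f"
  have g: "?g y \<in> mcarrier U" "f (?g y) = y" if "y \<in> mcarrier Y" for y
    using that f(2) by (metis bij_betw_def inv_into_into, metis bij_betw_inv_into_right)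
  show "?g y \<in> mcarrier U" if "y \<in> mcarrier Y" for y using g that by simp
  fix y y' assume y: "y \<in> mcarrier Y" "y' \<in> mcarrier Y"
  have "madd Y y y' = f (madd U (?g y) (?g y'))" using g y f(1) by (simp add: addhom_add)
  moreover have "madd U (?g y) (?g y') \<in> mcarrier U" using g y U by (simp add: abgrp_add_closed)
  ultimately show "?g (madd Y y y') = madd U (?g y) (?g y')"
    using f(2) by (simp add: bij_betw_inv_into_left)
qed

locale morita =
  fixes A :: "'a ring" and B :: "'a set" and A' :: "'b ring" and B' :: "'b set"
    and M :: "('a, 'b, 'm) bimod" and N :: "('a, 'b, 'n) bimod"
  assumes rA: "ring A" and sB: "subring B A" and rA': "ring A'" and sB': "subring B' A'"
    and equiv: "morita_equiv A B A' B' M N"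
begin

sublocale E: ring_extension A B by (rule ring_extension.intro[OF rA sB])
sublocale P: ring_extension A' B' by (rule ring_extension.intro[OF rA' sB'])

abbreviation "BB \<equiv> subr A B"
abbreviation "BB' \<equiv> subr A' B'"
abbreviation "RA \<equiv> ring_bimod A"
abbreviation "RA' \<equiv> ring_bimod A'"
abbreviation "tAN \<equiv> tens BB RA N"
abbreviation "tAM \<equiv> tens BB RA M"
abbreviation "tAA \<equiv> tens BB RA RA"
abbreviation "tPP \<equiv> tens BB' RA' RA'"
abbreviation "pAN \<equiv> tpure BB RA N"
abbreviation "pAM \<equiv> tpure BB RA M"
abbreviation "pAA \<equiv> tpure BB RA RA"
abbreviation "pPP \<equiv> tpure BB' RA' RA'"
abbreviation act (infixr "\<triangleright>" 75) where "a \<triangleright> m \<equiv> lsmult M a m"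
abbreviation ract (infixl "\<triangleleft>" 74) where "m \<triangleleft> c \<equiv> rsmult M m c"

lemma mM: "morita_module A A' M" and mN: "morita_module BB BB' N"
  using equiv by (auto simp: morita_equiv_def)

lemma bM: "bimodule A A' M" and bN: "bimodule BB BB' N"
  using mM mN by (auto simp: morita_module_def)

lemma bM_left: "bimodule BB A' M"
  by (rule bimodule_subring_left[OF rA bM sB])

sublocale AN: tensor_bimod A BB BB' RA N by (rule tensor_bimodI[OF E.bRA_right bN])
sublocale AM: tensor_bimod A BB A' RA M by (rule tensor_bimodI[OF E.bRA_right bM_left])

lemmas abM = bimodule_abgrp[OF bM] and abN = bimodule_abgrp[OF bN]
lemmas M_l = leftmod_simps[OF bimodule_left[OF bM]]
lemmas M_r = rightmod_simps[OF bimodule_right[OF bM]]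
lemmas M_assoc = bimodule_assoc[OF bM]
lemmas N_l = leftmod_simps[OF bimodule_left[OF bN], simplified]
lemmas N_r = rightmod_simps[OF bimodule_right[OF bN], simplified]
lemmas hom_l = leftmod_addhom[OF bimodule_left[OF bM]]
lemmas hom_r = rightmod_addhom[OF bimodule_right[OF bM]]
lemmas abRA = abgrp_ring_bimod[OF rA] and abRA' = abgrp_ring_bimod[OF rA']

lemma hom_l_arg: "m \<in> mcarrier M \<Longrightarrow> addhom RA M (\<lambda>a. a \<triangleright> m)"
  and hom_r_arg: "m \<in> mcarrier M \<Longrightarrow> addhom RA' M (\<lambda>c. m \<triangleleft> c)"
  by (simp_all add: addhom_def M_l M_r)

section \<open>\<open>M\<close> as the module induced from \<open>N\<close>\<close>

definition iso :: "('a \<times> 'n \<Rightarrow> int) set \<Rightarrow> 'm" where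
  "iso = (SOME f. biso A BB' tAN M f)"

definition \<iota> :: "'n \<Rightarrow> 'm" where
  "\<iota> x = iso (pAN \<one>\<^bsub>A\<^esub> x)"

lemma iso: "biso A BB' tAN M iso"
proof -
  have "\<exists>f. biso A BB' tAN M f" using equiv unfolding morita_equiv_def by blast
  then show ?thesis unfolding iso_def by (rule someI_ex)
qed

lemma iso_simps:
  "bij_betw iso (mcarrier tAN) (mcarrier M)" "addhom tAN M iso"
  "a \<in> carrier A \<Longrightarrow> z \<in> mcarrier tAN \<Longrightarrow> iso (lsmult tAN a z) = a \<triangleright> iso z"
  "b \<in> B' \<Longrightarrow> z \<in> mcarrier tAN \<Longrightarrow> iso (rsmult tAN z b) = iso z \<triangleleft> b"
  using iso by (simp_all add: biso_def bhom_def lhom_def addhom_def)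

lemma pAN_closed: "a \<in> carrier A \<Longrightarrow> x \<in> mcarrier N \<Longrightarrow> pAN a x \<in> mcarrier tAN"
  using AN.pure_closed by simp

lemma iota_hom: "addhom N M \<iota>"
  unfolding \<iota>_def[abs_def]
  by (rule addhom_comp[OF AN.addhom_pure_right iso_simps(2)]) simp

lemma iota_closed: "x \<in> mcarrier N \<Longrightarrow> \<iota> x \<in> mcarrier M"
  using addhom_closed[OF iota_hom] .

lemma act_iota: "a \<in> carrier A \<Longrightarrow> x \<in> mcarrier N \<Longrightarrow> a \<triangleright> \<iota> x = iso (pAN a x)"
  using AN.lsmult_pure[of a "\<one>\<^bsub>A\<^esub>" x] iso_simps(3)[of a "pAN \<one>\<^bsub>A\<^esub> x"]
  by (simp add: \<iota>_def pAN_closed)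

lemma iota_l: "b \<in> B \<Longrightarrow> x \<in> mcarrier N \<Longrightarrow> \<iota> (lsmult N b x) = b \<triangleright> \<iota> x"
  using AN.pure_balance[of "\<one>\<^bsub>A\<^esub>" b x] act_iota[of b x] by (simp add: E.B_sub \<iota>_def)

lemma iota_r: "b \<in> B' \<Longrightarrow> x \<in> mcarrier N \<Longrightarrow> \<iota> (rsmult N x b) = \<iota> x \<triangleleft> b"
  using AN.rsmult_pure[of b "\<one>\<^bsub>A\<^esub>" x, symmetric] by (simp add: iso_simps \<iota>_def pAN_closed)

text \<open>Surjectivity of \<open>iso\<close> carries the induction over pure tensors to
  \<open>M\<close>, which is therefore additively generated by the elements
  \<open>a \<triangleright> \<iota> x\<close>.\<close>

lemma M_induct [consumes 1, case_names gen add]: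
  assumes m: "m \<in> mcarrier M"
    and gen: "\<And>a x. a \<in> carrier A \<Longrightarrow> x \<in> mcarrier N \<Longrightarrow> Q (a \<triangleright> \<iota> x)"
    and add: "\<And>m m'. m \<in> mcarrier M \<Longrightarrow> m' \<in> mcarrier M \<Longrightarrow> Q m \<Longrightarrow> Q m' \<Longrightarrow> Q (madd M m m')"
  shows "Q m"
proof -
  have "m \<in> iso ` mcarrier tAN" using m bij_betw_imp_surj_on[OF iso_simps(1)] by simp
  then obtain z where z: "z \<in> mcarrier tAN" "m = iso z" by blast
  have "Q (iso z)" using z(1)
  proof (induction rule: AN.tens_induct)
    case (pure a x)
    then show ?case using gen[of a x] by (simp add: act_iota)
  next
    case (add z w)
    then show ?case using assms(3) iso_simps(2) by (simp add: addhom_add addhom_closed)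
  qed
  then show ?thesis using z by simp
qed

lemma M_hom_eqI:
  assumes "addhom M Z \<phi>" "addhom M Z \<psi>" "m \<in> mcarrier M"
    and "\<And>a x. a \<in> carrier A \<Longrightarrow> x \<in> mcarrier N \<Longrightarrow> \<phi> (a \<triangleright> \<iota> x) = \<psi> (a \<triangleright> \<iota> x)"
  shows "\<phi> m = \<psi> m"
  using assms(3) by (induction rule: M_induct) (use assms in \<open>simp_all add: addhom_add\<close>)

text \<open>The universal property of \<open>tAN\<close>, read on \<open>M\<close> through the
  inverse of \<open>iso\<close>.\<close>

lemma M_universal:
  assumes "abgrp_part Z" "balanced BB RA N Z h"
  shows "\<exists>\<phi>. addhom M Z \<phi> \<and> (\<forall>a\<in>carrier A. \<forall>x\<in>mcarrier N. \<phi> (a \<triangleright> \<iota> x) = h a x)"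
proof -
  obtain \<phi> where \<phi>: "addhom tAN Z \<phi>" "\<And>a x. a \<in> mcarrier RA \<Longrightarrow> x \<in> mcarrier N \<Longrightarrow> \<phi> (pAN a x) = h a x"
    using AN.tens_universal[OF assms] by blast
  show ?thesis
  proof (intro exI conjI ballI)
    show "addhom M Z (\<lambda>m. \<phi> (inv_into (mcarrier tAN) iso m))"
      by (rule addhom_comp[OF addhom_inv_into[OF iso_simps(2,1) AN.abgrp_tens] \<phi>(1)])
    show "\<phi> (inv_into (mcarrier tAN) iso (a \<triangleright> \<iota> x)) = h a x" if "a \<in> carrier A" "x \<in> mcarrier N" for a x
      using that \<phi>(2) bij_betw_inv_into_left[OF iso_simps(1)] by (simp add: act_iota pAN_closed)
  qed
qed

text \<open>Right multiplication by an element of \<open>A'\<close> is left \<open>A\<close>-linear,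
  so its values on the \<open>\<iota> x\<close> determine it on \<open>M\<close>; and
  \<open>A'\<close> acts faithfully by the endomorphism condition on \<open>M\<close>.\<close>

lemma A'_unique:
  assumes c: "c \<in> carrier A'" "d \<in> carrier A'"
    and eq: "\<And>x. x \<in> mcarrier N \<Longrightarrow> \<iota> x \<triangleleft> c = \<iota> x \<triangleleft> d"
  shows "c = d"
proof -
  have "m \<triangleleft> c = m \<triangleleft> d" if "m \<in> mcarrier M" for m
    by (rule M_hom_eqI[OF hom_r[OF c(1)] hom_r[OF c(2)] that])
      (simp add: M_assoc c eq iota_closed)
  then have "restrict (\<lambda>m. m \<triangleleft> c) (mcarrier M) = restrict (\<lambda>m. m \<triangleleft> d) (mcarrier M)"
    by (simp add: restrict_def fun_eq_iff)
  moreover have "inj_on (\<lambda>s. restrict (\<lambda>m. m \<triangleleft> s) (mcarrier M)) (carrier A')"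
    using mM by (simp add: morita_module_def bij_betw_def)
  ultimately show ?thesis using c by (simp add: inj_on_def)
qed

text \<open>Adjunction of induction and restriction: a \<open>B\<close>-linear map from
  \<open>N\<close> to \<open>M\<close> extends to an \<open>A\<close>-linear endomorphism of
  \<open>M\<close>, and each of these is right multiplication by an element of
  \<open>A'\<close>.\<close>

lemma A'_exists:
  assumes h: "lhom BB N M h"
  shows "\<exists>c\<in>carrier A'. \<forall>x\<in>mcarrier N. \<iota> x \<triangleleft> c = h x"
proof -
  have hs: "x \<in> mcarrier N \<Longrightarrow> h x \<in> mcarrier M" "x \<in> mcarrier N \<Longrightarrow> b \<in> B \<Longrightarrow> h (lsmult N b x) = b \<triangleright> h x" for x b
    using h by (simp_all add: lhom_def)
  have "balanced BB RA N M (\<lambda>a x. a \<triangleright> h x)"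
  proof (rule balancedI)
    show "addhom N M (\<lambda>x. a \<triangleright> h x)" if "a \<in> mcarrier RA" for a
      using addhom_comp[OF lhom_addhom[OF h] hom_l] that by simp
  qed (use hs M_l E.B_sub in \<open>simp_all add: hom_l_arg\<close>)
  from M_universal[OF abM this] obtain \<phi> where \<phi>: "addhom M M \<phi>"
    "\<And>a x. a \<in> carrier A \<Longrightarrow> x \<in> mcarrier N \<Longrightarrow> \<phi> (a \<triangleright> \<iota> x) = a \<triangleright> h x" by blast
  have lin: "\<phi> (a \<triangleright> m) = a \<triangleright> \<phi> m" if a: "a \<in> carrier A" and m: "m \<in> mcarrier M" for a m
    by (rule M_hom_eqI[OF addhom_comp[OF hom_l[OF a] \<phi>(1)] addhom_comp[OF \<phi>(1) hom_l[OF a]] m])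
      (simp add: \<phi> a M_l(4)[symmetric] hs iota_closed)
  \<comment> \<open>Endomorphisms are encoded as extensional functions, hence the restriction to the
    carrier.\<close>
  have "lhom A M M (restrict \<phi> (mcarrier M))"
    using \<phi>(1) lin M_l abM by (simp add: lhom_def addhom_def abgrp_add_closed)
  then have "restrict \<phi> (mcarrier M) \<in> (\<lambda>s. restrict (\<lambda>m. m \<triangleleft> s) (mcarrier M)) ` carrier A'"
    using mM by (simp add: morita_module_def bij_betw_def)
  then obtain c where c: "c \<in> carrier A'" "restrict \<phi> (mcarrier M) = restrict (\<lambda>m. m \<triangleleft> c) (mcarrier M)"
    by blast
  have "\<iota> x \<triangleleft> c = h x" if "x \<in> mcarrier N" for x
  proof -
    have "\<iota> x \<triangleleft> c = \<phi> (\<iota> x)"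
      using fun_cong[OF c(2), of "\<iota> x"] iota_closed[OF that] by simp
    then show ?thesis using \<phi>(2)[of "\<one>\<^bsub>A\<^esub>" x] that by (simp add: M_l iota_closed hs)
  qed
  then show ?thesis using c by blast
qed

lemma B'_exists:
  assumes h: "lhom BB N N h"
  shows "\<exists>b\<in>B'. \<forall>x\<in>mcarrier N. rsmult N x b = h x"
proof -
  have hs: "addhom N N h" "b \<in> B \<Longrightarrow> x \<in> mcarrier N \<Longrightarrow> h (lsmult N b x) = lsmult N b (h x)" for b x
    using h by (simp_all add: lhom_def addhom_def)
  have "lhom BB N N (restrict h (mcarrier N))"
    using hs N_l abN by (simp add: lhom_def addhom_def abgrp_add_closed)
  then have "restrict h (mcarrier N) \<in> (\<lambda>s. restrict (\<lambda>m. rsmult N m s) (mcarrier N)) ` B'"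
    using mN by (simp add: morita_module_def bij_betw_def)
  then obtain b where b: "b \<in> B'" "restrict h (mcarrier N) = restrict (\<lambda>m. rsmult N m b) (mcarrier N)"
    by blast
  then show ?thesis by (metis restrict_apply')
qed

section \<open>Elements of \<open>A'\<close> given by maps from \<open>N\<close> to
  \<open>M\<close>\<close>

definition coef :: "('n \<Rightarrow> 'm) \<Rightarrow> 'b" where
  "coef h = (SOME c. c \<in> carrier A' \<and> (\<forall>x\<in>mcarrier N. \<iota> x \<triangleleft> c = h x))"

lemma coef:
  assumes "lhom BB N M h"
  shows "coef h \<in> carrier A'" "x \<in> mcarrier N \<Longrightarrow> \<iota> x \<triangleleft> coef h = h x"
  using someI_ex[OF A'_exists[OF assms, unfolded Bex_def]] unfolding coef_def by auto

text \<open>Rank one maps: a functional on \<open>N\<close> followed by scaling of a fixed vector.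
  With a dual basis for \<open>\<nu>\<close>, sums of them exhaust \<open>A'\<close>, as the proof
  of \<open>Phi_Theta\<close> shows.\<close>

definition e :: "('n \<Rightarrow> 'a) \<Rightarrow> 'm \<Rightarrow> 'b" where
  "e \<nu> m = coef (\<lambda>x. \<nu> x \<triangleright> m)"

context
  fixes \<nu> assumes \<nu>: "lhom BB N (ring_bimod BB) \<nu>"
begin

lemma nu: "x \<in> mcarrier N \<Longrightarrow> \<nu> x \<in> B" "x \<in> mcarrier N \<Longrightarrow> \<nu> x \<in> carrier A"
  "x \<in> mcarrier N \<Longrightarrow> y \<in> mcarrier N \<Longrightarrow> \<nu> (madd N x y) = \<nu> x \<oplus>\<^bsub>A\<^esub> \<nu> y"
  "b \<in> B \<Longrightarrow> x \<in> mcarrier N \<Longrightarrow> \<nu> (lsmult N b x) = b \<otimes>\<^bsub>A\<^esub> \<nu> x"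
  using \<nu> E.B_sub by (simp_all add: lhom_def)

lemma e_closed: "m \<in> mcarrier M \<Longrightarrow> e \<nu> m \<in> carrier A'"
  and iota_e: "m \<in> mcarrier M \<Longrightarrow> x \<in> mcarrier N \<Longrightarrow> \<iota> x \<triangleleft> e \<nu> m = \<nu> x \<triangleright> m"
proof -
  have h: "lhom BB N M (\<lambda>x. \<nu> x \<triangleright> m)" if "m \<in> mcarrier M"
    using that by (simp add: lhom_def nu M_l E.B_sub)
  show "m \<in> mcarrier M \<Longrightarrow> e \<nu> m \<in> carrier A'"
    "m \<in> mcarrier M \<Longrightarrow> x \<in> mcarrier N \<Longrightarrow> \<iota> x \<triangleleft> e \<nu> m = \<nu> x \<triangleright> m"
    using coef[OF h] by (simp_all add: e_def)
qed

lemma e_hom: "addhom M RA' (e \<nu>)"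
proof (rule addhomI)
  fix m m' assume m: "m \<in> mcarrier M" "m' \<in> mcarrier M"
  have "e \<nu> (madd M m m') = e \<nu> m \<oplus>\<^bsub>A'\<^esub> e \<nu> m'"
    using m abM by (intro A'_unique) (simp_all add: e_closed iota_e M_r M_l nu abgrp_add_closed iota_closed)
  then show "e \<nu> (madd M m m') = madd RA' (e \<nu> m) (e \<nu> m')" by simp
qed (simp add: e_closed)

lemma e_mult:
  assumes "m \<in> mcarrier M" "c \<in> carrier A'"
  shows "e \<nu> m \<otimes>\<^bsub>A'\<^esub> c = e \<nu> (m \<triangleleft> c)"
  using assms by (intro A'_unique) (simp_all add: e_closed iota_e M_r nu iota_closed M_assoc)

end

section \<open>The comparison map from A' \<otimes> A' to A \<otimes> M\<close>

definition E :: "'b \<Rightarrow> 'm \<Rightarrow> ('a \<times> 'm \<Rightarrow> int) set" where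
  "E c = (SOME \<phi>. addhom M tAM \<phi> \<and> (\<forall>a\<in>carrier A. \<forall>x\<in>mcarrier N. \<phi> (a \<triangleright> \<iota> x) = pAM a (\<iota> x \<triangleleft> c)))"

text \<open>On A \<otimes> N this is the identity of \<open>A\<close> tensored with
  \<open>\<iota>\<close> followed by right multiplication by \<open>c\<close>. It is balanced
  because both of these commute with scalars from \<open>B\<close>.\<close>

lemma E:
  assumes c: "c \<in> carrier A'"
  shows "addhom M tAM (E c)" "a \<in> carrier A \<Longrightarrow> x \<in> mcarrier N \<Longrightarrow> E c (a \<triangleright> \<iota> x) = pAM a (\<iota> x \<triangleleft> c)"
proof -
  have "balanced BB RA N tAM (\<lambda>a x. pAM a (\<iota> x \<triangleleft> c))"
  proof (rule balancedI)
    show "addhom RA tAM (\<lambda>a. pAM a (\<iota> x \<triangleleft> c))" if "x \<in> mcarrier N" for x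
      using AM.addhom_pure_left that c by (simp add: iota_closed M_r)
    show "addhom N tAM (\<lambda>x. pAM a (\<iota> x \<triangleleft> c))" if "a \<in> mcarrier RA" for a
      using addhom_comp[OF addhom_comp[OF iota_hom hom_r[OF c]] AM.addhom_pure_right[OF that]] .
    show "pAM (rsmult RA a b) (\<iota> x \<triangleleft> c) = pAM a (\<iota> (lsmult N b x) \<triangleleft> c)"
      if "a \<in> mcarrier RA" "b \<in> carrier BB" "x \<in> mcarrier N" for a b x
      using that c AM.pure_balance[of a b "\<iota> x \<triangleleft> c"]
      by (simp add: iota_l M_assoc E.B_sub iota_closed M_r)
  qed
  from someI_ex[OF M_universal[OF AM.abgrp_tens this]]
  show "addhom M tAM (E c)" "a \<in> carrier A \<Longrightarrow> x \<in> mcarrier N \<Longrightarrow> E c (a \<triangleright> \<iota> x) = pAM a (\<iota> x \<triangleleft> c)"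
    unfolding E_def by blast+
qed

lemma E_closed: "c \<in> carrier A' \<Longrightarrow> m \<in> mcarrier M \<Longrightarrow> E c m \<in> mcarrier tAM"
  using addhom_closed[OF E(1)] .

lemma E_iota: "c \<in> carrier A' \<Longrightarrow> x \<in> mcarrier N \<Longrightarrow> E c (\<iota> x) = pAM \<one>\<^bsub>A\<^esub> (\<iota> x \<triangleleft> c)"
  using E(2)[of c "\<one>\<^bsub>A\<^esub>" x] by (simp add: M_l iota_closed)

lemma E_lin:
  assumes "c \<in> carrier A'" "m \<in> mcarrier M" "a \<in> carrier A"
  shows "E c (a \<triangleright> m) = lsmult tAM a (E c m)"
  by (rule M_hom_eqI[OF addhom_comp[OF hom_l E(1)] addhom_comp[OF E(1) AM.addhom_lsmult]])
    (use assms in \<open>simp_all add: M_l(4)[symmetric] iota_closed E AM.lsmult_pure M_r\<close>)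

lemma E_mult:
  assumes "c \<in> carrier A'" "m \<in> mcarrier M" "d \<in> carrier A'"
  shows "E (c \<otimes>\<^bsub>A'\<^esub> d) m = rsmult tAM (E c m) d"
  by (rule M_hom_eqI[OF E(1) addhom_comp[OF E(1) AM.addhom_rsmult]])
    (use assms in \<open>simp_all add: iota_closed E AM.rsmult_pure M_r\<close>)

lemma E_add:
  assumes "c \<in> carrier A'" "m \<in> mcarrier M" "d \<in> carrier A'"
  shows "E (c \<oplus>\<^bsub>A'\<^esub> d) m = madd tAM (E c m) (E d m)"
  by (rule M_hom_eqI[OF E(1) addhom_add_fun[OF AM.abgrp_tens E(1) E(1)]])
    (use assms in \<open>simp_all add: iota_closed E AM.pure_add_right M_r\<close>)

text \<open>Scalars from \<open>B'\<close> already act on \<open>N\<close>: \<open>b\<close> is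
  absorbed into \<open>x\<close> by \<open>iota_r\<close> and reappears in front of
  \<open>c\<close>. This is the balance over \<open>B'\<close> on which \<open>\<Theta>\<close>
  rests.\<close>

lemma E_bal:
  assumes "c \<in> carrier A'" "m \<in> mcarrier M" "b \<in> B'"
  shows "E c (m \<triangleleft> b) = E (b \<otimes>\<^bsub>A'\<^esub> c) m"
proof (rule M_hom_eqI[OF addhom_comp[OF hom_r E(1)] E(1)])
  fix a x assume ax: "a \<in> carrier A" "x \<in> mcarrier N"
  have *: "(a \<triangleright> \<iota> x) \<triangleleft> b = a \<triangleright> \<iota> (rsmult N x b)"
    using ax assms by (simp add: M_assoc P.B_sub iota_closed iota_r)
  have "E c ((a \<triangleright> \<iota> x) \<triangleleft> b) = pAM a (\<iota> (rsmult N x b) \<triangleleft> c)"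
    unfolding * using ax assms by (intro E(2)) (simp_all add: N_r)
  then show "E c ((a \<triangleright> \<iota> x) \<triangleleft> b) = E (b \<otimes>\<^bsub>A'\<^esub> c) (a \<triangleright> \<iota> x)"
    using ax assms by (simp add: E P.B_sub iota_r M_r iota_closed)
qed (use assms P.B_sub in auto)

definition \<Theta> :: "'m \<Rightarrow> ('b \<times> 'b \<Rightarrow> int) set \<Rightarrow> ('a \<times> 'm \<Rightarrow> int) set" where
  "\<Theta> m = (SOME \<phi>. addhom tPP tAM \<phi> \<and> (\<forall>c\<in>carrier A'. \<forall>d\<in>carrier A'. \<phi> (pPP c d) = E d (m \<triangleleft> c)))"

lemma Theta:
  assumes m: "m \<in> mcarrier M"
  shows "addhom tPP tAM (\<Theta> m)"
    "c \<in> carrier A' \<Longrightarrow> d \<in> carrier A' \<Longrightarrow> \<Theta> m (pPP c d) = E d (m \<triangleleft> c)"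
proof -
  have "balanced BB' RA' RA' tAM (\<lambda>c d. E d (m \<triangleleft> c))"
  proof (rule balancedI)
    show "addhom RA' tAM (\<lambda>c. E d (m \<triangleleft> c))" if "d \<in> mcarrier RA'" for d
      using addhom_comp[OF hom_r_arg[OF m] E(1)] that by simp
    show "addhom RA' tAM (\<lambda>d. E d (m \<triangleleft> c))" if "c \<in> mcarrier RA'" for c
      using that m by (intro addhomI) (simp_all add: E_closed E_add M_r)
    show "E d (m \<triangleleft> rsmult RA' c b) = E (lsmult RA' b d) (m \<triangleleft> c)"
      if "c \<in> mcarrier RA'" "b \<in> carrier BB'" "d \<in> mcarrier RA'" for c b d
      using that m E_bal[of d "m \<triangleleft> c" b] by (simp add: M_r P.B_sub)
  qed
  from P.AA.tens_universal[OF AM.abgrp_tens this]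
  have "\<exists>\<phi>. addhom tPP tAM \<phi> \<and> (\<forall>c\<in>carrier A'. \<forall>d\<in>carrier A'. \<phi> (pPP c d) = E d (m \<triangleleft> c))"
    by (metis ring_bimod_simps(1))
  from someI_ex[OF this] show "addhom tPP tAM (\<Theta> m)"
    "c \<in> carrier A' \<Longrightarrow> d \<in> carrier A' \<Longrightarrow> \<Theta> m (pPP c d) = E d (m \<triangleleft> c)"
    unfolding \<Theta>_def by blast+
qed

lemma Theta_closed: "m \<in> mcarrier M \<Longrightarrow> z \<in> mcarrier tPP \<Longrightarrow> \<Theta> m z \<in> mcarrier tAM"
  using addhom_closed[OF Theta(1)] .

lemma Theta_lin:
  assumes "m \<in> mcarrier M" "a \<in> carrier A" "z \<in> mcarrier tPP"
  shows "\<Theta> (a \<triangleright> m) z = lsmult tAM a (\<Theta> m z)"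
  by (rule P.AA.tens_hom_eqI[OF Theta(1) addhom_comp[OF Theta(1) AM.addhom_lsmult]])
    (use assms in \<open>simp_all add: M_l M_r M_assoc Theta E_lin\<close>)

lemma Theta_add:
  assumes "m \<in> mcarrier M" "m' \<in> mcarrier M" "z \<in> mcarrier tPP"
  shows "\<Theta> (madd M m m') z = madd tAM (\<Theta> m z) (\<Theta> m' z)"
proof (rule P.AA.tens_hom_eqI[OF Theta(1) addhom_add_fun[OF AM.abgrp_tens Theta(1) Theta(1)]])
  show "\<Theta> (madd M m m') (pPP c d) = madd tAM (\<Theta> m (pPP c d)) (\<Theta> m' (pPP c d))"
    if "c \<in> mcarrier RA'" "d \<in> mcarrier RA'" for c d
    using that assms abM by (simp add: M_r Theta abgrp_add_closed addhom_add[OF E(1)])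
qed (use assms abM in \<open>simp_all add: abgrp_add_closed\<close>)

lemma Theta_hom_arg: "z \<in> mcarrier tPP \<Longrightarrow> addhom M tAM (\<lambda>m. \<Theta> m z)"
  by (rule addhomI) (simp_all add: Theta_closed Theta_add)

text \<open>A left factor acts on the vector before anything else, so it can be shifted from the
  tensor to \<open>m\<close>.\<close>

lemma Theta_left:
  assumes "m \<in> mcarrier M" "c \<in> carrier A'" "z \<in> mcarrier tPP"
  shows "\<Theta> m (lsmult tPP c z) = \<Theta> (m \<triangleleft> c) z"
  by (rule P.AA.tens_hom_eqI[OF addhom_comp[OF P.AA.addhom_lsmult Theta(1)] Theta(1)])
    (use assms in \<open>simp_all add: M_r Theta P.AA.lsmult_pure\<close>)

lemma Theta_right:
  assumes "m \<in> mcarrier M" "c \<in> carrier A'" "z \<in> mcarrier tPP"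
  shows "\<Theta> m (rsmult tPP z c) = rsmult tAM (\<Theta> m z) c"
  by (rule P.AA.tens_hom_eqI[OF addhom_comp[OF P.AA.addhom_rsmult Theta(1)] addhom_comp[OF Theta(1) AM.addhom_rsmult]])
    (use assms in \<open>simp_all add: M_r Theta P.AA.rsmult_pure E_mult\<close>)

text \<open>The contraction written as t \<cdot> m in the opening comment: the identification of (A
  \<otimes> A) \<otimes> M, the outer product taken over \<open>A\<close>, with A \<otimes> M,
  evaluated at the vector \<open>m\<close>.\<close>

definition \<rho> :: "'m \<Rightarrow> ('a \<times> 'a \<Rightarrow> int) set \<Rightarrow> ('a \<times> 'm \<Rightarrow> int) set" where
  "\<rho> m = (SOME \<phi>. addhom tAA tAM \<phi> \<and> (\<forall>p\<in>carrier A. \<forall>q\<in>carrier A. \<phi> (pAA p q) = pAM p (q \<triangleright> m)))"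

lemma rho:
  assumes m: "m \<in> mcarrier M"
  shows "addhom tAA tAM (\<rho> m)"
    "p \<in> carrier A \<Longrightarrow> q \<in> carrier A \<Longrightarrow> \<rho> m (pAA p q) = pAM p (q \<triangleright> m)"
proof -
  have "balanced BB RA RA tAM (\<lambda>p q. pAM p (q \<triangleright> m))"
  proof (rule balancedI)
    show "addhom RA tAM (\<lambda>p. pAM p (q \<triangleright> m))" if "q \<in> mcarrier RA" for q
      using AM.addhom_pure_left that m by (simp add: M_l)
    show "addhom RA tAM (\<lambda>q. pAM p (q \<triangleright> m))" if "p \<in> mcarrier RA" for p
      using addhom_comp[OF hom_l_arg[OF m] AM.addhom_pure_right[OF that]] .
    show "pAM (rsmult RA p b) (q \<triangleright> m) = pAM p (lsmult RA b q \<triangleright> m)"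
      if "p \<in> mcarrier RA" "b \<in> carrier BB" "q \<in> mcarrier RA" for p b q
      using that m AM.pure_balance[of p b "q \<triangleright> m"] by (simp add: M_l E.B_sub)
  qed
  from E.AA.tens_universal[OF AM.abgrp_tens this]
  have "\<exists>\<phi>. addhom tAA tAM \<phi> \<and> (\<forall>p\<in>carrier A. \<forall>q\<in>carrier A. \<phi> (pAA p q) = pAM p (q \<triangleright> m))"
    by (metis ring_bimod_simps(1))
  from someI_ex[OF this] show "addhom tAA tAM (\<rho> m)"
    "p \<in> carrier A \<Longrightarrow> q \<in> carrier A \<Longrightarrow> \<rho> m (pAA p q) = pAM p (q \<triangleright> m)"
    unfolding \<rho>_def by blast+
qed

lemma rho_closed: "m \<in> mcarrier M \<Longrightarrow> t \<in> mcarrier tAA \<Longrightarrow> \<rho> m t \<in> mcarrier tAM"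
  using addhom_closed[OF rho(1)] .

lemma rho_add:
  assumes "m \<in> mcarrier M" "m' \<in> mcarrier M" "t \<in> mcarrier tAA"
  shows "\<rho> (madd M m m') t = madd tAM (\<rho> m t) (\<rho> m' t)"
  by (rule E.AA.tens_hom_eqI[OF rho(1) addhom_add_fun[OF AM.abgrp_tens rho(1) rho(1)]])
    (use assms abM in \<open>simp_all add: M_l rho abgrp_add_closed AM.pure_add_right\<close>)

lemma rho_hom_arg: "t \<in> mcarrier tAA \<Longrightarrow> addhom M tAM (\<lambda>m. \<rho> m t)"
  by (rule addhomI) (simp_all add: rho_closed rho_add)

lemma rho_left:
  assumes "m \<in> mcarrier M" "a \<in> carrier A" "t \<in> mcarrier tAA"
  shows "\<rho> m (lsmult tAA a t) = lsmult tAM a (\<rho> m t)"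
  by (rule E.AA.tens_hom_eqI[OF addhom_comp[OF E.AA.addhom_lsmult rho(1)] addhom_comp[OF rho(1) AM.addhom_lsmult]])
    (use assms in \<open>simp_all add: M_l rho E.AA.lsmult_pure AM.lsmult_pure\<close>)

text \<open>Together with \<open>rho_left\<close> this turns centrality of \<open>t\<close> over
  \<open>B\<close> into left \<open>B\<close>-linearity in the vector \<open>m\<close>.\<close>

lemma rho_right:
  assumes "m \<in> mcarrier M" "a \<in> carrier A" "t \<in> mcarrier tAA"
  shows "\<rho> m (rsmult tAA t a) = \<rho> (a \<triangleright> m) t"
  by (rule E.AA.tens_hom_eqI[OF addhom_comp[OF E.AA.addhom_rsmult rho(1)] rho(1)])
    (use assms in \<open>simp_all add: M_l rho E.AA.rsmult_pure\<close>)

lemma rho_act: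
  assumes "m \<in> mcarrier M" "c \<in> carrier A'" "t \<in> mcarrier tAA"
  shows "rsmult tAM (\<rho> m t) c = \<rho> (m \<triangleleft> c) t"
  by (rule E.AA.tens_hom_eqI[OF addhom_comp[OF rho(1) AM.addhom_rsmult] rho(1)])
    (use assms in \<open>simp_all add: M_l M_r rho AM.rsmult_pure M_assoc\<close>)

section \<open>Transport of bimodule endomorphisms of \<open>A\<close> to \<open>A'\<close>\<close>

definition lift :: "('a \<Rightarrow> 'a) \<Rightarrow> 'm \<Rightarrow> 'm" where
  "lift \<beta> = (SOME \<phi>. addhom M M \<phi> \<and> (\<forall>a\<in>carrier A. \<forall>x\<in>mcarrier N. \<phi> (a \<triangleright> \<iota> x) = \<beta> a \<triangleright> \<iota> x))"

definition \<gamma> :: "('a \<Rightarrow> 'a) \<Rightarrow> 'b \<Rightarrow> 'b" where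
  "\<gamma> \<beta> c = coef (\<lambda>x. lift \<beta> (\<iota> x \<triangleleft> c))"

context
  fixes \<beta> assumes \<beta>: "bhom BB BB RA RA \<beta>"
begin

lemma beta: "a \<in> carrier A \<Longrightarrow> \<beta> a \<in> carrier A"
  "a \<in> carrier A \<Longrightarrow> a' \<in> carrier A \<Longrightarrow> \<beta> (a \<oplus>\<^bsub>A\<^esub> a') = \<beta> a \<oplus>\<^bsub>A\<^esub> \<beta> a'"
  "a \<in> carrier A \<Longrightarrow> b \<in> B \<Longrightarrow> \<beta> (b \<otimes>\<^bsub>A\<^esub> a) = b \<otimes>\<^bsub>A\<^esub> \<beta> a"
  "a \<in> carrier A \<Longrightarrow> b \<in> B \<Longrightarrow> \<beta> (a \<otimes>\<^bsub>A\<^esub> b) = \<beta> a \<otimes>\<^bsub>A\<^esub> b"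
  using \<beta> by (simp_all add: bhom_def lhom_def)

text \<open>Right \<open>B\<close>-linearity of \<open>\<beta>\<close> is what makes \<beta>
  \<otimes> N balanced; its left linearity enters in \<open>lift_l\<close>.\<close>

lemma lift: "addhom M M (lift \<beta>)"
  "a \<in> carrier A \<Longrightarrow> x \<in> mcarrier N \<Longrightarrow> lift \<beta> (a \<triangleright> \<iota> x) = \<beta> a \<triangleright> \<iota> x"
proof -
  have "balanced BB RA N M (\<lambda>a x. \<beta> a \<triangleright> \<iota> x)"
  proof (rule balancedI)
    show "addhom RA M (\<lambda>a. \<beta> a \<triangleright> \<iota> x)" if "x \<in> mcarrier N" for x
      using addhom_comp[OF bhom_addhom[OF \<beta>] hom_l_arg[OF iota_closed[OF that]]] .
    show "addhom N M (\<lambda>x. \<beta> a \<triangleright> \<iota> x)" if "a \<in> mcarrier RA" for a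
      using addhom_comp[OF iota_hom hom_l] that beta by simp
  qed (simp add: beta iota_l M_l E.B_sub iota_closed)
  from someI_ex[OF M_universal[OF abM this]]
  show "addhom M M (lift \<beta>)" "a \<in> carrier A \<Longrightarrow> x \<in> mcarrier N \<Longrightarrow> lift \<beta> (a \<triangleright> \<iota> x) = \<beta> a \<triangleright> \<iota> x"
    unfolding lift_def by blast+
qed

lemma lift_l:
  assumes "b \<in> B" "m \<in> mcarrier M" shows "lift \<beta> (b \<triangleright> m) = b \<triangleright> lift \<beta> m"
  by (rule M_hom_eqI[OF addhom_comp[OF hom_l lift(1)] addhom_comp[OF lift(1) hom_l]])
    (use assms in \<open>simp_all add: E.B_sub M_l(4)[symmetric] iota_closed lift beta\<close>)

text \<open>\<open>\<beta>\<close> affects the factor \<open>A\<close> and \<open>b\<close> the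
  factor \<open>N\<close>, so the two operations commute.\<close>

lemma lift_r:
  assumes "b \<in> B'" "m \<in> mcarrier M" shows "lift \<beta> (m \<triangleleft> b) = lift \<beta> m \<triangleleft> b"
  by (rule M_hom_eqI[OF addhom_comp[OF hom_r lift(1)] addhom_comp[OF lift(1) hom_r]])
    (use assms in \<open>simp_all add: P.B_sub M_assoc iota_closed lift beta iota_r[symmetric] N_r\<close>)

text \<open>By \<open>lift_l\<close> the map from \<open>N\<close> to \<open>M\<close> defining
  \<open>\<gamma> \<beta> c\<close> is left \<open>B\<close>-linear, so an element of
  \<open>A'\<close> represents it.\<close>

lemma gamma_closed: "c \<in> carrier A' \<Longrightarrow> \<gamma> \<beta> c \<in> carrier A'"
  and iota_gamma: "c \<in> carrier A' \<Longrightarrow> x \<in> mcarrier N \<Longrightarrow> \<iota> x \<triangleleft> \<gamma> \<beta> c = lift \<beta> (\<iota> x \<triangleleft> c)"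
proof -
  have h: "lhom BB N M (\<lambda>x. lift \<beta> (\<iota> x \<triangleleft> c))" if c: "c \<in> carrier A'"
    using addhom_comp[OF addhom_comp[OF iota_hom hom_r[OF c]] lift(1)] c
    by (simp add: lhom_def addhom_def iota_l M_assoc lift_l E.B_sub iota_closed M_r)
  show "c \<in> carrier A' \<Longrightarrow> \<gamma> \<beta> c \<in> carrier A'"
    "c \<in> carrier A' \<Longrightarrow> x \<in> mcarrier N \<Longrightarrow> \<iota> x \<triangleleft> \<gamma> \<beta> c = lift \<beta> (\<iota> x \<triangleleft> c)"
    using coef[OF h] by (simp_all add: \<gamma>_def)
qed

text \<open>A left factor \<open>b\<close> is absorbed into \<open>x\<close>, since
  \<open>\<iota> x \<triangleleft> b\<close> is \<open>\<iota>\<close> of an element of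
  \<open>N\<close>; a right factor passes through \<open>lift_r\<close>.\<close>

lemma gamma_bhom: "bhom BB' BB' RA' RA' (\<gamma> \<beta>)"
proof -
  have "\<gamma> \<beta> (c \<oplus>\<^bsub>A'\<^esub> d) = \<gamma> \<beta> c \<oplus>\<^bsub>A'\<^esub> \<gamma> \<beta> d" if "c \<in> carrier A'" "d \<in> carrier A'" for c d
    using that by (intro A'_unique)
      (simp_all add: gamma_closed iota_gamma M_r iota_closed addhom_add[OF lift(1)])
  moreover have "\<gamma> \<beta> (b \<otimes>\<^bsub>A'\<^esub> c) = b \<otimes>\<^bsub>A'\<^esub> \<gamma> \<beta> c" if "c \<in> carrier A'" "b \<in> B'" for c b
    using that by (intro A'_unique)
      (simp_all add: gamma_closed iota_gamma M_r iota_closed P.B_sub iota_r[symmetric] N_r)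
  moreover have "\<gamma> \<beta> (c \<otimes>\<^bsub>A'\<^esub> b) = \<gamma> \<beta> c \<otimes>\<^bsub>A'\<^esub> b" if "c \<in> carrier A'" "b \<in> B'" for c b
    using that by (intro A'_unique)
      (simp_all add: gamma_closed iota_gamma M_r iota_closed P.B_sub lift_r)
  ultimately show ?thesis by (simp add: bhom_def lhom_def gamma_closed)
qed

end

end

section \<open>Transport along dual bases\<close>

text \<open>\<open>\<nu>\<close> and \<open>u\<close> form a dual basis, expressing that
  \<open>N\<close> is finitely generated projective over \<open>B\<close>. \<open>\<mu>\<close> and
  \<open>v\<close> express that \<open>N\<close> is a generator: values of functionals sum to
  1.\<close>

locale morita_bases = morita A B A' B' M N
  for A :: "'a ring" and B :: "'a set" and A' :: "'b ring" and B' :: "'b set"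
    and M :: "('a, 'b, 'm) bimod" and N :: "('a, 'b, 'n) bimod" +
  fixes K L :: nat and \<nu> \<mu> :: "nat \<Rightarrow> 'n \<Rightarrow> 'a" and u v :: "nat \<Rightarrow> 'n"
  assumes nu_lhom: "k < K \<Longrightarrow> lhom (subr A B) N (ring_bimod (subr A B)) (\<nu> k)"
    and u: "k < K \<Longrightarrow> u k \<in> mcarrier N"
    and nu_sum: "x \<in> mcarrier N \<Longrightarrow> msum N (\<lambda>k. lsmult N (\<nu> k x) (u k)) K = x"
    and mu_lhom: "l < L \<Longrightarrow> lhom (subr A B) N (ring_bimod (subr A B)) (\<mu> l)"
    and v: "l < L \<Longrightarrow> v l \<in> mcarrier N"
    and mu_sum: "msum (ring_bimod A) (\<lambda>l. \<mu> l (v l)) L = \<one>\<^bsub>A\<^esub>"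
begin

lemma mu_unit:
  assumes "abgrp_part Z" "addhom RA Z f"
  shows "msum Z (\<lambda>l. f (\<mu> l (v l))) L = f \<one>\<^bsub>A\<^esub>"
  using addhom_msum[OF abRA assms, of L "\<lambda>l. \<mu> l (v l)"] nu[OF mu_lhom] v mu_sum by simp

lemma nu_expand:
  assumes "abgrp_part Z" "addhom N Z f" "x \<in> mcarrier N"
  shows "msum Z (\<lambda>k. f (lsmult N (\<nu> k x) (u k))) K = f x"
  using addhom_msum[OF abN assms(1,2), of K "\<lambda>k. lsmult N (\<nu> k x) (u k)"] nu[OF nu_lhom] u nu_sum assms(3)
  by (simp add: N_l)

text \<open>The matrix of the right multiplications \<open>x \<mapsto> \<mu>\<^sub>l(x)y\<close>, so that \<open>y = \<Sum>\<^sub>l v\<^sub>l \<cdot> cc l y\<close>.\<close>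

definition cc :: "nat \<Rightarrow> 'n \<Rightarrow> 'b" where
  "cc l y = (SOME b. b \<in> B' \<and> (\<forall>x\<in>mcarrier N. rsmult N x b = lsmult N (\<mu> l x) y))"

lemma cc:
  assumes l: "l < L" and y: "y \<in> mcarrier N"
  shows "cc l y \<in> B'" "x \<in> mcarrier N \<Longrightarrow> rsmult N x (cc l y) = lsmult N (\<mu> l x) y"
proof -
  have "lhom BB N N (\<lambda>x. lsmult N (\<mu> l x) y)"
    using nu[OF mu_lhom[OF l]] y by (simp add: lhom_def N_l)
  from B'_exists[OF this] have "\<exists>b. b \<in> B' \<and> (\<forall>x\<in>mcarrier N. rsmult N x b = lsmult N (\<mu> l x) y)"
    by blast
  from someI_ex[OF this]
  show "cc l y \<in> B'" "x \<in> mcarrier N \<Longrightarrow> rsmult N x (cc l y) = lsmult N (\<mu> l x) y"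
    unfolding cc_def by blast+
qed

text \<open>By the choice of \<open>cc\<close> the summands are \<open>\<mu> l (v l)\<close> times
  \<open>y\<close>, and these coefficients sum to 1.\<close>

lemma cc_expand:
  assumes y: "y \<in> mcarrier N"
  shows "msum N (\<lambda>l. rsmult N (v l) (cc l y)) L = y"
proof -
  have "msum N (\<lambda>l. rsmult N (v l) (cc l y)) L = msum N (\<lambda>l. lsmult N (\<mu> l (v l)) y) L"
    using cc(2)[OF _ y] v by (intro msum_cong) simp
  \<comment> \<open>\<open>N\<close> is a module over \<open>B\<close> only, so the coefficients are
    summed in \<open>subr A B\<close> and the value is then read off in \<open>A\<close>.\<close>
  also have "\<dots> = lsmult N (msum (ring_bimod BB) (\<lambda>l. \<mu> l (v l)) L) y"
  proof (rule addhom_msum[symmetric])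
    show "abgrp_part (ring_bimod BB)" by (rule abgrp_ring_bimod[OF ring.subring_is_ring[OF rA sB]])
    show "addhom (ring_bimod BB) N (\<lambda>b. lsmult N b y)" using y by (simp add: addhom_def N_l)
  qed (use abN nu[OF mu_lhom] v in simp_all)
  also have "\<dots> = y" using y by (simp add: msum_ring_bimod_subr mu_sum N_l)
  finally show ?thesis .
qed

text \<open>On \<open>\<iota> x\<close> both sides give \<open>\<mu> l x\<close> times
  \<open>\<iota> y \<triangleleft> d\<close>, because \<open>cc l y\<close> acts already within
  \<open>N\<close>.\<close>

lemma cc_mult:
  assumes "l < L" "y \<in> mcarrier N" "d \<in> carrier A'"
  shows "cc l y \<otimes>\<^bsub>A'\<^esub> d = e (\<mu> l) (\<iota> y \<triangleleft> d)"
proof (rule A'_unique)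
  fix x assume x: "x \<in> mcarrier N"
  have "\<iota> x \<triangleleft> (cc l y \<otimes>\<^bsub>A'\<^esub> d) = \<iota> (rsmult N x (cc l y)) \<triangleleft> d"
    using assms x cc(1)[OF assms(1,2)] by (simp add: M_r P.B_sub iota_closed iota_r)
  also have "\<dots> = \<mu> l x \<triangleright> (\<iota> y \<triangleleft> d)"
    using assms x nu[OF mu_lhom[OF assms(1)]] by (simp add: cc iota_l M_assoc iota_closed)
  finally show "\<iota> x \<triangleleft> (cc l y \<otimes>\<^bsub>A'\<^esub> d) = \<iota> x \<triangleleft> e (\<mu> l) (\<iota> y \<triangleleft> d)"
    using assms x by (simp add: iota_e[OF mu_lhom] iota_closed M_r)
qed (use assms cc(1) in \<open>simp_all add: P.B_sub e_closed[OF mu_lhom] iota_closed M_r\<close>)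

lemma pPP_closed: "c \<in> carrier A' \<Longrightarrow> d \<in> carrier A' \<Longrightarrow> pPP c d \<in> mcarrier tPP"
  using P.AA.pure_closed by simp

text \<open>Expanding \<open>y\<close> by \<open>cc_expand\<close> exposes the elements
  \<open>cc l y\<close> of \<open>B'\<close>. By \<open>e_mult\<close> they stand at the right of
  the first tensor factor, and balance over \<open>B'\<close> moves them to the second.\<close>

lemma slide:
  assumes \<eta>: "lhom BB N (ring_bimod BB) \<eta>" and a: "a \<in> carrier A" and y: "y \<in> mcarrier N" and d: "d \<in> carrier A'"
  shows "pPP (e \<eta> (a \<triangleright> \<iota> y)) d = msum tPP (\<lambda>l. pPP (e \<eta> (a \<triangleright> \<iota> (v l))) (cc l y \<otimes>\<^bsub>A'\<^esub> d)) L"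
proof -
  have hom: "addhom N tPP (\<lambda>y. pPP (e \<eta> (a \<triangleright> \<iota> y)) d)"
    by (rule addhom_comp[OF addhom_comp[OF addhom_comp[OF iota_hom hom_l[OF a]] e_hom[OF \<eta>]]
          P.AA.addhom_pure_left]) (simp add: d)
  have "pPP (e \<eta> (a \<triangleright> \<iota> y)) d = pPP (e \<eta> (a \<triangleright> \<iota> (msum N (\<lambda>l. rsmult N (v l) (cc l y)) L))) d"
    using y by (simp add: cc_expand)
  also have "\<dots> = msum tPP (\<lambda>l. pPP (e \<eta> (a \<triangleright> \<iota> (rsmult N (v l) (cc l y)))) d) L"
    using v cc(1)[OF _ y] by (intro addhom_msum[OF abN P.AA.abgrp_tens hom]) (simp add: N_r)
  also have "\<dots> = msum tPP (\<lambda>l. pPP (e \<eta> (a \<triangleright> \<iota> (v l))) (cc l y \<otimes>\<^bsub>A'\<^esub> d)) L"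
  proof (rule msum_cong)
    fix l assume l: "l < L"
    note c = cc(1)[OF l y] and vl = v[OF l]
    have "e \<eta> (a \<triangleright> \<iota> (rsmult N (v l) (cc l y))) = e \<eta> (a \<triangleright> \<iota> (v l)) \<otimes>\<^bsub>A'\<^esub> cc l y"
      using a c vl by (simp add: e_mult[OF \<eta>] M_l iota_closed P.B_sub iota_r M_assoc)
    then show "pPP (e \<eta> (a \<triangleright> \<iota> (rsmult N (v l) (cc l y)))) d = pPP (e \<eta> (a \<triangleright> \<iota> (v l))) (cc l y \<otimes>\<^bsub>A'\<^esub> d)"
      using a c vl d P.AA.pure_balance[of "e \<eta> (a \<triangleright> \<iota> (v l))" "cc l y" d]
      by (simp add: e_closed[OF \<eta>] M_l iota_closed)
  qed
  finally show ?thesis .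
qed

text \<open>The inverse of \<open>\<Theta>\<close> is \<open>w \<mapsto> \<Sum>\<^sub>k \<Phi>\<^bsub>\<nu>\<^sub>k\<^esub>(w(u\<^sub>k))\<close>; see \<open>Phi_Theta\<close> and \<open>Theta_Phi\<close>.\<close>

definition \<Phi> :: "('n \<Rightarrow> 'a) \<Rightarrow> ('a \<times> 'm \<Rightarrow> int) set \<Rightarrow> ('b \<times> 'b \<Rightarrow> int) set" where
  "\<Phi> \<eta> = (SOME \<phi>. addhom tAM tPP \<phi> \<and> (\<forall>a\<in>carrier A. \<forall>m\<in>mcarrier M.
     \<phi> (pAM a m) = msum tPP (\<lambda>l. pPP (e \<eta> (a \<triangleright> \<iota> (v l))) (e (\<mu> l) m)) L))"

context
  fixes \<eta> assumes \<eta>: "lhom BB N (ring_bimod BB) \<eta>"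
begin

text \<open>The substance is balance over \<open>B\<close>: \<open>slide\<close> spreads
  \<open>b\<close> over a double sum, and interchanging the summations lets \<open>mu_unit\<close>
  collapse it with \<open>b\<close> in the second factor.\<close>

lemma Phi: "addhom tAM tPP (\<Phi> \<eta>)"
  "a \<in> carrier A \<Longrightarrow> m \<in> mcarrier M \<Longrightarrow>
     \<Phi> \<eta> (pAM a m) = msum tPP (\<lambda>l. pPP (e \<eta> (a \<triangleright> \<iota> (v l))) (e (\<mu> l) m)) L"
proof -
  let ?h = "\<lambda>a m. msum tPP (\<lambda>l. pPP (e \<eta> (a \<triangleright> \<iota> (v l))) (e (\<mu> l) m)) L"
  have ec: "e \<eta> (a \<triangleright> \<iota> (v l)) \<in> carrier A'" if "a \<in> carrier A" "l < L" for a l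
    using that v by (simp add: e_closed[OF \<eta>] M_l iota_closed)
  have "balanced BB RA M tPP ?h"
  proof (rule balancedI)
    fix m assume m: "m \<in> mcarrier M"
    show "addhom RA tPP (\<lambda>a. ?h a m)"
    proof (rule addhom_msum_fun[OF P.AA.abgrp_tens])
      fix l assume l: "l < L"
      show "addhom RA tPP (\<lambda>a. pPP (e \<eta> (a \<triangleright> \<iota> (v l))) (e (\<mu> l) m))"
        by (rule addhom_comp[OF addhom_comp[OF hom_l_arg[OF iota_closed[OF v[OF l]]] e_hom[OF \<eta>]]
              P.AA.addhom_pure_left]) (simp add: e_closed[OF mu_lhom[OF l]] m)
    qed
  next
    fix a assume a: "a \<in> mcarrier RA"
    show "addhom M tPP (?h a)"
    proof (rule addhom_msum_fun[OF P.AA.abgrp_tens])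
      fix l assume l: "l < L"
      show "addhom M tPP (\<lambda>m. pPP (e \<eta> (a \<triangleright> \<iota> (v l))) (e (\<mu> l) m))"
        by (rule addhom_comp[OF e_hom[OF mu_lhom[OF l]] P.AA.addhom_pure_right]) (use a l ec in simp)
    qed
  next
    fix a b m assume "a \<in> mcarrier RA" "b \<in> carrier BB" "m \<in> mcarrier M"
    then have a: "a \<in> carrier A" and b: "b \<in> B" "b \<in> carrier A" and m: "m \<in> mcarrier M"
      by (simp_all add: E.B_sub)
    \<comment> \<open>\<open>slide\<close> is applied to \<open>b\<close> times \<open>v l\<close>;
      \<open>cc_mult\<close> and \<open>iota_e\<close> then collect \<open>b\<close> and
      \<open>\<mu> l (v l)\<close> in the second factor.\<close>
    have "?h (a \<otimes>\<^bsub>A\<^esub> b) m = msum tPP (\<lambda>l. msum tPP (\<lambda>r.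
        pPP (e \<eta> (a \<triangleright> \<iota> (v r))) (e (\<mu> r) ((b \<otimes>\<^bsub>A\<^esub> \<mu> l (v l)) \<triangleright> m))) L) L"
    proof (rule msum_cong)
      fix l assume l: "l < L"
      have "(a \<otimes>\<^bsub>A\<^esub> b) \<triangleright> \<iota> (v l) = a \<triangleright> \<iota> (lsmult N b (v l))"
        using a b v[OF l] by (simp add: M_l iota_closed iota_l)
      then have "pPP (e \<eta> ((a \<otimes>\<^bsub>A\<^esub> b) \<triangleright> \<iota> (v l))) (e (\<mu> l) m) = msum tPP (\<lambda>r.
          pPP (e \<eta> (a \<triangleright> \<iota> (v r))) (cc r (lsmult N b (v l)) \<otimes>\<^bsub>A'\<^esub> e (\<mu> l) m)) L"
        using slide[OF \<eta> a _ e_closed[OF mu_lhom[OF l] m]] b v[OF l] by (simp add: N_l)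
      also have "\<dots> = msum tPP (\<lambda>r. pPP (e \<eta> (a \<triangleright> \<iota> (v r))) (e (\<mu> r) ((b \<otimes>\<^bsub>A\<^esub> \<mu> l (v l)) \<triangleright> m))) L"
        using b m v[OF l] l
        by (intro msum_cong) (simp add: cc_mult N_l e_closed[OF mu_lhom] iota_e[OF mu_lhom] nu[OF mu_lhom])
      finally show "pPP (e \<eta> ((a \<otimes>\<^bsub>A\<^esub> b) \<triangleright> \<iota> (v l))) (e (\<mu> l) m) =
        msum tPP (\<lambda>r. pPP (e \<eta> (a \<triangleright> \<iota> (v r))) (e (\<mu> r) ((b \<otimes>\<^bsub>A\<^esub> \<mu> l (v l)) \<triangleright> m))) L" .
    qed
    also have "\<dots> = msum tPP (\<lambda>r. msum tPP (\<lambda>l.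
        pPP (e \<eta> (a \<triangleright> \<iota> (v r))) (e (\<mu> r) ((b \<otimes>\<^bsub>A\<^esub> \<mu> l (v l)) \<triangleright> m))) L) L"
      using a b m v nu[OF mu_lhom]
      by (intro msum_swap[OF P.AA.abgrp_tens] pPP_closed ec e_closed[OF mu_lhom] M_l(1)) simp_all
    \<comment> \<open>After the interchange the inner index occurs only in
      \<open>\<mu> l (v l)\<close>, whose sum is 1.\<close>
    also have "\<dots> = ?h a (b \<triangleright> m)"
    proof (rule msum_cong)
      fix r assume r: "r < L"
      have "addhom RA tPP (\<lambda>a'. pPP (e \<eta> (a \<triangleright> \<iota> (v r))) (e (\<mu> r) ((b \<otimes>\<^bsub>A\<^esub> a') \<triangleright> m)))"
        by (rule addhom_comp[OF addhom_comp[OF addhom_comp[OF E.ring_addhom(1)[OF b(2)] hom_l_arg[OF m]]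
              e_hom[OF mu_lhom[OF r]]] P.AA.addhom_pure_right]) (use a r ec in simp)
      from mu_unit[OF P.AA.abgrp_tens this]
      show "msum tPP (\<lambda>l. pPP (e \<eta> (a \<triangleright> \<iota> (v r))) (e (\<mu> r) ((b \<otimes>\<^bsub>A\<^esub> \<mu> l (v l)) \<triangleright> m))) L =
          pPP (e \<eta> (a \<triangleright> \<iota> (v r))) (e (\<mu> r) (b \<triangleright> m))"
        using b by simp
    qed
    finally show "?h (rsmult RA a b) m = ?h a (lsmult M b m)" by simp
  qed
  then obtain \<phi> where "addhom tAM tPP \<phi>" "\<And>a m. a \<in> mcarrier RA \<Longrightarrow> m \<in> mcarrier M \<Longrightarrow> \<phi> (pAM a m) = ?h a m"
    using AM.tens_universal[OF P.AA.abgrp_tens] by blast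
  then have "\<exists>\<phi>. addhom tAM tPP \<phi> \<and> (\<forall>a\<in>carrier A. \<forall>m\<in>mcarrier M. \<phi> (pAM a m) = ?h a m)"
    by (intro exI[of _ \<phi>]) simp
  from someI_ex[OF this] show "addhom tAM tPP (\<Phi> \<eta>)"
    "a \<in> carrier A \<Longrightarrow> m \<in> mcarrier M \<Longrightarrow> \<Phi> \<eta> (pAM a m) = ?h a m"
    unfolding \<Phi>_def by blast+
qed

lemma Phi_closed: "w \<in> mcarrier tAM \<Longrightarrow> \<Phi> \<eta> w \<in> mcarrier tPP"
  using addhom_closed[OF Phi(1)] .

text \<open>On a generator of \<open>M\<close>, the sum defining \<open>\<Phi> \<eta>\<close> is the
  right side of \<open>slide\<close>, by \<open>cc_mult\<close>.\<close>

lemma Phi_E: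
  assumes "m \<in> mcarrier M" "d \<in> carrier A'"
  shows "\<Phi> \<eta> (E d m) = pPP (e \<eta> m) d"
proof (rule M_hom_eqI[OF addhom_comp[OF E(1) Phi(1)] addhom_comp[OF e_hom[OF \<eta>] P.AA.addhom_pure_left]])
  fix a x assume ax: "a \<in> carrier A" "x \<in> mcarrier N"
  show "\<Phi> \<eta> (E d (a \<triangleright> \<iota> x)) = pPP (e \<eta> (a \<triangleright> \<iota> x)) d"
    unfolding slide[OF \<eta> ax assms(2)] using ax assms(2)
    by (simp add: E Phi M_r iota_closed cc_mult cong: msum_cong)
qed (use assms in simp_all)

text \<open>For a \<otimes> m, the first factor of each summand turns \<open>\<iota> x\<close> into
  \<open>\<eta> x\<close> times a times \<open>\<iota> (v l)\<close>. Then \<open>E\<close> leaves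
  \<open>\<mu> l (v l)\<close> as a coefficient of m, and summing over \<open>l\<close> removes
  it.\<close>

lemma Theta_Phi:
  assumes x: "x \<in> mcarrier N" and w: "w \<in> mcarrier tAM"
  shows "\<Theta> (\<iota> x) (\<Phi> \<eta> w) = lsmult tAM (\<eta> x) w"
proof (rule AM.tens_hom_eqI[OF addhom_comp[OF Phi(1) Theta(1)] AM.addhom_lsmult w])
  fix a m assume "a \<in> mcarrier RA" and m: "m \<in> mcarrier M"
  then have a: "a \<in> carrier A" by simp
  note \<eta>x = nu(2)[OF \<eta> x]
  have "\<Theta> (\<iota> x) (\<Phi> \<eta> (pAM a m)) =
      msum tAM (\<lambda>l. \<Theta> (\<iota> x) (pPP (e \<eta> (a \<triangleright> \<iota> (v l))) (e (\<mu> l) m))) L"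
    unfolding Phi(2)[OF a m] using a m v
    by (intro addhom_msum[OF P.AA.abgrp_tens AM.abgrp_tens Theta(1)])
      (simp_all add: iota_closed x pPP_closed e_closed[OF \<eta>] e_closed[OF mu_lhom] M_l)
  also have "\<dots> = msum tAM (\<lambda>l. pAM (\<eta> x \<otimes>\<^bsub>A\<^esub> a) (\<mu> l (v l) \<triangleright> m)) L"
  proof (rule msum_cong)
    fix l assume l: "l < L"
    have "\<iota> x \<triangleleft> e \<eta> (a \<triangleright> \<iota> (v l)) = (\<eta> x \<otimes>\<^bsub>A\<^esub> a) \<triangleright> \<iota> (v l)"
      using a x v[OF l] \<eta>x by (simp add: iota_e[OF \<eta>] M_l iota_closed)
    then show "\<Theta> (\<iota> x) (pPP (e \<eta> (a \<triangleright> \<iota> (v l))) (e (\<mu> l) m)) = pAM (\<eta> x \<otimes>\<^bsub>A\<^esub> a) (\<mu> l (v l) \<triangleright> m)"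
      using a x v[OF l] l m \<eta>x
      by (simp add: Theta iota_closed e_closed[OF \<eta>] e_closed[OF mu_lhom] M_l(1) E iota_e[OF mu_lhom])
  qed
  also have "\<dots> = pAM (\<eta> x \<otimes>\<^bsub>A\<^esub> a) (\<one>\<^bsub>A\<^esub> \<triangleright> m)"
    using a \<eta>x by (intro mu_unit[OF AM.abgrp_tens] addhom_comp[OF hom_l_arg[OF m] AM.addhom_pure_right]) simp
  also have "\<dots> = lsmult tAM (\<eta> x) (pAM a m)"
    using a m \<eta>x by (simp add: M_l AM.lsmult_pure)
  finally show "\<Theta> (\<iota> x) (\<Phi> \<eta> (pAM a m)) = lsmult tAM (\<eta> x) (pAM a m)" .
qed (use x nu(2)[OF \<eta>] in \<open>simp_all add: iota_closed\<close>)

end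

text \<open>By \<open>Phi_E\<close>, c \<otimes> d goes to the sum of the
  \<open>e (\<nu> k) (\<iota> (u k) \<triangleleft> c)\<close>, tensored with d. That sum is c, as
  the dual basis property shows on each \<open>\<iota> x\<close>.\<close>

lemma Phi_Theta:
  assumes z: "z \<in> mcarrier tPP"
  shows "msum tPP (\<lambda>k. \<Phi> (\<nu> k) (\<Theta> (\<iota> (u k)) z)) K = z"
proof (rule P.AA.tens_hom_eqI[OF _ _ z])
  show "addhom tPP tPP (\<lambda>z. msum tPP (\<lambda>k. \<Phi> (\<nu> k) (\<Theta> (\<iota> (u k)) z)) K)"
    by (rule addhom_msum_fun[OF P.AA.abgrp_tens])
      (use u in \<open>simp add: addhom_comp[OF Theta(1) Phi(1)[OF nu_lhom]] iota_closed\<close>)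
  show "addhom tPP tPP (\<lambda>z. z)" by (simp add: addhom_def)
  fix c d assume "c \<in> mcarrier RA'" "d \<in> mcarrier RA'"
  then have cd: "c \<in> carrier A'" "d \<in> carrier A'" by simp_all
  have ek: "e (\<nu> k) (\<iota> (u k) \<triangleleft> c) \<in> carrier A'" if "k < K" for k
    using that u cd by (simp add: e_closed[OF nu_lhom] M_r iota_closed)
  have "msum tPP (\<lambda>k. \<Phi> (\<nu> k) (\<Theta> (\<iota> (u k)) (pPP c d))) K = msum tPP (\<lambda>k. pPP (e (\<nu> k) (\<iota> (u k) \<triangleleft> c)) d) K"
    using cd u by (intro msum_cong) (simp add: Theta Phi_E[OF nu_lhom] iota_closed M_r)
  also have "\<dots> = pPP (msum RA' (\<lambda>k. e (\<nu> k) (\<iota> (u k) \<triangleleft> c)) K) d"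
    using cd ek by (intro addhom_msum[OF abRA' P.AA.abgrp_tens P.AA.addhom_pure_left, symmetric]) simp_all
  also have "msum RA' (\<lambda>k. e (\<nu> k) (\<iota> (u k) \<triangleleft> c)) K = c"
  proof (rule A'_unique)
    show "msum RA' (\<lambda>k. e (\<nu> k) (\<iota> (u k) \<triangleleft> c)) K \<in> carrier A'"
      using msum_closed[OF abRA', of K] ek by simp
    fix x assume x: "x \<in> mcarrier N"
    have "\<iota> x \<triangleleft> msum RA' (\<lambda>k. e (\<nu> k) (\<iota> (u k) \<triangleleft> c)) K = msum M (\<lambda>k. \<iota> x \<triangleleft> e (\<nu> k) (\<iota> (u k) \<triangleleft> c)) K"
      using ek by (intro addhom_msum[OF abRA' abM hom_r_arg[OF iota_closed[OF x]]]) simp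
    also have "\<dots> = msum M (\<lambda>k. \<iota> (lsmult N (\<nu> k x) (u k)) \<triangleleft> c) K"
      using x u cd
      by (intro msum_cong) (simp add: iota_e[OF nu_lhom] M_r iota_closed iota_l nu[OF nu_lhom] M_assoc)
    also have "\<dots> = \<iota> x \<triangleleft> c"
      by (rule nu_expand[OF abM addhom_comp[OF iota_hom hom_r[OF cd(1)]] x])
    finally show "\<iota> x \<triangleleft> msum RA' (\<lambda>k. e (\<nu> k) (\<iota> (u k) \<triangleleft> c)) K = \<iota> x \<triangleleft> c" .
  qed (rule cd)
  finally show "msum tPP (\<lambda>k. \<Phi> (\<nu> k) (\<Theta> (\<iota> (u k)) (pPP c d))) K = pPP c d" .
qed

text \<open>\<open>Phi_Theta\<close> recovers a tensor from its values at the
  \<open>\<iota> (u k)\<close>. The equations for the transported tensors are all checked through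
  this.\<close>

lemma Theta_inj:
  assumes "z \<in> mcarrier tPP" "w \<in> mcarrier tPP" "\<And>x. x \<in> mcarrier N \<Longrightarrow> \<Theta> (\<iota> x) z = \<Theta> (\<iota> x) w"
  shows "z = w"
proof -
  have "msum tPP (\<lambda>k. \<Phi> (\<nu> k) (\<Theta> (\<iota> (u k)) z)) K = msum tPP (\<lambda>k. \<Phi> (\<nu> k) (\<Theta> (\<iota> (u k)) w)) K"
    using assms(3) u by (intro msum_cong) simp
  then show ?thesis using assms(1,2) by (simp add: Phi_Theta)
qed

section \<open>Transport of the central tensors and of the depth two equations\<close>

definition \<sigma> :: "('a \<times> 'a \<Rightarrow> int) set \<Rightarrow> ('b \<times> 'b \<Rightarrow> int) set" where
  "\<sigma> t = msum tPP (\<lambda>k. \<Phi> (\<nu> k) (\<rho> (\<iota> (u k)) t)) K"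

lemma sigma_closed: "t \<in> mcarrier tAA \<Longrightarrow> \<sigma> t \<in> mcarrier tPP"
  unfolding \<sigma>_def using u
  by (intro msum_closed[OF P.AA.abgrp_tens]) (simp add: Phi_closed[OF nu_lhom] rho_closed iota_closed)

text \<open>\<open>Theta_Phi\<close> produces \<open>\<nu> k x\<close> on the left of
  \<open>t\<close>. Centrality moves it to the right, where it scales \<open>u k\<close>, and the
  dual basis sums these vectors to \<open>x\<close>.\<close>

lemma Theta_sigma:
  assumes t: "t \<in> mcarrier tAA" and central: "\<And>b. b \<in> B \<Longrightarrow> lsmult tAA b t = rsmult tAA t b"
    and x: "x \<in> mcarrier N"
  shows "\<Theta> (\<iota> x) (\<sigma> t) = \<rho> (\<iota> x) t"
proof -
  have "\<Theta> (\<iota> x) (\<sigma> t) = msum tAM (\<lambda>k. \<Theta> (\<iota> x) (\<Phi> (\<nu> k) (\<rho> (\<iota> (u k)) t))) K"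
    unfolding \<sigma>_def using u t
    by (intro addhom_msum[OF P.AA.abgrp_tens AM.abgrp_tens Theta(1)])
      (simp_all add: Phi_closed[OF nu_lhom] rho_closed iota_closed x)
  also have "\<dots> = msum tAM (\<lambda>k. \<rho> (\<iota> (lsmult N (\<nu> k x) (u k))) t) K"
  proof (rule msum_cong)
    fix k assume k: "k < K"
    note b = nu(1,2)[OF nu_lhom[OF k] x] and uk = iota_closed[OF u[OF k]]
    have "\<Theta> (\<iota> x) (\<Phi> (\<nu> k) (\<rho> (\<iota> (u k)) t)) = \<rho> (\<iota> (u k)) (lsmult tAA (\<nu> k x) t)"
      using x b uk t by (simp add: Theta_Phi[OF nu_lhom[OF k]] rho_closed rho_left)
    also have "\<dots> = \<rho> (\<iota> (lsmult N (\<nu> k x) (u k))) t"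
      using b uk t u[OF k] by (simp add: central rho_right iota_l)
    finally show "\<Theta> (\<iota> x) (\<Phi> (\<nu> k) (\<rho> (\<iota> (u k)) t)) = \<rho> (\<iota> (lsmult N (\<nu> k x) (u k))) t" .
  qed
  also have "\<dots> = \<rho> (\<iota> x) t"
    by (rule nu_expand[OF AM.abgrp_tens addhom_comp[OF iota_hom rho_hom_arg[OF t]] x])
  finally show ?thesis .
qed

context
  fixes n \<beta> t assumes d: "d2_data A B n \<beta> t"
begin

lemma data:
  assumes "i < n"
  shows "bhom BB BB RA RA (\<beta> i)" "t i \<in> mcarrier tAA" "b \<in> B \<Longrightarrow> lsmult tAA b (t i) = rsmult tAA (t i) b"
  using d assms by (simp_all add: d2_data_def)

lemma Theta_sigma_data: "i < n \<Longrightarrow> x \<in> mcarrier N \<Longrightarrow> \<Theta> (\<iota> x) (\<sigma> (t i)) = \<rho> (\<iota> x) (t i)"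
  using Theta_sigma[OF data(2,3)] .

text \<open>For centrality over \<open>B'\<close>: under \<open>\<Theta>\<close> a left factor
  \<open>b\<close> replaces \<open>x\<close> by \<open>x\<close> times \<open>b\<close>, and a right
  factor does the same by \<open>rho_act\<close>.\<close>

lemma transport_data: "d2_data A' B' n (\<lambda>i. \<gamma> (\<beta> i)) (\<lambda>i. \<sigma> (t i))"
  unfolding d2_data_def
proof (intro allI impI conjI ballI)
  fix i assume i: "i < n"
  show "bhom BB' BB' RA' RA' (\<gamma> (\<beta> i))" by (rule gamma_bhom[OF data(1)[OF i]])
  show s: "\<sigma> (t i) \<in> mcarrier tPP" by (rule sigma_closed[OF data(2)[OF i]])
  fix b assume b: "b \<in> B'"
  show "lsmult tPP b (\<sigma> (t i)) = rsmult tPP (\<sigma> (t i)) b"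
  proof (rule Theta_inj)
    fix x assume x: "x \<in> mcarrier N"
    have "\<Theta> (\<iota> x) (lsmult tPP b (\<sigma> (t i))) = \<Theta> (\<iota> (rsmult N x b)) (\<sigma> (t i))"
      using b x s by (simp add: Theta_left iota_closed P.B_sub iota_r)
    also have "\<dots> = \<rho> (\<iota> (rsmult N x b)) (t i)"
      using b x by (simp add: Theta_sigma_data[OF i] N_r)
    also have "\<dots> = \<Theta> (\<iota> x) (rsmult tPP (\<sigma> (t i)) b)"
      using b x s data(2)[OF i]
      by (simp add: Theta_sigma_data[OF i] Theta_right iota_closed P.B_sub rho_act iota_r)
    finally show "\<Theta> (\<iota> x) (lsmult tPP b (\<sigma> (t i))) = \<Theta> (\<iota> x) (rsmult tPP (\<sigma> (t i)) b)" .
  qed (use s b in \<open>simp_all add: P.AA_l P.AA_r P.B_sub\<close>)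
qed

lemma s_closed: "i < n \<Longrightarrow> \<sigma> (t i) \<in> mcarrier tPP"
  by (rule sigma_closed[OF data(2)])

text \<open>Applying \<open>\<Theta>\<close> turns the claim into \<open>key\<close> at
  \<open>\<iota> x \<triangleleft> c\<close>. On generators
  \<open>a \<triangleright> \<iota> x\<close>, \<open>key\<close> is the hypothesis
  \<open>eq\<close> contracted with \<open>\<iota> x\<close> by \<open>\<rho>\<close>.\<close>

lemma transport_left:
  assumes eq: "\<And>a. a \<in> carrier A \<Longrightarrow> msum tAA (\<lambda>i. rsmult tAA (t i) (\<beta> i a)) n = pAA a \<one>\<^bsub>A\<^esub>"
    and c: "c \<in> carrier A'"
  shows "msum tPP (\<lambda>i. rsmult tPP (\<sigma> (t i)) (\<gamma> (\<beta> i) c)) n = pPP c \<one>\<^bsub>A'\<^esub>"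
proof (rule Theta_inj)
  have cl: "rsmult tPP (\<sigma> (t i)) (\<gamma> (\<beta> i) c) \<in> mcarrier tPP" if "i < n" for i
    using that c by (simp add: P.AA_r s_closed gamma_closed[OF data(1)])
  show "msum tPP (\<lambda>i. rsmult tPP (\<sigma> (t i)) (\<gamma> (\<beta> i) c)) n \<in> mcarrier tPP"
    using cl by (rule msum_closed[OF P.AA.abgrp_tens])
  show "pPP c \<one>\<^bsub>A'\<^esub> \<in> mcarrier tPP" using c by (simp add: pPP_closed)
  \<comment> \<open>\<open>E\<close> at the identity sends
    \<open>a \<triangleright> \<iota> x\<close> to a \<otimes> \<open>\<iota> x\<close>, which is
    the contraction of a \<otimes> 1 with \<open>\<iota> x\<close>.\<close>
  have key: "msum tAM (\<lambda>i. \<rho> (lift (\<beta> i) m) (t i)) n = E \<one>\<^bsub>A'\<^esub> m" if m: "m \<in> mcarrier M" for m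
  proof (rule M_hom_eqI[OF addhom_msum_fun[OF AM.abgrp_tens] E(1) m])
    show "addhom M tAM (\<lambda>m. \<rho> (lift (\<beta> i) m) (t i))" if "i < n" for i
      by (rule addhom_comp[OF lift(1)[OF data(1)[OF that]] rho_hom_arg[OF data(2)[OF that]]])
    fix a x assume ax: "a \<in> carrier A" "x \<in> mcarrier N"
    have "msum tAM (\<lambda>i. \<rho> (lift (\<beta> i) (a \<triangleright> \<iota> x)) (t i)) n = msum tAM (\<lambda>i. \<rho> (\<iota> x) (rsmult tAA (t i) (\<beta> i a))) n"
      using ax by (intro msum_cong) (simp add: lift[OF data(1)] rho_right data beta[OF data(1)] iota_closed)
    also have "\<dots> = \<rho> (\<iota> x) (msum tAA (\<lambda>i. rsmult tAA (t i) (\<beta> i a)) n)"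
      using ax by (intro addhom_msum[OF E.AA.abgrp_tens AM.abgrp_tens rho(1), symmetric])
        (simp_all add: iota_closed E.AA_r data beta[OF data(1)])
    also have "\<dots> = E \<one>\<^bsub>A'\<^esub> (a \<triangleright> \<iota> x)"
      using ax by (simp add: eq rho E iota_closed M_l M_r)
    finally show "msum tAM (\<lambda>i. \<rho> (lift (\<beta> i) (a \<triangleright> \<iota> x)) (t i)) n = E \<one>\<^bsub>A'\<^esub> (a \<triangleright> \<iota> x)" .
  qed simp
  fix x assume x: "x \<in> mcarrier N"
  have "\<Theta> (\<iota> x) (msum tPP (\<lambda>i. rsmult tPP (\<sigma> (t i)) (\<gamma> (\<beta> i) c)) n) =
      msum tAM (\<lambda>i. \<Theta> (\<iota> x) (rsmult tPP (\<sigma> (t i)) (\<gamma> (\<beta> i) c))) n"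
    using cl by (rule addhom_msum[OF P.AA.abgrp_tens AM.abgrp_tens Theta(1)[OF iota_closed[OF x]]])
  also have "\<dots> = msum tAM (\<lambda>i. \<rho> (lift (\<beta> i) (\<iota> x \<triangleleft> c)) (t i)) n"
    using x c
    by (intro msum_cong) (simp add: Theta_right iota_closed s_closed gamma_closed[OF data(1)]
        Theta_sigma_data rho_act data(2) iota_gamma[OF data(1)])
  also have "\<dots> = \<Theta> (\<iota> x) (pPP c \<one>\<^bsub>A'\<^esub>)"
    using x c by (simp add: key M_r iota_closed Theta)
  finally show "\<Theta> (\<iota> x) (msum tPP (\<lambda>i. rsmult tPP (\<sigma> (t i)) (\<gamma> (\<beta> i) c)) n) = \<Theta> (\<iota> x) (pPP c \<one>\<^bsub>A'\<^esub>)" .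
qed

text \<open>The left factor \<open>\<gamma> (\<beta> i) c\<close> acts on the vector first, so
  \<open>key\<close> concerns \<open>\<Theta>\<close> at arbitrary vectors of \<open>M\<close>. On
  generators, \<open>Theta_lin\<close> pulls \<open>\<beta> i a\<close> out to the left of
  \<open>t i\<close>.\<close>

lemma transport_right:
  assumes eq: "\<And>a. a \<in> carrier A \<Longrightarrow> msum tAA (\<lambda>i. lsmult tAA (\<beta> i a) (t i)) n = pAA \<one>\<^bsub>A\<^esub> a"
    and c: "c \<in> carrier A'"
  shows "msum tPP (\<lambda>i. lsmult tPP (\<gamma> (\<beta> i) c) (\<sigma> (t i))) n = pPP \<one>\<^bsub>A'\<^esub> c"
proof (rule Theta_inj)
  have cl: "lsmult tPP (\<gamma> (\<beta> i) c) (\<sigma> (t i)) \<in> mcarrier tPP" if "i < n" for i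
    using that c by (simp add: P.AA_l s_closed gamma_closed[OF data(1)])
  show "msum tPP (\<lambda>i. lsmult tPP (\<gamma> (\<beta> i) c) (\<sigma> (t i))) n \<in> mcarrier tPP"
    using cl by (rule msum_closed[OF P.AA.abgrp_tens])
  show "pPP \<one>\<^bsub>A'\<^esub> c \<in> mcarrier tPP" using c by (simp add: pPP_closed)
  have key: "msum tAM (\<lambda>i. \<Theta> (lift (\<beta> i) m) (\<sigma> (t i))) n = pAM \<one>\<^bsub>A\<^esub> m" if m: "m \<in> mcarrier M" for m
  proof (rule M_hom_eqI[OF addhom_msum_fun[OF AM.abgrp_tens] AM.addhom_pure_right m])
    show "addhom M tAM (\<lambda>m. \<Theta> (lift (\<beta> i) m) (\<sigma> (t i)))" if "i < n" for i
      by (rule addhom_comp[OF lift(1)[OF data(1)[OF that]] Theta_hom_arg[OF s_closed[OF that]]])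
    fix a x assume ax: "a \<in> carrier A" "x \<in> mcarrier N"
    have "msum tAM (\<lambda>i. \<Theta> (lift (\<beta> i) (a \<triangleright> \<iota> x)) (\<sigma> (t i))) n = msum tAM (\<lambda>i. \<rho> (\<iota> x) (lsmult tAA (\<beta> i a) (t i))) n"
      using ax by (intro msum_cong)
        (simp add: lift[OF data(1)] Theta_lin s_closed Theta_sigma_data rho_left data beta[OF data(1)] iota_closed)
    also have "\<dots> = \<rho> (\<iota> x) (msum tAA (\<lambda>i. lsmult tAA (\<beta> i a) (t i)) n)"
      using ax by (intro addhom_msum[OF E.AA.abgrp_tens AM.abgrp_tens rho(1), symmetric])
        (simp_all add: iota_closed E.AA_l data beta[OF data(1)])
    also have "\<dots> = pAM \<one>\<^bsub>A\<^esub> (a \<triangleright> \<iota> x)"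
      using ax by (simp add: eq rho iota_closed)
    finally show "msum tAM (\<lambda>i. \<Theta> (lift (\<beta> i) (a \<triangleright> \<iota> x)) (\<sigma> (t i))) n = pAM \<one>\<^bsub>A\<^esub> (a \<triangleright> \<iota> x)" .
  qed simp
  fix x assume x: "x \<in> mcarrier N"
  have "\<Theta> (\<iota> x) (msum tPP (\<lambda>i. lsmult tPP (\<gamma> (\<beta> i) c) (\<sigma> (t i))) n) =
      msum tAM (\<lambda>i. \<Theta> (\<iota> x) (lsmult tPP (\<gamma> (\<beta> i) c) (\<sigma> (t i)))) n"
    using cl by (rule addhom_msum[OF P.AA.abgrp_tens AM.abgrp_tens Theta(1)[OF iota_closed[OF x]]])
  also have "\<dots> = msum tAM (\<lambda>i. \<Theta> (lift (\<beta> i) (\<iota> x \<triangleleft> c)) (\<sigma> (t i))) n"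
    using x c
    by (intro msum_cong) (simp add: Theta_left iota_closed s_closed gamma_closed[OF data(1)]
        iota_gamma[OF data(1)])
  \<comment> \<open>By \<open>E_iota\<close> the right side is 1 \<otimes>
    (\<open>\<iota> x \<triangleleft> c\<close>), the value given by \<open>key\<close>.\<close>
  also have "\<dots> = \<Theta> (\<iota> x) (pPP \<one>\<^bsub>A'\<^esub> c)"
    using x c by (simp add: key M_r iota_closed Theta E_iota)
  finally show "\<Theta> (\<iota> x) (msum tPP (\<lambda>i. lsmult tPP (\<gamma> (\<beta> i) c) (\<sigma> (t i))) n) = \<Theta> (\<iota> x) (pPP \<one>\<^bsub>A'\<^esub> c)" .
qed

end

lemma left_d2_transport:
  assumes "left_d2 A B" shows "left_d2 A' B'"
proof -
  obtain n \<beta> t where d: "d2_data A B n \<beta> t"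
    and eq: "\<And>a. a \<in> carrier A \<Longrightarrow> msum tAA (\<lambda>i. rsmult tAA (t i) (\<beta> i a)) n = pAA a \<one>\<^bsub>A\<^esub>"
    using E.left_d2_data[OF assms] by blast
  show ?thesis by (rule P.left_d2I[OF transport_data[OF d] transport_left[OF d eq]])
qed

lemma right_d2_transport:
  assumes "right_d2 A B" shows "right_d2 A' B'"
proof -
  obtain n \<beta> t where d: "d2_data A B n \<beta> t"
    and eq: "\<And>a. a \<in> carrier A \<Longrightarrow> msum tAA (\<lambda>i. lsmult tAA (\<beta> i a) (t i)) n = pAA \<one>\<^bsub>A\<^esub> a"
    using E.right_d2_data[OF assms] by blast
  show ?thesis by (rule P.right_d2I[OF transport_data[OF d] transport_right[OF d eq]])
qed

end

theorem theorem3p3: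
  fixes A :: "'a ring" and B :: "'a set" and A' :: "'b ring" and B' :: "'b set"
    and M :: "('a, 'b, 'm) bimod" and N :: "('a, 'b, 'n) bimod"
  assumes "ring A" and "subring B A" and "ring A'" and "subring B' A'"
    and "morita_equiv A B A' B' M N"
  shows "(left_d2 A B \<longrightarrow> left_d2 A' B') \<and> (right_d2 A B \<longrightarrow> right_d2 A' B')"
proof -
  interpret m: morita A B A' B' M N by (rule morita.intro[OF assms])
  let ?BB = "subr A B" and ?RB = "ring_bimod (subr A B)"
  have lRB: "leftmod ?BB ?RB"
    by (rule bimodule_left[OF bimodule_ring_bimod[OF ring.subring_is_ring[OF assms(1,2)]]])
  \<comment> \<open>That \<open>N\<close> is a summand of a power of \<open>B\<close> yields the
    dual basis; that \<open>B\<close> is a summand of a power of \<open>N\<close> yields the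
    generator data.\<close>
  have "ldvd ?BB N ?RB" "ldvd ?BB ?RB N" using m.mN by (simp_all add: morita_module_def lsim_def)
  note fam = ldvd_family[OF bimodule_left[OF m.bN] lRB this(1)] ldvd_family[OF lRB bimodule_left[OF m.bN] this(2)]
  obtain K \<nu> g where 1: "(\<forall>i<K::nat. lhom ?BB N ?RB (\<nu> i) \<and> lhom ?BB ?RB N (g i)) \<and>
      (\<forall>x\<in>mcarrier N. msum N (\<lambda>i. g i (\<nu> i x)) K = x)"
    using fam(1) by (elim exE)
  obtain L f \<mu> where 2: "(\<forall>i<L::nat. lhom ?BB ?RB N (f i) \<and> lhom ?BB N ?RB (\<mu> i)) \<and>
      (\<forall>x\<in>mcarrier ?RB. msum ?RB (\<lambda>i. \<mu> i (f i x)) L = x)"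
    using fam(2) by (elim exE)
  have one: "\<one>\<^bsub>A\<^esub> \<in> B" by (rule subringE(3)[OF assms(2)])
  \<comment> \<open>A left \<open>B\<close>-linear map out of \<open>B\<close> is determined by its
    value at 1, so \<open>u\<close> and \<open>v\<close> consist of the values at 1 of the maps into
    \<open>N\<close>.\<close>
  interpret morita_bases A B A' B' M N K L \<nu> \<mu> "\<lambda>k. g k \<one>\<^bsub>A\<^esub>" "\<lambda>l. f l \<one>\<^bsub>A\<^esub>"
  proof (intro morita_bases.intro morita_bases_axioms.intro m.morita_axioms)
    show "g k \<one>\<^bsub>A\<^esub> \<in> mcarrier N" if "k < K" for k using 1 that one by (simp add: lhom_def)
    show "f l \<one>\<^bsub>A\<^esub> \<in> mcarrier N" if "l < L" for l using 2 that one by (simp add: lhom_def)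
    show "msum N (\<lambda>k. lsmult N (\<nu> k x) (g k \<one>\<^bsub>A\<^esub>)) K = x" if x: "x \<in> mcarrier N" for x
    proof -
      have "msum N (\<lambda>k. lsmult N (\<nu> k x) (g k \<one>\<^bsub>A\<^esub>)) K = msum N (\<lambda>k. g k (\<nu> k x)) K"
      proof (rule msum_cong)
        fix k assume k: "k < K"
        have b: "\<nu> k x \<in> B" using 1 k x by (simp add: lhom_def)
        then have "g k (\<nu> k x \<otimes>\<^bsub>A\<^esub> \<one>\<^bsub>A\<^esub>) = lsmult N (\<nu> k x) (g k \<one>\<^bsub>A\<^esub>)"
          using 1 k one by (simp add: lhom_def)
        then show "lsmult N (\<nu> k x) (g k \<one>\<^bsub>A\<^esub>) = g k (\<nu> k x)" using b m.E.B_sub by simp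
      qed
      then show ?thesis using 1 x by simp
    qed
    \<comment> \<open>The generator equation is the splitting of \<open>B\<close> evaluated at
      1.\<close>
    show "msum (ring_bimod A) (\<lambda>l. \<mu> l (f l \<one>\<^bsub>A\<^esub>)) L = \<one>\<^bsub>A\<^esub>"
      using 2 one by (simp add: msum_ring_bimod_subr)
  qed (use 1 2 in simp_all)
  show ?thesis using left_d2_transport right_d2_transport by blast
qed

end
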